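(* Let $0\le q\le d$, let $\boldsymbol b,\boldsymbol d\in\mathcal S$ with $\boldsymbol b\le\boldsymbol d$, and assume that $\{(X_i,M_i)\}_{i\ge1}$ is an independently marked homogeneous Poisson point process. Then, as $n\to\infty$, $$\frac{\beta_{q,n}^{\boldsymbol b,\boldsymbol d}-\mathbb E\big[\beta_{q,n}^{\boldsymbol b,\boldsymbol d}\big]}{n^{d/2}}\Rightarrow Z$$ (convergence in distribution), where $Z$ is a centered normal random variable.
   Context: **Marked point process.** Fix $d\ge1$ and a positive integer $T$. $X=\{(X_i,M_i)\}_{i\ge1}$ is a marked point process with locations $X_i\in\mathbb R^d$ and marks $M_i\in[0,T]$. An independently marked homogeneous Poisson point process is one in which $\{X_i\}$ is a homogeneous Poisson point process of intensity $\lambda\in(0,\infty)$ and the marks $M_i$ are i.i.d. and independent of the locations. **Čech complex.** For a nonempty finite set $\sigma=\{x_0,\dots,x_p\}\subseteq\mathbb R^d$ let $r(\sigma):=\min\{t\ge0: B_t(x_0)\cap\cdots\cap B_t(x_p)\ne\varnothing\}$, where $B_t(y)$ is the closed Euclidean ball of radius $t$ around $y$. For $P\subseteq\mathbb R^d$, $\mathrm{Cech}_r(P)$ is the simplicial complex of all nonempty finite $\sigma\subseteq P$ with $r(\sigma)\le r$. **Multicover complex.** For $P\subseteq\mathbb R^d$, $r\ge0$ and an integer $k\ge1$, $\mathrm{Mult}_{(r,k)}(P)$ is the simplicial complex whose vertices are $k$-element subsets of $P$, and in which distinct $k$-element subsets $\varphi_0,\dots,\varphi_p\subseteq P$ form a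 $p$-simplex ($p\ge0$) if and only if $\varphi_0\cup\cdots\cup\varphi_p\in\mathrm{Cech}_r(P)$. **Multifiltration.** The index set is $\mathcal S:=[0,T]\times[0,T]\times\{1,\dots,T\}$, with $(r_1,r_2,k)\le(r_1',r_2',k')$ if and only if $r_1\le r_1'$, $r_2\le r_2'$ and $k\ge k'$ (reversed order in the last coordinate). For an integer $n\ge1$ and $(r_1,r_2,k)\in\mathcal S$ put $$\mathbb K_{(r_1,r_2,k),n}:=\mathrm{Mult}_{(r_1,k)}\big(\{X_i\in[0,n]^d: M_i\le r_2\}\big).$$ For $\boldsymbol a=(r_1,r_2,k)\le\boldsymbol a'=(r_1',r_2',k')$ the simplicial map $\mathbb K_{\boldsymbol a,n}\to\mathbb K_{\boldsymbol a',n}$ sends a vertex $\varphi$ (a $k$-element set) to the set of its $k'$ smallest elements in the lexicographic order of $\mathbb R^d$. **Persistent Betti numbers.** For $\boldsymbol b\le\boldsymbol d$ in $\mathcal S$, $$\beta_{q,n}^{\boldsymbol b,\boldsymbol d}:=\dim\,\mathrm{Im}\big(H_q(\mathbb K_{\boldsymbol b,n})\to H_q(\mathbb K_{\boldsymbol d,n})\big),$$ where $H_q$ is simplicial homology with $\mathbb Z/2$-coefficients. Convention: a centered normal random variable is allowed to be degenerate (variance zero). *)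

theory Defs
  imports
    "HOL-Probability.Probability"
    "HOL-Library.Z2"
    "HOL-Library.Poly_Mapping"
    "HOL-Algebra.AbelCoset"
    "Jordan_Normal_Form.VS_Connect"
begin

section \<open>Simplicial homology over \<open>\<int>/2\<close>\<close>

text \<open>
  An abstract simplicial complex is the set of its (nonempty, finite) simplices. A chain is a
  finitely supported function from simplices to the field \<^typ>\<open>bit\<close>.
\<close>

definition chain_module :: "'v set set \<Rightarrow> nat \<Rightarrow> (bit, 'v set \<Rightarrow>\<^sub>0 bit) module" where
  "chain_module K q = \<lparr> carrier = {c. Poly_Mapping.keys c \<subseteq> {\<sigma>\<in>K. finite \<sigma> \<and> card \<sigma> = q + 1}},
     mult = undefined, one = undefined, zero = 0, add = (+), smult = (\<lambda>a. Poly_Mapping.map ((*) a)) \<rparr>"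

text \<open>The homology is unreduced: the boundary of a vertex is \<open>0\<close>.\<close>

definition boundary_map :: "('v set \<Rightarrow>\<^sub>0 bit) \<Rightarrow> ('v set \<Rightarrow>\<^sub>0 bit)" where
  "boundary_map c = (\<Sum>\<sigma>\<in>Poly_Mapping.keys c. \<Sum>v\<in>\<sigma>.
     if \<sigma> = {v} then 0 else Poly_Mapping.single (\<sigma> - {v}) (Poly_Mapping.lookup c \<sigma>))"

text \<open>Simplices on which the vertex map is not injective are sent to \<open>0\<close>.\<close>

definition chain_map :: "('v \<Rightarrow> 'w) \<Rightarrow> ('v set \<Rightarrow>\<^sub>0 bit) \<Rightarrow> ('w set \<Rightarrow>\<^sub>0 bit)" where
  "chain_map f c = (\<Sum>\<sigma>\<in>Poly_Mapping.keys c.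
     if inj_on f \<sigma> then Poly_Mapping.single (f ` \<sigma>) (Poly_Mapping.lookup c \<sigma>) else 0)"

definition cycle_module :: "'v set set \<Rightarrow> nat \<Rightarrow> (bit, 'v set \<Rightarrow>\<^sub>0 bit) module" where
  "cycle_module K q =
     (chain_module K q)\<lparr>carrier := {c \<in> carrier (chain_module K q). boundary_map c = 0}\<rparr>"

definition boundaries :: "'v set set \<Rightarrow> nat \<Rightarrow> ('v set \<Rightarrow>\<^sub>0 bit) set" where
  "boundaries K q = boundary_map ` carrier (chain_module K (Suc q))"

definition quotient_module :: "('a, 'b) module \<Rightarrow> 'b set \<Rightarrow> ('a, 'b set) module" where
  "quotient_module V U = \<lparr> carrier = a_rcosets\<^bsub>V\<^esub> U,
     mult = undefined, one = undefined, zero = U, add = (<+>\<^bsub>V\<^esub>),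
     smult = (\<lambda>a A. \<Union>x\<in>A. U +>\<^bsub>V\<^esub> (a \<odot>\<^bsub>V\<^esub> x)) \<rparr>"

definition homology_module :: "'v set set \<Rightarrow> nat \<Rightarrow> (bit, ('v set \<Rightarrow>\<^sub>0 bit) set) module" where
  "homology_module K q = quotient_module (cycle_module K q) (boundaries K q)"

text \<open>
  The induced map \<open>H\<^sub>q(K) \<rightarrow> H\<^sub>q(L)\<close>; all representatives \<open>z\<close> of a class \<open>A\<close> give the same coset.
\<close>

definition homology_map ::
    "'w set set \<Rightarrow> nat \<Rightarrow> ('v \<Rightarrow> 'w) \<Rightarrow> ('v set \<Rightarrow>\<^sub>0 bit) set \<Rightarrow> ('w set \<Rightarrow>\<^sub>0 bit) set" where
  "homology_map L q f A = (\<Union>z\<in>A. boundaries L q +>\<^bsub>cycle_module L q\<^esub> chain_map f z)"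

definition homology_rank :: "'v set set \<Rightarrow> 'w set set \<Rightarrow> nat \<Rightarrow> ('v \<Rightarrow> 'w) \<Rightarrow> nat" where
  "homology_rank K L q f = vectorspace.dim class_ring
     ((homology_module L q)\<lparr>carrier := homology_map L q f ` carrier (homology_module K q)\<rparr>)"


section \<open>\v{C}ech and multicover complexes\<close>

definition cech_radius :: "(real ^ 'n) set \<Rightarrow> real" where
  "cech_radius \<sigma> = (LEAST t. 0 \<le> t \<and> (\<Inter>x\<in>\<sigma>. cball x t) \<noteq> {})"

definition Cech :: "real \<Rightarrow> (real ^ 'n) set \<Rightarrow> (real ^ 'n) set set" where
  "Cech r P = {\<sigma>. \<sigma> \<subseteq> P \<and> finite \<sigma> \<and> \<sigma> \<noteq> {} \<and> cech_radius \<sigma> \<le> r}"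

definition Mult :: "real \<Rightarrow> nat \<Rightarrow> (real ^ 'n) set \<Rightarrow> (real ^ 'n) set set set" where
  "Mult r k P = {\<Phi>. finite \<Phi> \<and> \<Phi> \<noteq> {} \<and> (\<forall>\<phi>\<in>\<Phi>. \<phi> \<subseteq> P \<and> finite \<phi> \<and> card \<phi> = k) \<and> \<Union>\<Phi> \<in> Cech r P}"

definition lex_less :: "real ^ 'n::{finite,linorder} \<Rightarrow> real ^ 'n::{finite,linorder} \<Rightarrow> bool" where
  "lex_less x y \<longleftrightarrow> (\<exists>i. x $ i < y $ i \<and> (\<forall>j<i. x $ j = y $ j))"

text \<open>The \<open>k\<close> lexicographically smallest elements of a finite set.\<close>

definition lex_smallest ::
    "nat \<Rightarrow> (real ^ 'n::{finite,linorder}) set \<Rightarrow> (real ^ 'n::{finite,linorder}) set" where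
  "lex_smallest k \<phi> = {x\<in>\<phi>. card {y\<in>\<phi>. lex_less y x} < k}"


section \<open>The multifiltration and its persistent Betti numbers\<close>

definition filtration_index :: "nat \<Rightarrow> (real \<times> real \<times> nat) set" where
  "filtration_index T = {0..real T} \<times> {0..real T} \<times> {1..T}"

text \<open>The order is reversed in the last coordinate.\<close>

definition filtration_le :: "real \<times> real \<times> nat \<Rightarrow> real \<times> real \<times> nat \<Rightarrow> bool" where
  "filtration_le = (\<lambda>(r1, r2, k) (r1', r2', k'). r1 \<le> r1' \<and> r2 \<le> r2' \<and> k' \<le> k)"

text \<open>
  A marked point configuration is given by the locations \<open>x i\<close> and marks \<open>m i\<close>, \<open>i :: nat\<close>.
\<close>

definition multicover_complex :: "(nat \<Rightarrow> real ^ 'n) \<Rightarrow> (nat \<Rightarrow> real) \<Rightarrow> nat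
    \<Rightarrow> real \<times> real \<times> nat \<Rightarrow> (real ^ 'n) set set set" where
  "multicover_complex x m n = (\<lambda>(r1, r2, k).
     Mult r1 k {x i | i. (\<forall>j. 0 \<le> x i $ j \<and> x i $ j \<le> real n) \<and> m i \<le> r2})"

definition persistent_betti :: "(nat \<Rightarrow> real ^ 'n::{finite,linorder}) \<Rightarrow> (nat \<Rightarrow> real) \<Rightarrow> nat
    \<Rightarrow> nat \<Rightarrow> real \<times> real \<times> nat \<Rightarrow> real \<times> real \<times> nat \<Rightarrow> nat" where
  "persistent_betti x m n q b d =
     homology_rank (multicover_complex x m n b) (multicover_complex x m n d) q
       (lex_smallest (snd (snd d)))"


section \<open>Independently marked Poisson processes\<close>

text \<open>
  A marked point process is an enumerated random configuration. As usual for point processes,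
  local finiteness is required for every outcome, not only almost surely; this makes all quantities
  above, which depend on the points in a bounded window, well defined everywhere.
\<close>

definition marked_point_process ::
    "'w measure \<Rightarrow> (nat \<Rightarrow> 'w \<Rightarrow> real ^ 'n) \<Rightarrow> (nat \<Rightarrow> 'w \<Rightarrow> real) \<Rightarrow> nat \<Rightarrow> bool" where
  "marked_point_process M X mark T \<longleftrightarrow> prob_space M
     \<and> (\<forall>i. X i \<in> borel_measurable M) \<and> (\<forall>i. mark i \<in> borel_measurable M)
     \<and> (\<forall>\<omega>\<in>space M. \<forall>i. 0 \<le> mark i \<omega> \<and> mark i \<omega> \<le> real T)
     \<and> (\<forall>\<omega>\<in>space M. \<forall>A. bounded A \<longrightarrow> finite {i. X i \<omega> \<in> A})"

definition point_count :: "(nat \<Rightarrow> 'w \<Rightarrow> 'a) \<Rightarrow> 'a set \<Rightarrow> 'w \<Rightarrow> nat" where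
  "point_count X A \<omega> = card {i. X i \<omega> \<in> A}"

text \<open>
  The number of points in a bounded Borel set \<open>A\<close> is Poisson distributed with parameter \<open>l * vol A\<close>;
  the formula (with \<open>0 ^ 0 = 1\<close>) includes the case of a null set, which \<^const>\<open>poisson_pmf\<close> does not.
\<close>

definition homogeneous_poisson_process ::
    "'w measure \<Rightarrow> (nat \<Rightarrow> 'w \<Rightarrow> real ^ 'n) \<Rightarrow> real \<Rightarrow> bool" where
  "homogeneous_poisson_process M X l \<longleftrightarrow>
     (\<forall>A k. A \<in> sets borel \<longrightarrow> bounded A \<longrightarrow>
        measure M {\<omega>\<in>space M. point_count X A \<omega> = k}
          = (l * measure lborel A) ^ k / fact k * exp (- (l * measure lborel A)))
     \<and> (\<forall>(A :: nat \<Rightarrow> (real ^ 'n) set) J. finite J \<longrightarrow> disjoint_family_on A J \<longrightarrow>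
        (\<forall>j\<in>J. A j \<in> sets borel \<and> bounded (A j)) \<longrightarrow>
        prob_space.indep_vars M (\<lambda>_. count_space UNIV) (\<lambda>j. point_count X (A j)) J)"

text \<open>
  Independence of marks and locations is that of the generated \<open>\<sigma>\<close>-algebras
  (\<^const>\<open>prob_space.indep_var\<close> requires the two random variables to have the same type).
\<close>

definition independently_marked_poisson :: "'w measure \<Rightarrow> (nat \<Rightarrow> 'w \<Rightarrow> real ^ 'n)
    \<Rightarrow> (nat \<Rightarrow> 'w \<Rightarrow> real) \<Rightarrow> nat \<Rightarrow> real \<Rightarrow> bool" where
  "independently_marked_poisson M X mark T l \<longleftrightarrow>
     marked_point_process M X mark T
     \<and> 0 < l \<and> homogeneous_poisson_process M X l
     \<and> prob_space.indep_vars M (\<lambda>_. borel) mark UNIV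
     \<and> (\<forall>i j. distr M borel (mark i) = distr M borel (mark j))
     \<and> prob_space.indep_set M
         (sets (vimage_algebra (space M) (\<lambda>\<omega> i. X i \<omega>) (Pi\<^sub>M UNIV (\<lambda>_. borel))))
         (sets (vimage_algebra (space M) (\<lambda>\<omega> i. mark i \<omega>) (Pi\<^sub>M UNIV (\<lambda>_. borel))))"


section \<open>Centered normal distributions, including the degenerate one\<close>

definition centered_normal :: "real \<Rightarrow> real measure" where
  "centered_normal s = (if s = 0 then return borel 0 else density lborel (normal_density 0 s))"

end

theory Submission imports Defs begin

text \<open>
  A persistent Betti number of the points in a large box is a sum, up to a small error, of independent
  identically distributed contributions of sub-boxes. The two facts behind this are that the number is
  stable under local changes of the point set, and that a Poisson process splits into independent cells.

  Local stability comes from counting. Over \<open>\<int>/2\<close> the rank of a map in homology is a combination of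
  binary logarithms of cardinalities of three groups of chains, each cut out by linear equations and a
  bound on the support (\<open>homology_rank_eq\<close>). Deleting a set \<open>S\<close> of simplices divides the cardinality of such
  a group by the number of traces that its members leave on \<open>S\<close> (\<open>homology_rank_increment\<close>). For the
  simplices that meet one unit cell, the set of traces grows with the complex and, because simplices have
  bounded diameter, stays inside a finite set that depends only on the points near this cell. Hence the
  change of the Betti number caused by emptying one cell becomes constant once the window is large
  (\<open>betti_stabilizes\<close>), and at every stage it has a bound that depends only on nearby cells
  (\<open>betti_increment_bound\<close>). The bound has a second moment since Poisson variables have exponential moments.

  Independence comes from void probabilities. The probability that no point falls into given regions with
  given marks factorizes over disjoint regions (\<open>avoid\<close>), void events generate the \<open>\<sigma>\<close>-algebra of
  configurations, and so the configurations in the unit cells, translated to the origin, are independent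
  and identically distributed (\<open>distr_cells\<close>). Betti numbers are measurable for this \<open>\<sigma>\<close>-algebra because
  numbers of tuples of points with a given measurable property are
  (\<open>random_set_functional_measurable\<close>) and a Betti number depends only on finitely much
  combinatorial information about an enumeration of the points (\<open>pattern_determines_betti\<close>).

  The rest concerns any translation covariant functional of an independent lattice field with increments
  that stabilize and have a square integrable bound. The Efron--Stein inequality shows that replacing the
  functional on a cube of side \<open>n\<close> by the sum over sub-cubes of side \<open>L\<close> costs a variance of order
  \<open>\<epsilon>\<^sub>L n\<^sup>d\<close> with \<open>\<epsilon>\<^sub>L \<rightarrow> 0\<close> (\<open>variance_block_error\<close>): only sites near a sub-cube boundary and sites
  whose increment has not yet stabilized contribute. Sums over sub-cubes are sums of independent terms with
  normal limits, and comparing characteristic functions carries the limit over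
  (\<open>central_limit_char\<close>). Levy's continuity theorem finishes the proof.
\<close>

(* Here $ and \<bullet> stand for components and inner products of vectors in real ^ 'n. *)
no_notation Matrix.vec_index (infixl "$" 100)
no_notation Matrix.scalar_prod (infix "\<bullet>" 70)

section \<open>Counting in groups of exponent two\<close>

text \<open>Closure under addition and exponent two make this a subgroup of the ambient type; over \<open>\<int>/2\<close> it is a subspace.\<close>
definition binary_group :: "'c::ab_group_add set \<Rightarrow> bool" where
  "binary_group V \<longleftrightarrow> 0 \<in> V \<and> (\<forall>v\<in>V. \<forall>w\<in>V. v + w \<in> V) \<and> (\<forall>v\<in>V. v + v = 0)"

text \<open>The hypothesis on \<open>\<phi>\<close> says that its fibres are the cosets of \<open>E\<close>, and these all have the same size.\<close>
lemma card_fibres: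
  assumes V: "binary_group V" "finite V"
    and E: "E \<subseteq> V" and \<phi>: "\<And>v w. v \<in> V \<Longrightarrow> w \<in> V \<Longrightarrow> \<phi> v = \<phi> w \<longleftrightarrow> v + w \<in> E"
  shows "card V = card (\<phi> ` V) * card E"
proof -
  have add: "v + w \<in> V" "v + v = 0" if "v \<in> V" "w \<in> V" for v w
    using V that unfolding binary_group_def by blast+
  have fibre: "card {w \<in> V. \<phi> w = y} = card E" if y: "y \<in> \<phi> ` V" for y
  proof -
    obtain v where v: "v \<in> V" "y = \<phi> v" using y by blast
    have vv: "v + (v + w) = w" for w using add(2)[OF v(1) v(1)] by (simp flip: add.assoc)
    have "{w \<in> V. \<phi> w = y} = (\<lambda>e. v + e) ` E"
    proof (intro equalityI subsetI)
      fix w assume "w \<in> {w \<in> V. \<phi> w = y}"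
      then have "v + w \<in> E" using \<phi>[OF v(1), of w] v(2) by auto
      then show "w \<in> (\<lambda>e. v + e) ` E" by (intro image_eqI[of _ _ "v + w"]) (simp_all add: vv)
    next
      fix w assume "w \<in> (\<lambda>e. v + e) ` E"
      then obtain e where e: "e \<in> E" "w = v + e" by blast
      then have "w \<in> V" using E v(1) add(1) by blast
      moreover have "v + w \<in> E" unfolding e(2) vv by (rule e(1))
      ultimately have "w \<in> V \<and> \<phi> v = \<phi> w" using \<phi>[OF v(1)] by blast
      then show "w \<in> {w \<in> V. \<phi> w = y}" using v(2) by simp
    qed
    moreover have "inj_on (\<lambda>e. v + e) E" by (rule inj_onI) simp
    ultimately show ?thesis by (simp add: card_image)
  qed
  have "card V = (\<Sum>y\<in>\<phi> ` V. card {w \<in> V. \<phi> w = y})"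
    using sum.image_gen[OF V(2), of "\<lambda>_. 1 :: nat" \<phi>] by simp
  also have "\<dots> = (\<Sum>y\<in>\<phi> ` V. card E)" by (rule sum.cong) (auto simp: fibre)
  finally show ?thesis by simp
qed

lemma bit_UNIV: "(UNIV :: bit set) = {0, 1}"
  using bit_not_one_iff by auto

text \<open>A basis identifies the space with the bit vectors indexed by it. This turns dimensions into cardinalities, which behave well under deletion of simplices.\<close>
lemma card_eq_two_pow_dim:
  fixes V :: "(bit, 'c) module"
  assumes "vectorspace class_ring V" and carrier_finite: "finite (carrier V)"
  shows "card (carrier V) = 2 ^ vectorspace.dim class_ring V"
proof -
  interpret vectorspace class_ring V by fact
  have "fin_dim"
  proof -
    have "span (carrier V) \<subseteq> carrier V"
      unfolding span_def using lincomb_closed by blast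
    moreover have "carrier V \<subseteq> span (carrier V)"
      by (rule in_own_span) auto
    ultimately have "span (carrier V) = carrier V" by (rule equalityI)
    note span = this
    show ?thesis unfolding fin_dim_def by (intro exI[of _ "carrier V"] conjI carrier_finite subset_refl span)
  qed
  then obtain \<beta> where \<beta>: "finite \<beta>" "basis \<beta>" using finite_basis_exists by blast
  then have \<beta>C: "\<beta> \<subseteq> carrier V" unfolding basis_def by blast
  have uniq: "\<exists>!a. a \<in> \<beta> \<rightarrow>\<^sub>E UNIV \<and> lincomb a \<beta> = v" if "v \<in> carrier V" for v
    using basis_criterion[OF \<beta>(1) \<beta>C] \<beta>(2) that by (simp add: class_ring_simps)
  have "bij_betw (\<lambda>a. lincomb a \<beta>) (\<beta> \<rightarrow>\<^sub>E (UNIV :: bit set)) (carrier V)"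
    unfolding bij_betw_def
  proof (intro conjI inj_onI equalityI subsetI)
    have cl: "lincomb a \<beta> \<in> carrier V" for a
      by (rule lincomb_closed[OF \<beta>C]) (simp add: class_ring_simps)
    show "a = a'" if "a \<in> \<beta> \<rightarrow>\<^sub>E UNIV" "a' \<in> \<beta> \<rightarrow>\<^sub>E UNIV" "lincomb a \<beta> = lincomb a' \<beta>" for a a' :: "'c \<Rightarrow> bit"
      using ex1E[OF uniq[OF cl[of a]]] that by (metis (no_types))
    show "v \<in> carrier V" if "v \<in> (\<lambda>a. lincomb a \<beta>) ` (\<beta> \<rightarrow>\<^sub>E UNIV)" for v
      using that cl by blast
    show "v \<in> (\<lambda>a. lincomb a \<beta>) ` (\<beta> \<rightarrow>\<^sub>E UNIV)" if "v \<in> carrier V" for v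
      using uniq[OF that] by blast
  qed
  then have "card (carrier V) = card (\<beta> \<rightarrow>\<^sub>E (UNIV :: bit set))"
    by (rule bij_betw_same_card[symmetric])
  also have "\<dots> = 2 ^ card \<beta>" using \<beta>(1) by (simp add: card_PiE bit_UNIV numeral_2_eq_2)
  also have "card \<beta> = dim" using dim_basis[OF \<beta>] by simp
  finally show ?thesis .
qed

section \<open>Chains and their maps\<close>

lemma chain_double: "c + c = (0 :: 'k \<Rightarrow>\<^sub>0 bit)"
  by (rule poly_mapping_eqI) (simp add: lookup_add)

lemma chain_add_cancel: "c + (c + d) = (d :: 'k \<Rightarrow>\<^sub>0 bit)"
  by (simp add: chain_double flip: add.assoc)

lemma lookup_bit: "\<sigma> \<in> Poly_Mapping.keys c \<Longrightarrow> Poly_Mapping.lookup c \<sigma> = (1 :: bit)"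
  by (simp add: in_keys_iff)

lemma keys_bit_add:
  "Poly_Mapping.keys (c + d) = (Poly_Mapping.keys c - Poly_Mapping.keys d) \<union> (Poly_Mapping.keys d - Poly_Mapping.keys c)"
  for c d :: "'k \<Rightarrow>\<^sub>0 bit"
proof (rule Set.set_eqI)
  fix \<sigma>
  show "\<sigma> \<in> Poly_Mapping.keys (c + d) \<longleftrightarrow>
    \<sigma> \<in> (Poly_Mapping.keys c - Poly_Mapping.keys d) \<union> (Poly_Mapping.keys d - Poly_Mapping.keys c)"
    by (cases "Poly_Mapping.lookup c \<sigma>"; cases "Poly_Mapping.lookup d \<sigma>") (auto simp: in_keys_iff lookup_add)
qed

text \<open>Over \<open>\<int>/2\<close> a chain is its support, so the linear extension of \<open>g\<close> is a sum over the support.\<close>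
definition linear_extension :: "('k \<Rightarrow> ('l \<Rightarrow>\<^sub>0 bit)) \<Rightarrow> ('k \<Rightarrow>\<^sub>0 bit) \<Rightarrow> ('l \<Rightarrow>\<^sub>0 bit)" where
  "linear_extension g c = (\<Sum>\<sigma>\<in>Poly_Mapping.keys c. g \<sigma>)"

lemma linear_extension_add: "linear_extension g (c + d) = linear_extension g c + linear_extension g d"
proof -
  let ?C = "Poly_Mapping.keys c" and ?D = "Poly_Mapping.keys d"
  have C: "sum g ?C = sum g (?C - ?D) + sum g (?C \<inter> ?D)"
    by (subst sum.union_disjoint[symmetric]) (auto intro!: sum.cong)
  have D: "sum g ?D = sum g (?D - ?C) + sum g (?C \<inter> ?D)"
    by (subst sum.union_disjoint[symmetric]) (auto intro!: sum.cong)
  have "linear_extension g (c + d) = sum g (?C - ?D) + sum g (?D - ?C)"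
    unfolding linear_extension_def keys_bit_add by (rule sum.union_disjoint) auto
  moreover have "sum g (?C \<inter> ?D) + sum g (?C \<inter> ?D) = 0" by (rule chain_double)
  moreover have "(a + x) + (b + x) = (a + b) + (x + x)" for a b x :: "'b \<Rightarrow>\<^sub>0 bit"
    by (simp only: add_ac)
  ultimately show ?thesis
    unfolding linear_extension_def C D by simp
qed

lemma linear_extension_0 [simp]: "linear_extension g 0 = 0"
  by (simp add: linear_extension_def)

lemma linear_extension_single [simp]: "linear_extension g (Poly_Mapping.single \<sigma> 1) = g \<sigma>"
  by (simp add: linear_extension_def)

lemma linear_extension_sum: "linear_extension g (sum h I) = (\<Sum>i\<in>I. linear_extension g (h i))"
  by (induction I rule: infinite_finite_induct) (simp_all add: linear_extension_add)

lemma linear_extension_comp: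
  "linear_extension g (linear_extension h c) = linear_extension (\<lambda>\<sigma>. linear_extension g (h \<sigma>)) c"
  unfolding linear_extension_def[of h] linear_extension_sum by (simp add: linear_extension_def)

text \<open>The case \<open>\<sigma> = {v}\<close> keeps the empty simplex out: homology is not reduced.\<close>
definition simplex_boundary :: "'v set \<Rightarrow> ('v set \<Rightarrow>\<^sub>0 bit)" where
  "simplex_boundary \<sigma> = (\<Sum>v\<in>\<sigma>. if \<sigma> = {v} then 0 else Poly_Mapping.single (\<sigma> - {v}) 1)"

definition simplex_image :: "('v \<Rightarrow> 'w) \<Rightarrow> 'v set \<Rightarrow> ('w set \<Rightarrow>\<^sub>0 bit)" where
  "simplex_image f \<sigma> = (if inj_on f \<sigma> then Poly_Mapping.single (f ` \<sigma>) 1 else 0)"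

lemma boundary_map_eq: "boundary_map = linear_extension simplex_boundary"
proof
  fix c :: "'v set \<Rightarrow>\<^sub>0 bit"
  show "boundary_map c = linear_extension simplex_boundary c"
    unfolding boundary_map_def linear_extension_def simplex_boundary_def
    by (intro sum.cong refl) (simp add: lookup_bit)
qed

lemma chain_map_eq: "chain_map f = linear_extension (simplex_image f)"
proof (rule ext)
  fix c
  show "chain_map f c = linear_extension (simplex_image f) c"
    unfolding chain_map_def linear_extension_def simplex_image_def
    by (intro sum.cong refl) (simp add: lookup_bit)
qed

text \<open>If \<open>f\<close> identifies two vertices of \<open>\<sigma>\<close>, the right side is \<open>0\<close>. On the left every face that contains both vertices degenerates as well, and the two faces that miss one of them either degenerate or have the same image, so that they cancel modulo 2.\<close>
lemma simplex_boundary_natural: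
  assumes "finite \<sigma>"
  shows "linear_extension (simplex_image f) (simplex_boundary \<sigma>) = linear_extension simplex_boundary (simplex_image f \<sigma>)"
proof (cases "inj_on f \<sigma>")
  case True
  have "linear_extension simplex_boundary (simplex_image f \<sigma>) = simplex_boundary (f ` \<sigma>)"
    using True by (simp add: simplex_image_def)
  also have "\<dots> = (\<Sum>v\<in>\<sigma>. if f ` \<sigma> = {f v} then 0 else Poly_Mapping.single (f ` \<sigma> - {f v}) 1)"
    unfolding simplex_boundary_def by (simp add: sum.reindex[OF True])
  also have "\<dots> = (\<Sum>v\<in>\<sigma>. linear_extension (simplex_image f) (if \<sigma> = {v} then 0 else Poly_Mapping.single (\<sigma> - {v}) 1))"
  proof (rule sum.cong[OF refl])
    fix v assume v: "v \<in> \<sigma>"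
    have "f ` \<sigma> = {f v} \<longleftrightarrow> \<sigma> = {v}"
      using inj_on_image_eq_iff[OF True, of \<sigma> "{v}"] v by auto
    moreover have "f ` \<sigma> - {f v} = f ` (\<sigma> - {v})"
      using inj_on_image_set_diff[OF True, of \<sigma> "{v}"] v by auto
    moreover have "inj_on f (\<sigma> - {v})" using True by (rule inj_on_subset) auto
    ultimately show "(if f ` \<sigma> = {f v} then 0 else Poly_Mapping.single (f ` \<sigma> - {f v}) 1) =
      linear_extension (simplex_image f) (if \<sigma> = {v} then 0 else Poly_Mapping.single (\<sigma> - {v}) 1)"
      by (simp add: simplex_image_def)
  qed
  finally show ?thesis unfolding simplex_boundary_def linear_extension_sum by simp
next
  case False
  then obtain v w where vw: "v \<in> \<sigma>" "w \<in> \<sigma>" "v \<noteq> w" "f v = f w" unfolding inj_on_def by blast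
  define g where "g u = simplex_image f (\<sigma> - {u})" for u
  have "linear_extension (simplex_image f) (simplex_boundary \<sigma>) = (\<Sum>u\<in>\<sigma>. g u)"
    unfolding simplex_boundary_def linear_extension_sum
  proof (rule sum.cong[OF refl])
    fix u
    have "\<sigma> \<noteq> {u}" using vw by auto
    then show "linear_extension (simplex_image f) (if \<sigma> = {u} then 0 else Poly_Mapping.single (\<sigma> - {u}) 1) = g u"
      by (simp add: g_def)
  qed
  also have "\<dots> = (\<Sum>u\<in>{v, w}. g u)"
  proof (rule sum.mono_neutral_right[OF assms])
    show "\<forall>u\<in>\<sigma> - {v, w}. g u = 0"
    proof
      fix u assume "u \<in> \<sigma> - {v, w}"
      then have "v \<in> \<sigma> - {u}" "w \<in> \<sigma> - {u}" using vw by auto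
      then have "\<not> inj_on f (\<sigma> - {u})" using vw(3,4) unfolding inj_on_def by blast
      then show "g u = 0" by (simp add: g_def simplex_image_def)
    qed
  qed (use vw in auto)
  also have "\<dots> = g v + g w" using vw(3) by simp
  also have "g v = g w"
  proof -
    have img': "f ` (\<sigma> - {a}) = f ` \<sigma>" if ab: "b \<in> \<sigma>" "b \<noteq> a" "f a = f b" for a b
    proof (rule equalityI[OF image_mono[OF Diff_subset] subsetI])
      fix x assume "x \<in> f ` \<sigma>"
      then obtain u where u: "u \<in> \<sigma>" "x = f u" by blast
      show "x \<in> f ` (\<sigma> - {a})"
        using u ab by (cases "u = a") auto
    qed
    have img: "f ` (\<sigma> - {v}) = f ` (\<sigma> - {w})"
      using img'[of w v] img'[of v w] vw by simp
    have "inj_on f (\<sigma> - {v}) \<longleftrightarrow> card (f ` (\<sigma> - {v})) = card (\<sigma> - {v})"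
      using assms by (auto simp: card_image dest: eq_card_imp_inj_on[rotated])
    moreover have "inj_on f (\<sigma> - {w}) \<longleftrightarrow> card (f ` (\<sigma> - {w})) = card (\<sigma> - {w})"
      using assms by (auto simp: card_image dest: eq_card_imp_inj_on[rotated])
    moreover have "card (\<sigma> - {v}) = card (\<sigma> - {w})" using vw assms by (simp add: card_Diff_singleton)
    ultimately show ?thesis unfolding g_def simplex_image_def by (simp add: img)
  qed
  also have "g w + g w = 0" by (rule chain_double)
  finally have "linear_extension (simplex_image f) (simplex_boundary \<sigma>) = 0" .
  moreover have "simplex_image f \<sigma> = 0" using False by (simp add: simplex_image_def)
  ultimately show ?thesis by (simp only: linear_extension_0)
qed

lemma boundary_chain_map:
  assumes "\<And>\<sigma>. \<sigma> \<in> Poly_Mapping.keys c \<Longrightarrow> finite \<sigma>"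
  shows "chain_map f (boundary_map c) = boundary_map (chain_map f c)"
  unfolding chain_map_eq boundary_map_eq linear_extension_comp
  by (simp add: linear_extension_def[of _ c] simplex_boundary_natural assms)

definition simplices :: "'v set set \<Rightarrow> nat \<Rightarrow> 'v set set" where
  "simplices K q = {\<sigma>\<in>K. finite \<sigma> \<and> card \<sigma> = q + 1}"

definition cycles_on :: "'v set set \<Rightarrow> ('v set \<Rightarrow>\<^sub>0 bit) set" where
  "cycles_on A = {c. boundary_map c = 0 \<and> Poly_Mapping.keys c \<subseteq> A}"

text \<open>Pairs of a cycle and a witness that its image bounds. Recording the witness, rather than asking for its existence, makes membership a linear equation together with a bound on supports; this is what allows the comparison of a complex with a subcomplex by counting.\<close>
definition bounded_cycles_on :: "('v \<Rightarrow> 'w) \<Rightarrow> 'v set set \<Rightarrow> 'w set set \<Rightarrow> (('v set \<Rightarrow>\<^sub>0 bit) \<times> ('w set \<Rightarrow>\<^sub>0 bit)) set" where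
  "bounded_cycles_on f A A' = {(z, y). boundary_map z = 0 \<and> chain_map f z = boundary_map y
     \<and> Poly_Mapping.keys z \<subseteq> A \<and> Poly_Mapping.keys y \<subseteq> A'}"

lemma boundary_map_add: "boundary_map (c + d) = boundary_map c + boundary_map d"
  by (simp add: boundary_map_eq linear_extension_add)

lemma chain_map_add: "chain_map f (c + d) = chain_map f c + chain_map f d"
  by (simp add: chain_map_eq linear_extension_add)

lemma boundary_map_0 [simp]: "boundary_map 0 = 0" by (simp add: boundary_map_eq)

lemma chain_map_0 [simp]: "chain_map f 0 = 0" by (simp add: chain_map_eq)

lemma keys_add_subset: "Poly_Mapping.keys c \<subseteq> A \<Longrightarrow> Poly_Mapping.keys d \<subseteq> A \<Longrightarrow> Poly_Mapping.keys (c + d) \<subseteq> A"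
  for c d :: "'k \<Rightarrow>\<^sub>0 bit"
  by (auto simp: keys_bit_add)

lemma finite_chains:
  assumes "finite A"
  shows "finite {c :: 'k \<Rightarrow>\<^sub>0 bit. Poly_Mapping.keys c \<subseteq> A}"
proof (rule finite_imageD)
  have "Poly_Mapping.keys ` {c :: 'k \<Rightarrow>\<^sub>0 bit. Poly_Mapping.keys c \<subseteq> A} \<subseteq> Pow A" by auto
  then show "finite (Poly_Mapping.keys ` {c :: 'k \<Rightarrow>\<^sub>0 bit. Poly_Mapping.keys c \<subseteq> A})"
    using assms finite_subset by blast
  show "inj_on Poly_Mapping.keys {c :: 'k \<Rightarrow>\<^sub>0 bit. Poly_Mapping.keys c \<subseteq> A}"
  proof (rule inj_onI)
    fix c d :: "'k \<Rightarrow>\<^sub>0 bit" assume eq: "Poly_Mapping.keys c = Poly_Mapping.keys d"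
    show "c = d"
    proof (rule poly_mapping_eqI)
      fix \<sigma> show "Poly_Mapping.lookup c \<sigma> = Poly_Mapping.lookup d \<sigma>"
      proof (cases "\<sigma> \<in> Poly_Mapping.keys c")
        case True
        then show ?thesis using eq by (simp add: lookup_bit)
      next
        case False
        then have "\<sigma> \<notin> Poly_Mapping.keys d" using eq by simp
        with False show ?thesis by (simp add: in_keys_iff)
      qed
    qed
  qed
qed

lemma binary_group_cycles_on: "binary_group (cycles_on A)"
  unfolding binary_group_def cycles_on_def by (simp add: boundary_map_add chain_double keys_add_subset)

lemma finite_cycles_on: "finite A \<Longrightarrow> finite (cycles_on A)"
  unfolding cycles_on_def by (rule finite_subset[OF _ finite_chains]) auto

lemma binary_group_bounded_cycles_on: "binary_group (bounded_cycles_on f A A')"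
  unfolding binary_group_def bounded_cycles_on_def
  by (simp add: boundary_map_add chain_map_add chain_double zero_prod_def keys_add_subset split_beta)

lemma finite_bounded_cycles_on: "finite A \<Longrightarrow> finite A' \<Longrightarrow> finite (bounded_cycles_on f A A')"
  unfolding bounded_cycles_on_def
  by (rule finite_subset[OF _ finite_cartesian_product[OF finite_chains finite_chains]]) auto

section \<open>Homology ranks as counts\<close>

definition chain_coset :: "('k \<Rightarrow>\<^sub>0 bit) set \<Rightarrow> ('k \<Rightarrow>\<^sub>0 bit) \<Rightarrow> ('k \<Rightarrow>\<^sub>0 bit) set" where
  "chain_coset B z = (\<lambda>b. b + z) ` B"

text \<open>In exponent two the difference of \<open>z\<close> and \<open>w\<close> is \<open>z + w\<close>.\<close>
lemma chain_coset_eq_iff: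
  assumes "binary_group B"
  shows "chain_coset B z = chain_coset B w \<longleftrightarrow> z + w \<in> B"
proof
  have B: "0 \<in> B" "\<And>a b. a \<in> B \<Longrightarrow> b \<in> B \<Longrightarrow> a + b \<in> B" using assms unfolding binary_group_def by blast+
  assume "chain_coset B z = chain_coset B w"
  moreover have "z \<in> chain_coset B z" unfolding chain_coset_def using B(1) by (intro image_eqI[of _ _ 0]) simp_all
  ultimately obtain b where b: "b \<in> B" "z = b + w" unfolding chain_coset_def by blast
  have "z + w = b + (w + w)" unfolding b(2) by (rule add.assoc)
  then show "z + w \<in> B" using b(1) by (simp add: chain_double)
next
  have B: "\<And>a b. a \<in> B \<Longrightarrow> b \<in> B \<Longrightarrow> a + b \<in> B" using assms unfolding binary_group_def by blast
  assume zw: "z + w \<in> B"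
  have half: "chain_coset B x \<subseteq> chain_coset B y" if "x + y \<in> B" for x y
  proof
    fix u assume "u \<in> chain_coset B x"
    then obtain b where b: "b \<in> B" "u = b + x" unfolding chain_coset_def by blast
    have "(b + (x + y)) + y = b + x + (y + y)" by (simp only: add_ac)
    then have "u = (b + (x + y)) + y" unfolding b(2) by (simp add: chain_double)
    then show "u \<in> chain_coset B y" unfolding chain_coset_def using B[OF b(1) that] by blast
  qed
  show "chain_coset B z = chain_coset B w"
    using half[OF zw] half[of w z] zw by (simp add: add.commute subset_antisym)
qed

lemma chain_coset_add:
  assumes "binary_group B"
  shows "{x + y | x y. x \<in> chain_coset B z \<and> y \<in> chain_coset B w} = chain_coset B (z + w)"
proof (intro equalityI subsetI)
  have B: "0 \<in> B" "\<And>a b. a \<in> B \<Longrightarrow> b \<in> B \<Longrightarrow> a + b \<in> B" using assms unfolding binary_group_def by blast+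
  {
    fix u assume "u \<in> {x + y | x y. x \<in> chain_coset B z \<and> y \<in> chain_coset B w}"
    then obtain b b' where b: "b \<in> B" "b' \<in> B" "u = (b + z) + (b' + w)" unfolding chain_coset_def by blast
    have "u = (b + b') + (z + w)" unfolding b(3) by (simp only: add_ac)
    then show "u \<in> chain_coset B (z + w)" unfolding chain_coset_def using B(2)[OF b(1,2)] by blast
  next
    fix u assume "u \<in> chain_coset B (z + w)"
    then obtain b where b: "b \<in> B" "u = b + (z + w)" unfolding chain_coset_def by blast
    have "u = (b + z) + (0 + w)" unfolding b(2) by (simp add: add_ac)
    then show "u \<in> {x + y | x y. x \<in> chain_coset B z \<and> y \<in> chain_coset B w}"
      unfolding chain_coset_def using B(1) b(1) by blast
  }
qed

lemma chain_coset_0: "chain_coset B 0 = B"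
  by (simp add: chain_coset_def)

lemma chain_scale: "Poly_Mapping.map ((*) a) c = (if a = 1 then c else 0)" for a :: bit
proof (rule poly_mapping_eqI)
  fix \<sigma>
  show "Poly_Mapping.lookup (Poly_Mapping.map ((*) a) c) \<sigma> = Poly_Mapping.lookup (if a = 1 then c else 0) \<sigma>"
    by (cases a) (simp_all add: Poly_Mapping.map.rep_eq when_def)
qed

lemma UN_chain_coset:
  assumes B: "binary_group B" and h: "\<And>x y. h (x + y) = h x + h y" and hB: "\<And>b. b \<in> A \<Longrightarrow> h b \<in> B" and "0 \<in> A"
  shows "(\<Union>x\<in>chain_coset A z. chain_coset B (h x)) = chain_coset B (h z)"
proof -
  have "chain_coset B (h x) = chain_coset B (h z)" if "x \<in> chain_coset A z" for x
  proof -
    obtain b where b: "b \<in> A" "x = b + z" using \<open>x \<in> chain_coset A z\<close> unfolding chain_coset_def by blast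
    have "h x + h z = h b + (h z + h z)" unfolding b(2) h by (rule add.assoc)
    then have "h x + h z \<in> B" using hB[OF b(1)] by (simp add: chain_double)
    then show ?thesis using chain_coset_eq_iff[OF B] by blast
  qed
  moreover have "chain_coset A z \<noteq> {}" using \<open>0 \<in> A\<close> by (auto simp: chain_coset_def)
  ultimately show ?thesis by simp
qed

lemma bit_cring: "cring (class_ring :: bit ring)"
  by (rule class_cring.is_cring)

text \<open>This applies to a homology group as well as to the image of an induced map, since both are spaces of cosets of boundaries.\<close>
lemma quotient_dim:
  fixes V :: "(bit, ('k \<Rightarrow>\<^sub>0 bit) set) module"
  assumes B: "binary_group B" and Z: "binary_group Z" "finite Z"
    and carrier: "carrier V = chain_coset B ` Z"
    and zero: "zero V = B"
    and add: "add V = (\<lambda>X Y. {x + y | x y. x \<in> X \<and> y \<in> Y})"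
    and smult: "smult V = (\<lambda>a X. \<Union>x\<in>X. chain_coset B (Poly_Mapping.map ((*) a) x))"
  shows "card (chain_coset B ` Z) = 2 ^ vectorspace.dim class_ring V"
proof -
  have Z0: "0 \<in> Z" and Zadd: "\<And>z w. z \<in> Z \<Longrightarrow> w \<in> Z \<Longrightarrow> z + w \<in> Z"
    using Z unfolding binary_group_def by blast+
  have B0: "0 \<in> B" using B unfolding binary_group_def by blast
  have zero': "zero V = chain_coset B 0" unfolding zero chain_coset_0 ..
  have add': "add V (chain_coset B z) (chain_coset B w) = chain_coset B (z + w)" for z w
    unfolding add by (rule chain_coset_add[OF B])
  have smult': "smult V a (chain_coset B z) = chain_coset B (if a = 1 then z else 0)" for a z
    unfolding smult chain_scale
    by (rule UN_chain_coset[OF B _ _ B0, where h = "\<lambda>x. if a = 1 then x else 0"]) (use B0 in auto)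
  have "abelian_group V"
  proof (rule abelian_groupI)
    fix x assume "x \<in> carrier V"
    then obtain z where "z \<in> Z" "x = chain_coset B z" unfolding carrier by blast
    then show "\<exists>y\<in>carrier V. y \<oplus>\<^bsub>V\<^esub> x = \<zero>\<^bsub>V\<^esub>"
      unfolding carrier by (intro bexI[of _ "chain_coset B z"]) (simp_all add: add' zero' chain_double)
  qed (auto simp: carrier add' zero' Z0 Zadd add_ac)
  then have "module class_ring V"
  proof (rule moduleI[OF bit_cring])
    show "(a \<oplus>\<^bsub>class_ring\<^esub> b) \<odot>\<^bsub>V\<^esub> x = (a \<odot>\<^bsub>V\<^esub> x) \<oplus>\<^bsub>V\<^esub> (b \<odot>\<^bsub>V\<^esub> x)" if "x \<in> carrier V" for a b :: bit and x
      using that by (cases a; cases b) (auto simp: carrier smult' add' chain_double)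
  qed (auto simp: carrier smult' add' Z0)
  then have "vectorspace class_ring V"
    by (intro vectorspace.intro class_field.field_axioms)
  then show ?thesis unfolding carrier[symmetric]
    by (rule card_eq_two_pow_dim) (simp add: carrier Z(2))
qed

lemma simplices_carrier: "carrier (chain_module K q) = {c. Poly_Mapping.keys c \<subseteq> simplices K q}"
  by (simp add: chain_module_def simplices_def)

lemma cycle_carrier: "carrier (cycle_module K q) = cycles_on (simplices K q)"
  by (auto simp: cycle_module_def simplices_carrier cycles_on_def)

lemma cycle_coset: "B +>\<^bsub>cycle_module K q\<^esub> z = chain_coset B z"
  by (auto simp: a_r_coset_def' cycle_module_def chain_module_def chain_coset_def)

lemma homology_carrier: "carrier (homology_module K q) = chain_coset (boundaries K q) ` cycles_on (simplices K q)"
  unfolding homology_module_def quotient_module_def A_RCOSETS_def' by (auto simp: cycle_carrier cycle_coset)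

lemma binary_group_boundaries: "binary_group (boundaries K q)"
  unfolding binary_group_def
proof (intro conjI ballI)
  show "0 \<in> boundaries K q"
    unfolding boundaries_def simplices_carrier by (rule image_eqI[of _ _ 0]) simp_all
  fix v w assume "v \<in> boundaries K q" "w \<in> boundaries K q"
  then obtain c d where "Poly_Mapping.keys c \<subseteq> simplices K (Suc q)" "v = boundary_map c"
    "Poly_Mapping.keys d \<subseteq> simplices K (Suc q)" "w = boundary_map d"
    unfolding boundaries_def simplices_carrier by blast
  then show "v + w \<in> boundaries K q"
    unfolding boundaries_def simplices_carrier
    by (intro image_eqI[of _ _ "c + d"]) (simp_all add: boundary_map_add keys_add_subset)
qed (rule chain_double)

text \<open>Only simplices on which \<open>f\<close> is injective are constrained, because the induced chain map sends all others to \<open>0\<close>.\<close>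
definition simplicial_on :: "'v set set \<Rightarrow> 'w set set \<Rightarrow> ('v \<Rightarrow> 'w) \<Rightarrow> bool" where
  "simplicial_on K L f \<longleftrightarrow> (\<forall>\<sigma>\<in>K. finite \<sigma> \<longrightarrow> inj_on f \<sigma> \<longrightarrow> f ` \<sigma> \<in> L)"

lemma chain_map_keys:
  assumes f: "simplicial_on K L f" and c: "Poly_Mapping.keys c \<subseteq> simplices K q"
  shows "Poly_Mapping.keys (chain_map f c) \<subseteq> simplices L q"
proof -
  have "Poly_Mapping.keys (simplex_image f \<sigma>) \<subseteq> simplices L q" if "\<sigma> \<in> simplices K q" for \<sigma>
    using that f by (auto simp: simplex_image_def simplices_def simplicial_on_def card_image)
  then have *: "\<sigma> \<in> Poly_Mapping.keys c \<Longrightarrow> Poly_Mapping.keys (simplex_image f \<sigma>) \<subseteq> simplices L q" for \<sigma>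
    using c by blast
  have "Poly_Mapping.keys (\<Sum>\<sigma>\<in>I. simplex_image f \<sigma>) \<subseteq> simplices L q" if "finite I" "I \<subseteq> Poly_Mapping.keys c" for I
    using that by (induction I) (simp_all add: keys_add_subset * )
  then show ?thesis unfolding chain_map_eq linear_extension_def by simp
qed

text \<open>The image in homology is the group of \<open>q\<close>-cycles of \<open>K\<close> modulo those whose image in \<open>L\<close> bounds. The latter form the projection of the pairs in \<open>bounded_cycles_on\<close>, and the kernel of this projection consists of the \<open>(q+1)\<close>-cycles of \<open>L\<close>.\<close>
theorem homology_rank_eq:
  fixes K :: "'v set set" and L :: "'w set set" and f :: "'v \<Rightarrow> 'w"
  assumes fin: "finite (simplices K q)" "finite (simplices L (Suc q))"
    and f: "simplicial_on K L f"
  shows "real (homology_rank K L q f) = log 2 (card (cycles_on (simplices K q)))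
     - log 2 (card (bounded_cycles_on f (simplices K q) (simplices L (Suc q))))
     + log 2 (card (cycles_on (simplices L (Suc q))))"
proof -
  let ?Z = "cycles_on (simplices K q)" and ?B = "boundaries L q"
  let ?Y = "cycles_on (simplices L (Suc q))" and ?G = "bounded_cycles_on f (simplices K q) (simplices L (Suc q))"
  have Zg: "binary_group ?Z" by (rule binary_group_cycles_on)
  have Zf: "finite ?Z" by (rule finite_cycles_on[OF fin(1)])
  have Yg: "binary_group ?Y" by (rule binary_group_cycles_on)
  have Yf: "finite ?Y" by (rule finite_cycles_on[OF fin(2)])
  have Bg: "binary_group ?B" by (rule binary_group_boundaries)
  have B0: "0 \<in> boundaries K q" using binary_group_boundaries[of K q] unfolding binary_group_def by blast
  have hb: "chain_map f b \<in> ?B" if "b \<in> boundaries K q" for b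
  proof -
    obtain y where y: "Poly_Mapping.keys y \<subseteq> simplices K (Suc q)" "b = boundary_map y"
      using \<open>b \<in> boundaries K q\<close> unfolding boundaries_def simplices_carrier by blast
    have "chain_map f b = boundary_map (chain_map f y)"
      unfolding y(2) by (rule boundary_chain_map) (use y(1) in \<open>auto simp: simplices_def\<close>)
    then show ?thesis
      using chain_map_keys[OF f y(1)] unfolding boundaries_def simplices_carrier by blast
  qed
  have hm: "homology_map L q f (chain_coset (boundaries K q) z) = chain_coset ?B (chain_map f z)" for z
    unfolding homology_map_def cycle_coset
    by (rule UN_chain_coset[OF Bg chain_map_add hb B0])
  have im: "homology_map L q f ` carrier (homology_module K q) = chain_coset ?B ` chain_map f ` ?Z"
    unfolding homology_carrier image_image by (simp add: hm)
  have fZ: "binary_group (chain_map f ` ?Z)"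
    unfolding binary_group_def
  proof (intro conjI ballI)
    have "0 \<in> ?Z" using Zg unfolding binary_group_def by blast
    then show "0 \<in> chain_map f ` ?Z" by (intro image_eqI[of _ _ 0]) simp_all
    fix v w assume "v \<in> chain_map f ` ?Z" "w \<in> chain_map f ` ?Z"
    then obtain z z' where z: "z \<in> ?Z" "v = chain_map f z" "z' \<in> ?Z" "w = chain_map f z'" by blast
    have "z + z' \<in> ?Z" using Zg z unfolding binary_group_def by blast
    then show "v + w \<in> chain_map f ` ?Z" unfolding z chain_map_add[symmetric] by (rule imageI)
  qed (rule chain_double)
  have "card (chain_coset ?B ` chain_map f ` ?Z) = 2 ^ homology_rank K L q f"
    unfolding homology_rank_def
  proof (rule quotient_dim[OF Bg fZ])
    show "finite (chain_map f ` ?Z)" using Zf by simp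
    show "carrier (homology_module L q\<lparr>carrier := homology_map L q f ` carrier (homology_module K q)\<rparr>) = chain_coset ?B ` chain_map f ` ?Z"
      by (simp add: im)
    show "\<zero>\<^bsub>homology_module L q\<lparr>carrier := homology_map L q f ` carrier (homology_module K q)\<rparr>\<^esub> = ?B"
      by (simp add: homology_module_def quotient_module_def)
    have "X <+>\<^bsub>cycle_module L q\<^esub> Y = {x + y | x y. x \<in> X \<and> y \<in> Y}" for X Y
      by (auto simp: set_add_def' cycle_module_def chain_module_def)
    then show "add (homology_module L q\<lparr>carrier := homology_map L q f ` carrier (homology_module K q)\<rparr>) = (\<lambda>X Y. {x + y | x y. x \<in> X \<and> y \<in> Y})"
      by (simp add: homology_module_def quotient_module_def fun_eq_iff)
    show "smult (homology_module L q\<lparr>carrier := homology_map L q f ` carrier (homology_module K q)\<rparr>)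
      = (\<lambda>a X. \<Union>x\<in>X. chain_coset ?B (Poly_Mapping.map ((*) a) x))"
      by (simp add: homology_module_def quotient_module_def fun_eq_iff cycle_coset)
         (simp add: cycle_module_def chain_module_def)
  qed
  then have im_card: "card ((\<lambda>z. chain_coset ?B (chain_map f z)) ` ?Z) = 2 ^ homology_rank K L q f"
    by (simp add: image_image)
  \<comment> \<open>cycles that become boundaries\<close>
  define E where "E = {z\<in>?Z. chain_map f z \<in> ?B}"
  have cZ: "card ?Z = card ((\<lambda>z. chain_coset ?B (chain_map f z)) ` ?Z) * card E"
  proof (rule card_fibres[OF Zg Zf])
    show "E \<subseteq> ?Z" by (auto simp: E_def)
    fix v w assume "v \<in> ?Z" "w \<in> ?Z"
    then have "v + w \<in> ?Z" using Zg unfolding binary_group_def by blast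
    then show "chain_coset ?B (chain_map f v) = chain_coset ?B (chain_map f w) \<longleftrightarrow> v + w \<in> E"
      by (simp add: chain_coset_eq_iff[OF Bg] E_def chain_map_add)
  qed
  have "fst ` ?G = E"
  proof (rule Set.set_eqI)
    fix z
    have "z \<in> fst ` ?G \<longleftrightarrow> (\<exists>y. (z, y) \<in> ?G)" by force
    also have "\<dots> \<longleftrightarrow> z \<in> E"
      unfolding E_def boundaries_def simplices_carrier bounded_cycles_on_def cycles_on_def by auto
    finally show "z \<in> fst ` ?G \<longleftrightarrow> z \<in> E" .
  qed
  moreover have "card ?G = card (fst ` ?G) * card (Pair (0 :: 'v set \<Rightarrow>\<^sub>0 bit) ` ?Y)"
  proof (rule card_fibres[OF binary_group_bounded_cycles_on finite_bounded_cycles_on[OF fin]])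
    show "Pair (0 :: 'v set \<Rightarrow>\<^sub>0 bit) ` ?Y \<subseteq> ?G" by (auto simp: bounded_cycles_on_def cycles_on_def)
    fix g g' assume g: "g \<in> ?G" "g' \<in> ?G"
    then have s: "g + g' \<in> ?G" using binary_group_bounded_cycles_on unfolding binary_group_def by blast
    obtain x y where xy: "g + g' = (x, y)" by (cases "g + g'")
    have "fst g = fst g' \<longleftrightarrow> fst g + fst g' = 0"
    proof
      assume "fst g + fst g' = 0"
      then have "fst g + (fst g + fst g') = fst g" by simp
      then show "fst g = fst g'" by (simp add: chain_add_cancel)
    qed (simp add: chain_double)
    also have "\<dots> \<longleftrightarrow> fst (g + g') = 0" by simp
    also have "\<dots> \<longleftrightarrow> g + g' \<in> Pair (0 :: 'v set \<Rightarrow>\<^sub>0 bit) ` ?Y"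
      using s unfolding xy by (auto simp: bounded_cycles_on_def cycles_on_def image_iff)
    finally show "fst g = fst g' \<longleftrightarrow> g + g' \<in> Pair (0 :: 'v set \<Rightarrow>\<^sub>0 bit) ` ?Y" .
  qed
  moreover have "card (Pair (0 :: 'v set \<Rightarrow>\<^sub>0 bit) ` ?Y) = card ?Y" by (rule card_image) (simp add: inj_on_def)
  ultimately have cG: "card ?G = card E * card ?Y" by simp
  have pos: "0 < card E" "0 < card ?Y"
  proof -
    have "0 \<in> ?Z" "0 \<in> ?Y" "0 \<in> ?B" using Zg Yg Bg unfolding binary_group_def by blast+
    then have "0 \<in> E" by (simp add: E_def)
    moreover have "finite E" using Zf by (simp add: E_def)
    ultimately show "0 < card E" by (auto simp: card_gt_0_iff)
    show "0 < card ?Y" using \<open>0 \<in> ?Y\<close> Yf by (auto simp: card_gt_0_iff)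
  qed
  have "log 2 (card ?Z) = real (homology_rank K L q f) + log 2 (card E)"
    unfolding cZ im_card using pos by (simp add: log_mult log_nat_power)
  moreover have "log 2 (card ?G) = log 2 (card E) + log 2 (card ?Y)"
    unfolding cG using pos by (simp add: log_mult)
  ultimately show ?thesis by simp
qed

section \<open>Deleting simplices\<close>

text \<open>A homomorphic trace splits a group into the cosets of its kernel.\<close>
lemma card_trace:
  assumes V: "binary_group V" "finite V"
    and supp: "\<And>v w. v \<in> V \<Longrightarrow> w \<in> V \<Longrightarrow> s v = s w \<longleftrightarrow> s (v + w) = s 0"
  shows "card V = card (s ` V) * card {v\<in>V. s v = s 0}"
proof (rule card_fibres[OF V])
  fix v w assume vw: "v \<in> V" "w \<in> V"
  then have "v + w \<in> V" using V unfolding binary_group_def by blast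
  then show "s v = s w \<longleftrightarrow> v + w \<in> {v\<in>V. s v = s 0}" using supp[OF vw] by simp
qed auto

text \<open>The patterns that cycles supported in \<open>A\<close> leave on the simplices of \<open>S\<close>.\<close>
definition cycle_traces :: "'v set set \<Rightarrow> 'v set set \<Rightarrow> 'v set set set" where
  "cycle_traces A S = (\<lambda>c. Poly_Mapping.keys c \<inter> S) ` cycles_on A"

definition bounded_cycle_traces ::
    "('v \<Rightarrow> 'w) \<Rightarrow> 'v set set \<Rightarrow> 'w set set \<Rightarrow> 'v set set \<Rightarrow> 'w set set \<Rightarrow> ('v set set \<times> 'w set set) set" where
  "bounded_cycle_traces f A A' S S' =
     (\<lambda>(z, y). (Poly_Mapping.keys z \<inter> S, Poly_Mapping.keys y \<inter> S')) ` bounded_cycles_on f A A'"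

lemma keys_Int_eq_iff: "Poly_Mapping.keys c \<inter> S = Poly_Mapping.keys d \<inter> S \<longleftrightarrow> Poly_Mapping.keys (c + d) \<inter> S = {}"
  for c d :: "'k \<Rightarrow>\<^sub>0 bit"
  unfolding keys_bit_add by blast

text \<open>A cycle with empty trace on \<open>S\<close> is a cycle of the complex without \<open>S\<close>; apply \<open>card_trace\<close>.\<close>
lemma card_cycles_on:
  fixes A S :: "'v set set"
  assumes "finite A"
  shows "card (cycles_on A) = card (cycle_traces A S) * card (cycles_on (A - S))"
proof -
  have "{c \<in> cycles_on A. Poly_Mapping.keys c \<inter> S = Poly_Mapping.keys (0 :: 'v set \<Rightarrow>\<^sub>0 bit) \<inter> S} = cycles_on (A - S)"
    by (auto simp: cycles_on_def)
  moreover have "card (cycles_on A) = card (cycle_traces A S) * card {c \<in> cycles_on A. Poly_Mapping.keys c \<inter> S = Poly_Mapping.keys (0 :: 'v set \<Rightarrow>\<^sub>0 bit) \<inter> S}"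
    unfolding cycle_traces_def
    by (rule card_trace[OF binary_group_cycles_on finite_cycles_on[OF assms], where s = "\<lambda>c. Poly_Mapping.keys c \<inter> S"])
       (simp add: keys_Int_eq_iff)
  ultimately show ?thesis by simp
qed

lemma card_bounded_cycles_on:
  assumes "finite A" "finite A'"
  shows "card (bounded_cycles_on f A A') = card (bounded_cycle_traces f A A' S S') * card (bounded_cycles_on f (A - S) (A' - S'))"
proof -
  let ?s = "\<lambda>(z :: 'a set \<Rightarrow>\<^sub>0 bit, y :: 'b set \<Rightarrow>\<^sub>0 bit). (Poly_Mapping.keys z \<inter> S, Poly_Mapping.keys y \<inter> S')"
  have "{c \<in> bounded_cycles_on f A A'. ?s c = ?s 0} = bounded_cycles_on f (A - S) (A' - S')"
    by (auto simp: bounded_cycles_on_def zero_prod_def)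
  moreover have "card (bounded_cycles_on f A A') = card (bounded_cycle_traces f A A' S S') * card {c \<in> bounded_cycles_on f A A'. ?s c = ?s 0}"
    unfolding bounded_cycle_traces_def
    by (rule card_trace[OF binary_group_bounded_cycles_on finite_bounded_cycles_on[OF assms], where s = ?s])
       (simp add: split_beta keys_Int_eq_iff zero_prod_def)
  ultimately show ?thesis by simp
qed

lemma cycle_traces_mono: "A \<subseteq> B \<Longrightarrow> cycle_traces A S \<subseteq> cycle_traces B S"
  unfolding cycle_traces_def cycles_on_def by (intro image_mono) auto

lemma bounded_cycle_traces_mono:
  "A \<subseteq> B \<Longrightarrow> A' \<subseteq> B' \<Longrightarrow> bounded_cycle_traces f A A' S S' \<subseteq> bounded_cycle_traces f B B' S S'"
  unfolding bounded_cycle_traces_def bounded_cycles_on_def by (intro image_mono) auto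

lemma cycle_traces_subset: "cycle_traces A S \<subseteq> Pow (A \<inter> S)"
  unfolding cycle_traces_def cycles_on_def by auto

lemma bounded_cycle_traces_subset: "bounded_cycle_traces f A A' S S' \<subseteq> Pow (A \<inter> S) \<times> Pow (A' \<inter> S')"
  unfolding bounded_cycle_traces_def bounded_cycles_on_def by auto

lemma traces_nonempty: "cycle_traces A S \<noteq> {}" "bounded_cycle_traces f A A' S S' \<noteq> {}"
proof -
  have "0 \<in> cycles_on A" "0 \<in> bounded_cycles_on f A A'"
    using binary_group_cycles_on[of A] binary_group_bounded_cycles_on[of f A A'] unfolding binary_group_def by blast+
  then show "cycle_traces A S \<noteq> {}" "bounded_cycle_traces f A A' S S' \<noteq> {}"
    unfolding cycle_traces_def bounded_cycle_traces_def by blast+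
qed

lemma log_card_bounds:
  assumes "finite B" "T \<subseteq> B" "T \<noteq> {}" "card B \<le> 2 ^ m"
  shows "0 \<le> log 2 (card T)" "log 2 (card T) \<le> real m"
proof -
  have "finite T" using assms finite_subset by blast
  then have pos: "0 < card T" using assms(3) by (simp add: card_gt_0_iff)
  then show "0 \<le> log 2 (card T)" by (simp add: zero_le_log_cancel_iff)
  have "card T \<le> 2 ^ m" using card_mono[OF assms(1,2)] assms(4) by simp
  then have "real (card T) \<le> 2 powr real m" by (simp add: powr_realpow flip: of_nat_le_iff)
  then have "log 2 (card T) \<le> log 2 (2 powr real m)" using pos by (subst log_le_cancel_iff) auto
  then show "log 2 (card T) \<le> real m" by simp
qed

definition trace_increment ::
    "('v \<Rightarrow> 'w) \<Rightarrow> 'v set set \<Rightarrow> 'w set set \<Rightarrow> 'v set set \<Rightarrow> 'w set set \<Rightarrow> real" where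
  "trace_increment f A A' S S' = log 2 (card (cycle_traces A S))
     - log 2 (card (bounded_cycle_traces f A A' S S')) + log 2 (card (cycle_traces A' S'))"

text \<open>Each of the three counts in \<open>homology_rank_eq\<close> factors into the count after deletion and a number of traces, so that the logarithms of the numbers of traces are all that remains of the difference.\<close>
theorem homology_rank_increment:
  fixes K K0 :: "'v set set" and L L0 :: "'w set set"
  assumes fin: "finite (simplices K q)" "finite (simplices L (Suc q))"
    and f: "simplicial_on K L f" "simplicial_on K0 L0 f"
    and K0: "simplices K0 q = simplices K q - S" and L0: "simplices L0 (Suc q) = simplices L (Suc q) - S'"
  shows "real (homology_rank K L q f) - real (homology_rank K0 L0 q f)
    = trace_increment f (simplices K q) (simplices L (Suc q)) S S'"
proof -
  have pos: "0 < card (cycles_on A)" "0 < card (bounded_cycles_on f A A')"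
      if "finite A" "finite A'" for A :: "'v set set" and A' :: "'w set set"
    using finite_cycles_on[OF that(1)] finite_bounded_cycles_on[OF that, of f] binary_group_cycles_on[of A] binary_group_bounded_cycles_on[of f A A']
    unfolding binary_group_def card_gt_0_iff by blast+
  have pos': "0 < card (cycles_on A')" if "finite A'" for A' :: "'w set set"
    using finite_cycles_on[OF that] binary_group_cycles_on[of A'] unfolding binary_group_def card_gt_0_iff by blast
  have l: "log 2 (real a) = log 2 (real b) + log 2 (real c)" if "a = b * c" "0 < a" for a b c :: nat
    using that by (simp add: log_mult)
  have fin0: "finite (simplices K0 q)" "finite (simplices L0 (Suc q))" using fin K0 L0 by auto
  show ?thesis
    unfolding homology_rank_eq[OF fin f(1)] homology_rank_eq[OF fin0 f(2)] trace_increment_def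
    unfolding K0 L0 l[OF card_cycles_on[OF fin(1), of S] pos(1)[OF fin]] l[OF card_cycles_on[OF fin(2), of S'] pos'[OF fin(2)]]
      l[OF card_bounded_cycles_on[OF fin, of f S S'] pos(2)[OF fin]]
    by simp
qed

lemma abs_trace_increment_le:
  assumes "finite A" "finite A'"
  shows "\<bar>trace_increment f A A' S S'\<bar> \<le> real (card (A \<inter> S)) + real (card (A' \<inter> S'))"
proof -
  have f: "finite (Pow (A \<inter> S))" "finite (Pow (A' \<inter> S'))" "finite (Pow (A \<inter> S) \<times> Pow (A' \<inter> S'))" using assms by auto
  have p: "card (Pow (A \<inter> S)) = 2 ^ card (A \<inter> S)" "card (Pow (A' \<inter> S')) = 2 ^ card (A' \<inter> S')"
    by (rule card_Pow, use assms in simp)+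
  have c: "card (Pow (A \<inter> S)) \<le> 2 ^ card (A \<inter> S)" "card (Pow (A' \<inter> S')) \<le> 2 ^ card (A' \<inter> S')"
    "card (Pow (A \<inter> S) \<times> Pow (A' \<inter> S')) \<le> 2 ^ (card (A \<inter> S) + card (A' \<inter> S'))"
    unfolding card_cartesian_product p power_add by (rule order_refl)+
  show ?thesis
    using log_card_bounds[OF f(1) cycle_traces_subset traces_nonempty(1) c(1)]
      log_card_bounds[OF f(2) cycle_traces_subset traces_nonempty(1) c(2)]
      log_card_bounds[OF f(3) bounded_cycle_traces_subset traces_nonempty(2) c(3), of f]
    unfolding trace_increment_def by simp
qed

text \<open>Each of the finitely many values that ever occur has a finite witness; the union of the witnesses is a window from which on nothing new appears.\<close>
lemma monotone_bounded_stabilizes: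
  fixes F :: "'i set \<Rightarrow> 'b set"
  assumes mono: "\<And>W W'. W \<subseteq> W' \<Longrightarrow> finite W' \<Longrightarrow> F W \<subseteq> F W'"
    and B: "finite B" "\<And>W. finite W \<Longrightarrow> F W \<subseteq> B"
  shows "\<exists>W0. finite W0 \<and> (\<forall>W. finite W \<longrightarrow> W0 \<subseteq> W \<longrightarrow> F W = F W0)"
proof -
  define U where "U = (\<Union>W\<in>Collect finite. F W)"
  have "U \<subseteq> B" using B(2) unfolding U_def by blast
  then have "finite U" using B(1) by (rule finite_subset)
  moreover have "\<forall>b\<in>U. \<exists>W. finite W \<and> b \<in> F W" unfolding U_def by blast
  then obtain g where g: "\<And>b. b \<in> U \<Longrightarrow> finite (g b) \<and> b \<in> F (g b)" by metis
  define W0 where "W0 = (\<Union>b\<in>U. g b)"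
  have W0: "finite W0" unfolding W0_def using \<open>finite U\<close> g by blast
  have "F W = F W0" if "finite W" "W0 \<subseteq> W" for W
  proof
    show "F W0 \<subseteq> F W" by (rule mono[OF that(2,1)])
    show "F W \<subseteq> F W0"
    proof
      fix b assume "b \<in> F W"
      then have "b \<in> U" unfolding U_def using that(1) by blast
      then have "b \<in> F (g b)" "g b \<subseteq> W0" using g unfolding W0_def by blast+
      then show "b \<in> F W0" using mono[OF _ W0] by blast
    qed
  qed
  then show ?thesis using W0 by blast
qed

text \<open>The three sets of traces are monotone in the complex, and they consist of subsets of the finitely many simplices of \<open>S\<close> and \<open>S'\<close> that ever appear.\<close>
lemma trace_increment_stabilizes:
  fixes A :: "'i set \<Rightarrow> 'v set set" and A' :: "'i set \<Rightarrow> 'w set set"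
  assumes mono: "\<And>W W'. W \<subseteq> W' \<Longrightarrow> A W \<subseteq> A W'" "\<And>W W'. W \<subseteq> W' \<Longrightarrow> A' W \<subseteq> A' W'"
    and fin: "finite (\<Union>W\<in>Collect finite. A W \<inter> S)" "finite (\<Union>W\<in>Collect finite. A' W \<inter> S')"
  shows "\<exists>W0. finite W0 \<and> (\<forall>W. finite W \<longrightarrow> W0 \<subseteq> W \<longrightarrow> trace_increment f (A W) (A' W) S S' = trace_increment f (A W0) (A' W0) S S')"
proof -
  let ?U = "\<Union>W\<in>Collect finite. A W \<inter> S" and ?U' = "\<Union>W\<in>Collect finite. A' W \<inter> S'"
  have "\<exists>W0. finite W0 \<and> (\<forall>W. finite W \<longrightarrow> W0 \<subseteq> W \<longrightarrow> cycle_traces (A W) S = cycle_traces (A W0) S)"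
  proof (rule monotone_bounded_stabilizes[where B = "Pow ?U"])
    show "cycle_traces (A W) S \<subseteq> Pow ?U" if "finite W" for W
      using cycle_traces_subset[of "A W" S] that by blast
    show "cycle_traces (A W) S \<subseteq> cycle_traces (A W') S" if "W \<subseteq> W'" for W W'
      by (rule cycle_traces_mono[OF mono(1)[OF that]])
    show "finite (Pow ?U)" using fin(1) unfolding finite_Pow_iff .
  qed
  then obtain W1 where W1: "finite W1" "\<And>W. finite W \<Longrightarrow> W1 \<subseteq> W \<Longrightarrow> cycle_traces (A W) S = cycle_traces (A W1) S" by blast
  have "\<exists>W0. finite W0 \<and> (\<forall>W. finite W \<longrightarrow> W0 \<subseteq> W \<longrightarrow> cycle_traces (A' W) S' = cycle_traces (A' W0) S')"
  proof (rule monotone_bounded_stabilizes[where B = "Pow ?U'"])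
    show "cycle_traces (A' W) S' \<subseteq> Pow ?U'" if "finite W" for W
      using cycle_traces_subset[of "A' W" S'] that by blast
    show "cycle_traces (A' W) S' \<subseteq> cycle_traces (A' W') S'" if "W \<subseteq> W'" for W W'
      by (rule cycle_traces_mono[OF mono(2)[OF that]])
    show "finite (Pow ?U')" using fin(2) unfolding finite_Pow_iff .
  qed
  then obtain W2 where W2: "finite W2" "\<And>W. finite W \<Longrightarrow> W2 \<subseteq> W \<Longrightarrow> cycle_traces (A' W) S' = cycle_traces (A' W2) S'" by blast
  have "\<exists>W0. finite W0 \<and> (\<forall>W. finite W \<longrightarrow> W0 \<subseteq> W \<longrightarrow> bounded_cycle_traces f (A W) (A' W) S S' = bounded_cycle_traces f (A W0) (A' W0) S S')"
  proof (rule monotone_bounded_stabilizes[where B = "Pow ?U \<times> Pow ?U'"])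
    show "bounded_cycle_traces f (A W) (A' W) S S' \<subseteq> Pow ?U \<times> Pow ?U'" if "finite W" for W
      using bounded_cycle_traces_subset[of f "A W" "A' W" S S'] that by blast
    show "bounded_cycle_traces f (A W) (A' W) S S' \<subseteq> bounded_cycle_traces f (A W') (A' W') S S'" if "W \<subseteq> W'" for W W'
      by (rule bounded_cycle_traces_mono[OF mono[OF that]])
    show "finite (Pow ?U \<times> Pow ?U')"
      using fin by (intro finite_cartesian_product) (simp_all only: finite_Pow_iff)
  qed
  then obtain W3 where W3: "finite W3" "\<And>W. finite W \<Longrightarrow> W3 \<subseteq> W \<Longrightarrow> bounded_cycle_traces f (A W) (A' W) S S' = bounded_cycle_traces f (A W3) (A' W3) S S'" by blast
  define W0 where "W0 = W1 \<union> W2 \<union> W3"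
  have f0: "finite W0" using W1(1) W2(1) W3(1) by (simp add: W0_def)
  have "trace_increment f (A W) (A' W) S S' = trace_increment f (A W0) (A' W0) S S'" if W: "finite W" "W0 \<subseteq> W" for W
  proof -
    have s: "W1 \<subseteq> W" "W2 \<subseteq> W" "W3 \<subseteq> W" "W1 \<subseteq> W0" "W2 \<subseteq> W0" "W3 \<subseteq> W0" using W by (auto simp: W0_def)
    show ?thesis
      unfolding trace_increment_def W1(2)[OF W(1) s(1)] W2(2)[OF W(1) s(2)] W3(2)[OF W(1) s(3)]
        W1(2)[OF f0 s(4)] W2(2)[OF f0 s(5)] W3(2)[OF f0 s(6)] ..
  qed
  then show ?thesis using f0 by blast
qed


section \<open>Multicover complexes\<close>

definition covered :: "real \<Rightarrow> 'a::metric_space set \<Rightarrow> bool" where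
  "covered r \<sigma> \<longleftrightarrow> (\<exists>y. \<forall>x\<in>\<sigma>. dist y x \<le> r)"

text \<open>The infimum in the definition of the radius is attained: centres of nearly optimal balls stay in a compact set.\<close>
lemma cech_radius_le_iff:
  fixes \<sigma> :: "(real ^ 'n) set"
  assumes \<sigma>: "finite \<sigma>" "\<sigma> \<noteq> {}"
  shows "cech_radius \<sigma> \<le> r \<longleftrightarrow> covered r \<sigma>"
proof -
  define g where "g y = Max ((\<lambda>x. dist y x) ` \<sigma>)" for y
  have g_le: "g y \<le> t \<longleftrightarrow> (\<forall>x\<in>\<sigma>. dist y x \<le> t)" for y t
    unfolding g_def using \<sigma> by (subst Max_le_iff) auto
  have cont: "continuous_on UNIV g"
    unfolding g_def using \<sigma> by (induction \<sigma> rule: finite_ne_induct) (auto simp: Max_insert intro!: continuous_intros continuous_on_max)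
  obtain x0 where x0: "x0 \<in> \<sigma>" using \<sigma> by blast
  have dist_g: "dist y x \<le> g y" if "x \<in> \<sigma>" for x y using g_le[of y "g y"] that by blast
  have g0: "0 \<le> g y" for y using dist_g[OF x0, of y] zero_le_dist[of y x0] by linarith
  have x0_in: "x0 \<in> cball x0 (g x0)" using g0[of x0] by simp
  obtain y0 where y0: "y0 \<in> cball x0 (g x0)" "\<And>y. y \<in> cball x0 (g x0) \<Longrightarrow> g y0 \<le> g y"
    using continuous_attains_inf[OF compact_cball[of x0 "g x0"] _ continuous_on_subset[OF cont subset_UNIV]] x0_in by blast
  have min: "g y0 \<le> g y" for y
  proof (cases "y \<in> cball x0 (g x0)")
    case False
    then have "g x0 < dist y x0" by (simp add: dist_commute)
    moreover have "dist y x0 \<le> g y" by (rule dist_g[OF x0])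
    moreover have "g y0 \<le> g x0" by (rule y0(2)[OF x0_in])
    ultimately show ?thesis by linarith
  qed (rule y0(2))
  have P: "(\<Inter>x\<in>\<sigma>. cball x t) \<noteq> {} \<longleftrightarrow> (\<exists>y. g y \<le> t)" for t
  proof -
    have "(\<Inter>x\<in>\<sigma>. cball x t) = {y. \<forall>x\<in>\<sigma>. dist y x \<le> t}" by (auto simp: dist_commute)
    then show ?thesis unfolding g_le by simp
  qed
  have "cech_radius \<sigma> = g y0"
    unfolding cech_radius_def P
  proof (rule Least_equality)
    show "0 \<le> g y0 \<and> (\<exists>y. g y \<le> g y0)" using g0 by blast
    show "g y0 \<le> t" if "0 \<le> t \<and> (\<exists>y. g y \<le> t)" for t using that min order_trans by blast
  qed
  then show ?thesis
    unfolding covered_def g_le[symmetric] using min by (auto intro: order_trans)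
qed

lemma in_Mult_iff:
  "\<Phi> \<in> Mult r k P \<longleftrightarrow> finite \<Phi> \<and> \<Phi> \<noteq> {} \<and> (\<forall>\<phi>\<in>\<Phi>. finite \<phi> \<and> card \<phi> = k) \<and> \<Union>\<Phi> \<subseteq> P \<and> \<Union>\<Phi> \<noteq> {} \<and> covered r (\<Union>\<Phi>)"
proof -
  have "finite (\<Union>\<Phi>)" if "finite \<Phi>" "\<forall>\<phi>\<in>\<Phi>. finite \<phi>" using that by blast
  then show ?thesis
    unfolding Mult_def Cech_def using cech_radius_le_iff[of "\<Union>\<Phi>" r] by blast
qed

lemma covered_mono: "covered r \<sigma> \<Longrightarrow> \<tau> \<subseteq> \<sigma> \<Longrightarrow> r \<le> r' \<Longrightarrow> covered r' \<tau>"
  unfolding covered_def by (blast intro: order_trans)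

text \<open>All points lie within \<open>r\<close> of a common centre. This bounds the diameter of simplices and makes the complex local.\<close>
lemma covered_dist: "covered r \<sigma> \<Longrightarrow> x \<in> \<sigma> \<Longrightarrow> y \<in> \<sigma> \<Longrightarrow> dist x y \<le> 2 * r"
proof -
  assume "covered r \<sigma>" "x \<in> \<sigma>" "y \<in> \<sigma>"
  then obtain z where "dist z x \<le> r" "dist z y \<le> r" unfolding covered_def by blast
  then show "dist x y \<le> 2 * r" using dist_triangle2[of x y z] by (simp add: dist_commute)
qed

lemma Mult_mono: "P \<subseteq> P' \<Longrightarrow> Mult r k P \<subseteq> Mult r k P'"
proof
  fix \<Phi> assume "P \<subseteq> P'" "\<Phi> \<in> Mult r k P"
  then show "\<Phi> \<in> Mult r k P'" unfolding in_Mult_iff by (simp add: subset_trans[of _ P P'])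
qed

lemma finite_Mult: "finite P \<Longrightarrow> finite (Mult r k P)"
proof (rule finite_subset[of _ "Pow (Pow P)"], rule subsetI)
  fix \<Phi> assume "\<Phi> \<in> Mult r k P"
  then have "\<Union>\<Phi> \<subseteq> P" unfolding in_Mult_iff by blast
  then show "\<Phi> \<in> Pow (Pow P)" by blast
qed simp

lemma lex_less_irrefl: "\<not> lex_less x x"
  by (simp add: lex_less_def)

lemma lex_less_trans: "lex_less x y \<Longrightarrow> lex_less y z \<Longrightarrow> lex_less x z"
proof -
  assume xy: "lex_less x y" and yz: "lex_less y z"
  obtain i where i: "x $ i < y $ i" "\<And>l. l < i \<Longrightarrow> x $ l = y $ l"
    using xy unfolding lex_less_def by (elim exE conjE) simp
  obtain j where j: "y $ j < z $ j" "\<And>l. l < j \<Longrightarrow> y $ l = z $ l"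
    using yz unfolding lex_less_def by (elim exE conjE) simp
  show "lex_less x z"
    unfolding lex_less_def
  proof (intro exI conjI allI impI)
    show "x $ (min i j) < z $ (min i j)"
    proof (cases i j rule: linorder_cases)
      case less
      then show ?thesis using i(1) j(2)[OF less] by (simp add: min_absorb1 less_imp_le)
    next
      case equal
      then show ?thesis using i(1) j(1) by simp
    next
      case greater
      then show ?thesis using j(1) i(2)[OF greater] by (simp add: min_absorb2 less_imp_le)
    qed
    show "x $ l = z $ l" if "l < min i j" for l using that i(2) j(2) by simp
  qed
qed

lemma lex_less_linear: "x \<noteq> y \<Longrightarrow> lex_less x y \<or> lex_less y x"
proof -
  assume "x \<noteq> y"
  have ne: "{i. x $ i \<noteq> y $ i} \<noteq> {}"
  proof
    assume *: "{i. x $ i \<noteq> y $ i} = {}"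
    have "x $ i = y $ i" for i using * by (simp only: Collect_empty_eq simp_thms)
    then have "x = y" by (simp add: Finite_Cartesian_Product.vec_eq_iff)
    then show False using \<open>x \<noteq> y\<close> by contradiction
  qed
  define i where "i = Min {i. x $ i \<noteq> y $ i}"
  have "x $ i \<noteq> y $ i" using Min_in[OF _ ne] unfolding i_def by simp
  moreover have eq: "x $ j = y $ j" if "j < i" for j
  proof (rule ccontr)
    assume "x $ j \<noteq> y $ j"
    then have "i \<le> j" unfolding i_def by (intro Min_le) simp_all
    then show False using that by simp
  qed
  moreover have "lex_less x y" if "x $ i < y $ i"
    unfolding lex_less_def using that eq by (intro exI[of _ i]) simp
  moreover have "lex_less y x" if "y $ i < x $ i"
    unfolding lex_less_def using that eq by (intro exI[of _ i]) simp
  ultimately show ?thesis using \<open>x $ i \<noteq> y $ i\<close> by linarith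
qed

lemma card_lex_smallest:
  assumes "finite \<phi>" "k \<le> card \<phi>"
  shows "card (lex_smallest k \<phi>) = k"
proof -
  define rk where "rk x = card {y\<in>\<phi>. lex_less y x}" for x
  have less: "rk x < rk y" if "x \<in> \<phi>" "lex_less x y" for x y
    unfolding rk_def
  proof (rule psubset_card_mono)
    show "{z \<in> \<phi>. lex_less z x} \<subset> {z \<in> \<phi>. lex_less z y}"
      using that lex_less_trans lex_less_irrefl by blast
  qed (use assms in auto)
  have inj: "inj_on rk \<phi>"
  proof (rule inj_onI, rule ccontr)
    fix x y assume "x \<in> \<phi>" "y \<in> \<phi>" "rk x = rk y" "x \<noteq> y"
    then show False using lex_less_linear[of x y] less[of x y] less[of y x] by auto
  qed
  have sub: "rk ` \<phi> \<subseteq> {..<card \<phi>}"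
  proof (rule image_subsetI)
    fix x assume "x \<in> \<phi>"
    then have "{y\<in>\<phi>. lex_less y x} \<subset> \<phi>" using lex_less_irrefl by blast
    then show "rk x \<in> {..<card \<phi>}" unfolding rk_def using psubset_card_mono[OF assms(1)] by blast
  qed
  have "rk ` \<phi> = {..<card \<phi>}"
    by (rule card_subset_eq[OF _ sub]) (simp_all add: card_image[OF inj])
  have "rk ` lex_smallest k \<phi> = {..<k}"
  proof (intro equalityI subsetI)
    fix i assume "i \<in> {..<k}"
    then have "i \<in> rk ` \<phi>" unfolding \<open>rk ` \<phi> = {..<card \<phi>}\<close> using assms(2) by simp
    then show "i \<in> rk ` lex_smallest k \<phi>"
      using \<open>i \<in> {..<k}\<close> by (auto simp: lex_smallest_def rk_def)
  qed (auto simp: lex_smallest_def rk_def)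
  moreover have "inj_on rk (lex_smallest k \<phi>)"
    by (rule inj_on_subset[OF inj]) (auto simp: lex_smallest_def)
  ultimately show ?thesis using card_image[of rk "lex_smallest k \<phi>"] by simp
qed

text \<open>The chosen \<open>k'\<close> smallest elements of each vertex form a subset of it, so the union of a simplex only shrinks, while the radius and the point set grow.\<close>
lemma simplicial_on_Mult:
  assumes "r \<le> r'" "k' \<le> k" "1 \<le> k'" "P \<subseteq> P'"
  shows "simplicial_on (Mult r k P) (Mult r' k' P') (lex_smallest k')"
  unfolding simplicial_on_def
proof (intro ballI impI)
  fix \<Phi> assume \<Phi>: "\<Phi> \<in> Mult r k P"
  note \<Phi>' = \<Phi>[unfolded in_Mult_iff]
  have m: "finite \<Phi>" "\<Phi> \<noteq> {}" "\<And>\<phi>. \<phi> \<in> \<Phi> \<Longrightarrow> finite \<phi> \<and> card \<phi> = k" "\<Union>\<Phi> \<subseteq> P" "covered r (\<Union>\<Phi>)"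
    by (use \<Phi>' in simp)+
  have sub: "lex_smallest k' \<phi> \<subseteq> \<phi>" for \<phi> by (auto simp: lex_smallest_def)
  have c: "finite (lex_smallest k' \<phi>) \<and> card (lex_smallest k' \<phi>) = k'" if "\<phi> \<in> \<Phi>" for \<phi>
    using card_lex_smallest[of \<phi> k'] m(3)[OF that] assms(2) finite_subset[OF sub[of \<phi>]] by simp
  have U: "\<Union>(lex_smallest k' ` \<Phi>) \<subseteq> \<Union>\<Phi>" using sub by blast
  obtain \<phi> where \<phi>: "\<phi> \<in> \<Phi>" using m(2) by blast
  have "lex_smallest k' \<phi> \<noteq> {}" using c[OF \<phi>] assms(3) by auto
  then have ne: "\<Union>(lex_smallest k' ` \<Phi>) \<noteq> {}" using \<phi> by blast
  have sub': "\<Union>(lex_smallest k' ` \<Phi>) \<subseteq> P'" by (rule order_trans[OF U order_trans[OF m(4) assms(4)]])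
  have c': "\<forall>\<phi>\<in>lex_smallest k' ` \<Phi>. finite \<phi> \<and> card \<phi> = k'"
    using c by blast
  have ne': "lex_smallest k' ` \<Phi> \<noteq> {}" using m(2) by simp
  show "lex_smallest k' ` \<Phi> \<in> Mult r' k' P'"
    unfolding in_Mult_iff
    by (rule conjI[OF finite_imageI[OF m(1)] conjI[OF ne' conjI[OF c' conjI[OF sub' conjI[OF ne covered_mono[OF m(5) U assms(1)]]]]]])
qed

section \<open>Relabelling vertices\<close>

lemma linear_extension_cong:
  "(\<And>\<sigma>. \<sigma> \<in> Poly_Mapping.keys c \<Longrightarrow> g \<sigma> = h \<sigma>) \<Longrightarrow> linear_extension g c = linear_extension h c"
  unfolding linear_extension_def by (rule sum.cong[OF refl])

text \<open>On a simplex that \<open>h\<close> collapses both sides vanish; elsewhere functoriality holds simplex by simplex.\<close>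
lemma chain_map_comp:
  assumes "\<And>\<sigma>. \<sigma> \<in> Poly_Mapping.keys c \<Longrightarrow> inj_on h \<sigma> \<or> inj_on f (h ` \<sigma>) \<and> \<not> inj_on (f \<circ> h) \<sigma>"
  shows "chain_map f (chain_map h c) = chain_map (f \<circ> h) c"
  unfolding chain_map_eq linear_extension_comp
proof (rule linear_extension_cong)
  fix \<sigma> assume "\<sigma> \<in> Poly_Mapping.keys c"
  then consider "inj_on h \<sigma>" | "\<not> inj_on h \<sigma>" "\<not> inj_on (f \<circ> h) \<sigma>" using assms by blast
  then show "linear_extension (simplex_image f) (simplex_image h \<sigma>) = simplex_image (f \<circ> h) \<sigma>"
  proof cases
    case 1
    then have "linear_extension (simplex_image f) (simplex_image h \<sigma>) = simplex_image f (h ` \<sigma>)"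
      by (simp add: simplex_image_def)
    also have "\<dots> = simplex_image (f \<circ> h) \<sigma>"
      using 1 comp_inj_on_iff[of h \<sigma> f] by (simp add: simplex_image_def image_comp)
    finally show ?thesis .
  qed (simp add: simplex_image_def)
qed

lemma chain_map_cong:
  assumes "\<And>\<sigma> v. \<sigma> \<in> Poly_Mapping.keys c \<Longrightarrow> v \<in> \<sigma> \<Longrightarrow> f v = g v"
  shows "chain_map f c = chain_map g c"
  unfolding chain_map_eq
proof (rule linear_extension_cong)
  fix \<sigma> assume "\<sigma> \<in> Poly_Mapping.keys c"
  then have eq: "\<And>v. v \<in> \<sigma> \<Longrightarrow> f v = g v" using assms by blast
  have "inj_on f \<sigma> \<longleftrightarrow> inj_on g \<sigma>" by (rule inj_on_cong) (rule eq)
  moreover have "f ` \<sigma> = g ` \<sigma>" by (rule image_cong[OF refl eq])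
  ultimately show "simplex_image f \<sigma> = simplex_image g \<sigma>" by (simp add: simplex_image_def)
qed

lemma chain_map_id: "chain_map (\<lambda>v. v) c = c"
proof -
  have "chain_map (\<lambda>v. v) c = (\<Sum>\<sigma>\<in>Poly_Mapping.keys c. Poly_Mapping.single \<sigma> 1)"
    by (simp add: chain_map_eq linear_extension_def simplex_image_def)
  also have "\<dots> = c"
  proof (rule poly_mapping_eqI)
    fix \<tau>
    have "(\<Sum>\<sigma>\<in>Poly_Mapping.keys c. Poly_Mapping.lookup (Poly_Mapping.single \<sigma> (1 :: bit)) \<tau>) = (if \<tau> \<in> Poly_Mapping.keys c then 1 else 0)"
      by (simp add: lookup_single when_def sum.delta)
    then show "Poly_Mapping.lookup (\<Sum>\<sigma>\<in>Poly_Mapping.keys c. Poly_Mapping.single \<sigma> 1) \<tau> = Poly_Mapping.lookup c \<tau>"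
      by (simp add: lookup_sum in_keys_iff)
  qed
  finally show ?thesis .
qed

lemma keys_chain_map_subset:
  "Poly_Mapping.keys c \<subseteq> A \<Longrightarrow> Poly_Mapping.keys (chain_map f c) \<subseteq> (`) f ` A"
proof -
  assume c: "Poly_Mapping.keys c \<subseteq> A"
  have "Poly_Mapping.keys (simplex_image f \<sigma>) \<subseteq> (`) f ` A" if "\<sigma> \<in> A" for \<sigma>
    using that by (simp add: simplex_image_def)
  then have *: "\<sigma> \<in> Poly_Mapping.keys c \<Longrightarrow> Poly_Mapping.keys (simplex_image f \<sigma>) \<subseteq> (`) f ` A" for \<sigma>
    using c by blast
  have "Poly_Mapping.keys (\<Sum>\<sigma>\<in>I. simplex_image f \<sigma>) \<subseteq> (`) f ` A" if "finite I" "I \<subseteq> Poly_Mapping.keys c" for I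
    using that by (induction I) (simp_all add: keys_add_subset *)
  then show ?thesis unfolding chain_map_eq linear_extension_def by simp
qed

text \<open>An injective relabelling on the vertices \<open>V\<close> induces an isomorphism on chains supported there, with the relabelling by the inverse as its inverse.\<close>
locale vertex_bijection =
  fixes h :: "'v \<Rightarrow> 'w" and V :: "'v set"
  assumes inj: "inj_on h V"
begin

definition lower :: "'w \<Rightarrow> 'v" where "lower = the_inv_into V h"

definition admissible :: "'v set set \<Rightarrow> bool" where
  "admissible A \<longleftrightarrow> (\<forall>\<sigma>\<in>A. finite \<sigma> \<and> \<sigma> \<subseteq> V)"

lemma lower_h: "v \<in> V \<Longrightarrow> lower (h v) = v"
  unfolding lower_def by (rule the_inv_into_f_f[OF inj])

lemma h_lower: "w \<in> h ` V \<Longrightarrow> h (lower w) = w"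
  unfolding lower_def by (rule f_the_inv_into_f[OF inj])

lemma inj_lower: "inj_on lower (h ` V)"
  by (rule inj_on_inverseI[of _ h]) (rule h_lower)

lemma lower_image: "admissible A \<Longrightarrow> \<sigma> \<in> A \<Longrightarrow> lower ` h ` \<sigma> = \<sigma>"
  unfolding admissible_def by (force simp: image_image lower_h)

lemma lower_chain:
  assumes "admissible A" "Poly_Mapping.keys c \<subseteq> A"
  shows "chain_map lower (chain_map h c) = c"
proof -
  have *: "\<sigma> \<subseteq> V" if "\<sigma> \<in> Poly_Mapping.keys c" for \<sigma> using assms that unfolding admissible_def by blast
  have "chain_map lower (chain_map h c) = chain_map (lower \<circ> h) c"
    by (rule chain_map_comp) (use inj_on_subset[OF inj *] in blast)
  also have "\<dots> = chain_map (\<lambda>v. v) c"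
    by (rule chain_map_cong) (use * lower_h in auto)
  finally show ?thesis by (simp add: chain_map_id)
qed

lemma forth_chain:
  assumes "admissible A" "Poly_Mapping.keys c \<subseteq> (`) h ` A"
  shows "chain_map h (chain_map lower c) = c"
proof -
  have *: "\<sigma> \<subseteq> h ` V" if "\<sigma> \<in> Poly_Mapping.keys c" for \<sigma> using assms that unfolding admissible_def by blast
  have "chain_map h (chain_map lower c) = chain_map (h \<circ> lower) c"
    by (rule chain_map_comp) (use inj_on_subset[OF inj_lower *] in blast)
  also have "\<dots> = chain_map (\<lambda>v. v) c"
    by (rule chain_map_cong) (use * h_lower in auto)
  finally show ?thesis by (simp add: chain_map_id)
qed

lemma keys_forth: "Poly_Mapping.keys c \<subseteq> A \<Longrightarrow> Poly_Mapping.keys (chain_map h c) \<subseteq> (`) h ` A"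
  by (rule keys_chain_map_subset)

lemma keys_lower:
  assumes "admissible A" "Poly_Mapping.keys c \<subseteq> (`) h ` A"
  shows "Poly_Mapping.keys (chain_map lower c) \<subseteq> A"
proof -
  have "(`) lower ` (`) h ` A \<subseteq> A" using lower_image[OF assms(1)] by auto
  then show ?thesis using keys_chain_map_subset[OF assms(2), of lower] by (rule subset_trans[rotated])
qed

lemma boundary_forth:
  assumes "admissible A" "Poly_Mapping.keys c \<subseteq> A"
  shows "boundary_map (chain_map h c) = chain_map h (boundary_map c)"
  by (rule boundary_chain_map[symmetric]) (use assms in \<open>auto simp: admissible_def\<close>)

lemma boundary_lower:
  assumes "admissible A" "Poly_Mapping.keys c \<subseteq> (`) h ` A"
  shows "boundary_map (chain_map lower c) = chain_map lower (boundary_map c)"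
proof (rule boundary_chain_map[symmetric])
  fix \<sigma> assume "\<sigma> \<in> Poly_Mapping.keys c"
  then obtain \<tau> where "\<tau> \<in> A" "\<sigma> = h ` \<tau>" using assms(2) by blast
  then show "finite \<sigma>" using assms(1) unfolding admissible_def by blast
qed

lemma card_cycles_on_image:
  assumes A: "admissible A"
  shows "card (cycles_on ((`) h ` A)) = card (cycles_on A)"
proof -
  have "bij_betw (chain_map h) (cycles_on A) (cycles_on ((`) h ` A))"
  proof (rule bij_betw_byWitness[where f' = "chain_map lower"])
    show "\<forall>c\<in>cycles_on A. chain_map lower (chain_map h c) = c"
      using lower_chain[OF A] unfolding cycles_on_def by blast
    show "\<forall>c\<in>cycles_on ((`) h ` A). chain_map h (chain_map lower c) = c"
      using forth_chain[OF A] unfolding cycles_on_def by blast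
    show "chain_map h ` cycles_on A \<subseteq> cycles_on ((`) h ` A)"
      unfolding cycles_on_def by (clarsimp simp: keys_forth boundary_forth[OF A])
    show "chain_map lower ` cycles_on ((`) h ` A) \<subseteq> cycles_on A"
      unfolding cycles_on_def by (clarsimp simp: keys_lower[OF A] boundary_lower[OF A])
  qed
  then show ?thesis by (rule bij_betw_same_card[symmetric])
qed

lemma card_bounded_cycles_on_image:
  assumes A: "admissible A" and A': "admissible A'"
    and f: "\<And>v. v \<in> V \<Longrightarrow> f v \<in> V \<and> g (h v) = h (f v)"
  shows "card (bounded_cycles_on g ((`) h ` A) ((`) h ` A')) = card (bounded_cycles_on f A A')"
proof -
  have comm: "chain_map g (chain_map h z) = chain_map h (chain_map f z)" if "Poly_Mapping.keys z \<subseteq> A" for z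
  proof -
    have *: "\<sigma> \<subseteq> V" if "\<sigma> \<in> Poly_Mapping.keys z" for \<sigma> using A that \<open>_ \<subseteq> A\<close> unfolding admissible_def by blast
    have "chain_map g (chain_map h z) = chain_map (g \<circ> h) z"
      by (rule chain_map_comp) (use inj_on_subset[OF inj *] in blast)
    also have "\<dots> = chain_map (h \<circ> f) z"
      by (rule chain_map_cong) (use * f in auto)
    also have "\<dots> = chain_map h (chain_map f z)"
    proof (rule chain_map_comp[symmetric])
      fix \<sigma> assume "\<sigma> \<in> Poly_Mapping.keys z"
      then have "f ` \<sigma> \<subseteq> V" using * f by blast
      then have "inj_on h (f ` \<sigma>)" by (rule inj_on_subset[OF inj])
      moreover have "inj_on f \<sigma>" if "inj_on (h \<circ> f) \<sigma>" by (rule inj_on_imageI2[OF that])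
      ultimately show "inj_on f \<sigma> \<or> inj_on h (f ` \<sigma>) \<and> \<not> inj_on (h \<circ> f) \<sigma>" by blast
    qed
    finally show ?thesis .
  qed
  have inv: "z = z'" if "Poly_Mapping.keys z \<subseteq> A'" "chain_map h z = chain_map h z'" "Poly_Mapping.keys z' \<subseteq> A''" "admissible A''" for z z' A''
    using lower_chain[OF A' that(1)] lower_chain[OF that(4,3)] that(2) by metis
  have "bij_betw (\<lambda>(z, y). (chain_map h z, chain_map h y)) (bounded_cycles_on f A A') (bounded_cycles_on g ((`) h ` A) ((`) h ` A'))"
  proof (rule bij_betw_byWitness[where f' = "\<lambda>(z, y). (chain_map lower z, chain_map lower y)"])
    show "\<forall>c\<in>bounded_cycles_on f A A'. (\<lambda>(z, y). (chain_map lower z, chain_map lower y)) ((\<lambda>(z, y). (chain_map h z, chain_map h y)) c) = c"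
      using lower_chain[OF A] lower_chain[OF A'] unfolding bounded_cycles_on_def by auto
    show "\<forall>c\<in>bounded_cycles_on g ((`) h ` A) ((`) h ` A'). (\<lambda>(z, y). (chain_map h z, chain_map h y)) ((\<lambda>(z, y). (chain_map lower z, chain_map lower y)) c) = c"
      using forth_chain[OF A] forth_chain[OF A'] unfolding bounded_cycles_on_def by auto
    show "(\<lambda>(z, y). (chain_map h z, chain_map h y)) ` bounded_cycles_on f A A' \<subseteq> bounded_cycles_on g ((`) h ` A) ((`) h ` A')"
    proof (clarsimp simp: bounded_cycles_on_def keys_forth)
      fix z y assume zy: "boundary_map z = 0" "chain_map f z = boundary_map y" "Poly_Mapping.keys z \<subseteq> A" "Poly_Mapping.keys y \<subseteq> A'"
      show "boundary_map (chain_map h z) = 0 \<and> chain_map g (chain_map h z) = boundary_map (chain_map h y)"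
        unfolding boundary_forth[OF A zy(3)] boundary_forth[OF A' zy(4)] comm[OF zy(3)] zy(1,2) by simp
    qed
    show "(\<lambda>(z, y). (chain_map lower z, chain_map lower y)) ` bounded_cycles_on g ((`) h ` A) ((`) h ` A') \<subseteq> bounded_cycles_on f A A'"
    proof (clarsimp simp: bounded_cycles_on_def keys_lower[OF A] keys_lower[OF A'])
      fix z y assume zy: "boundary_map z = 0" "chain_map g z = boundary_map y" "Poly_Mapping.keys z \<subseteq> (`) h ` A" "Poly_Mapping.keys y \<subseteq> (`) h ` A'"
      define x where "x = chain_map f (chain_map lower z)"
      have "chain_map h x = chain_map g (chain_map h (chain_map lower z))"
        unfolding x_def by (rule comm[symmetric, OF keys_lower[OF A zy(3)]])
      also have "\<dots> = boundary_map y" unfolding forth_chain[OF A zy(3)] zy(2) ..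
      finally have hx: "chain_map h x = boundary_map y" .
      have "chain_map lower (chain_map h x) = x"
      proof (rule lower_chain)
        show "Poly_Mapping.keys x \<subseteq> (`) f ` A"
          unfolding x_def by (rule keys_chain_map_subset[OF keys_lower[OF A zy(3)]])
        show "admissible ((`) f ` A)" using A f unfolding admissible_def by blast
      qed
      then have "x = boundary_map (chain_map lower y)"
        unfolding boundary_lower[OF A' zy(4)] hx by simp
      then show "boundary_map (chain_map lower z) = 0 \<and> chain_map f (chain_map lower z) = boundary_map (chain_map lower y)"
        unfolding boundary_lower[OF A zy(3)] zy(1) x_def by simp
    qed
  qed
  then show ?thesis by (rule bij_betw_same_card[symmetric])
qed

end

text \<open>A bijection with this property induces an isomorphism of Cech complexes. It need not be an isometry: the definition also covers the change between two point sets that look alike only in terms of which subsets have small radius.\<close>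
definition shape_preserving :: "real \<Rightarrow> (real ^ 'n \<Rightarrow> real ^ 'n) \<Rightarrow> (real ^ 'n) set \<Rightarrow> bool" where
  "shape_preserving r g P \<longleftrightarrow> (\<forall>\<sigma>\<subseteq>P. covered r (g ` \<sigma>) \<longleftrightarrow> covered r \<sigma>)"

lemma Mult_image:
  assumes g: "inj_on g P" "shape_preserving r g P"
  shows "Mult r k (g ` P) = (`) ((`) g) ` Mult r k P"
proof (intro equalityI subsetI)
  fix \<Psi> assume \<Psi>: "\<Psi> \<in> Mult r k (g ` P)"
  note \<Psi>' = \<Psi>[unfolded in_Mult_iff]
  define b where "b = the_inv_into P g"
  have gb: "g ` b ` \<psi> = \<psi>" and bP: "b ` \<psi> \<subseteq> P" and cb: "card (b ` \<psi>) = card \<psi>" if "\<psi> \<in> \<Psi>" for \<psi>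
  proof -
    have sub: "\<psi> \<subseteq> g ` P" using \<Psi>' that by blast
    have *: "g (b x) = x" "b x \<in> P" if "x \<in> \<psi>" for x
      using f_the_inv_into_f[OF g(1), of x] the_inv_into_into[OF g(1), of x P] sub that unfolding b_def by blast+
    show "g ` b ` \<psi> = \<psi>" using *(1) by (force simp: image_image)
    show "b ` \<psi> \<subseteq> P" using *(2) by blast
    show "card (b ` \<psi>) = card \<psi>" by (rule card_image, rule inj_on_inverseI[of _ g], rule *(1))
  qed
  define \<Phi> where "\<Phi> = (`) b ` \<Psi>"
  have eq: "(`) g ` \<Phi> = \<Psi>" unfolding \<Phi>_def using gb by (force simp: image_image)
  have UP: "\<Union>\<Phi> \<subseteq> P" unfolding \<Phi>_def using bP by blast
  have U: "g ` \<Union>\<Phi> = \<Union>\<Psi>" unfolding eq[symmetric] by blast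
  have "\<Phi> \<in> Mult r k P"
    unfolding in_Mult_iff
  proof (intro conjI UP)
    show "finite \<Phi>" "\<Phi> \<noteq> {}" using \<Psi>' by (auto simp: \<Phi>_def)
    show "\<forall>\<phi>\<in>\<Phi>. finite \<phi> \<and> card \<phi> = k" using \<Psi>' cb by (auto simp: \<Phi>_def)
    show "\<Union>\<Phi> \<noteq> {}"
    proof
      assume "\<Union>\<Phi> = {}"
      then have "\<Union>\<Psi> = {}" unfolding U[symmetric] by simp
      then show False using \<Psi>' by blast
    qed
    show "covered r (\<Union>\<Phi>)" using g(2) UP U \<Psi>' unfolding shape_preserving_def by metis
  qed
  then show "\<Psi> \<in> (`) ((`) g) ` Mult r k P" using eq by blast
next
  fix \<Psi> assume "\<Psi> \<in> (`) ((`) g) ` Mult r k P"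
  then obtain \<Phi> where \<Phi>: "\<Phi> \<in> Mult r k P" "\<Psi> = (`) g ` \<Phi>" by blast
  note \<Phi>' = \<Phi>(1)[unfolded in_Mult_iff]
  have U: "\<Union>\<Psi> = g ` \<Union>\<Phi>" unfolding \<Phi>(2) by blast
  have c: "card (g ` \<phi>) = card \<phi>" if "\<phi> \<in> \<Phi>" for \<phi>
    by (rule card_image, rule inj_on_subset[OF g(1)]) (use \<Phi>' that in blast)
  show "\<Psi> \<in> Mult r k (g ` P)"
    unfolding in_Mult_iff
  proof (intro conjI)
    show "finite \<Psi>" "\<Psi> \<noteq> {}" using \<Phi>' by (auto simp: \<Phi>(2))
    show "\<forall>\<psi>\<in>\<Psi>. finite \<psi> \<and> card \<psi> = k" using \<Phi>' c by (auto simp: \<Phi>(2))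
    show "\<Union>\<Psi> \<noteq> {}" "\<Union>\<Psi> \<subseteq> g ` P" using U \<Phi>' by auto
    show "covered r (\<Union>\<Psi>)" unfolding U using g(2) \<Phi>' unfolding shape_preserving_def by blast
  qed
qed

lemma lex_smallest_image:
  assumes g: "inj_on g P" and lex: "\<And>x y. x \<in> P \<Longrightarrow> y \<in> P \<Longrightarrow> lex_less (g x) (g y) \<longleftrightarrow> lex_less x y" and \<phi>: "\<phi> \<subseteq> P"
  shows "lex_smallest k (g ` \<phi>) = g ` lex_smallest k \<phi>"
proof -
  have "card {y \<in> g ` \<phi>. lex_less y (g x)} = card {y \<in> \<phi>. lex_less y x}" if "x \<in> \<phi>" for x
  proof -
    have "{y \<in> g ` \<phi>. lex_less y (g x)} = g ` {y \<in> \<phi>. lex_less y x}" using lex \<phi> that by blast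
    moreover have "inj_on g {y \<in> \<phi>. lex_less y x}" by (rule inj_on_subset[OF g]) (use \<phi> in blast)
    ultimately show ?thesis by (simp add: card_image)
  qed
  then show ?thesis unfolding lex_smallest_def by auto
qed

text \<open>Membership in a multicover complex depends only on which subsets of points are covered, and the selection of vertices only on the lexicographic order; a bijection that preserves both is an isomorphism of the whole diagram. It is used for translations and for recognizing that a rank depends on finitely much information.\<close>
theorem multicover_rank_invariant:
  fixes g :: "real ^ 'n::{finite,linorder} \<Rightarrow> real ^ 'n::{finite,linorder}"
  assumes par: "r \<le> r'" "k' \<le> k" "1 \<le> k'" and P: "P \<subseteq> P'" "finite P'"
    and g: "inj_on g P'" and sh: "shape_preserving r g P'" "shape_preserving r' g P'"
    and lex: "\<And>x y. x \<in> P' \<Longrightarrow> y \<in> P' \<Longrightarrow> lex_less (g x) (g y) \<longleftrightarrow> lex_less x y"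
  shows "homology_rank (Mult r k (g ` P)) (Mult r' k' (g ` P')) q (lex_smallest k')
    = homology_rank (Mult r k P) (Mult r' k' P') q (lex_smallest k')"
proof -
  interpret vertex_bijection "(`) g" "Pow P'"
    by unfold_locales (rule inj_on_image_Pow[OF g])
  have gP: "inj_on g P" by (rule inj_on_subset[OF g P(1)])
  have shP: "shape_preserving r g P" using sh(1) P(1) unfolding shape_preserving_def by blast
  have sim: "simplices (Mult s l (g ` R)) p = (`) ((`) g) ` simplices (Mult s l R) p"
    if R: "R \<subseteq> P'" and s: "shape_preserving s g R" for s l R p
  proof -
    have gR: "inj_on g R" by (rule inj_on_subset[OF g R])
    have "inj_on ((`) g) \<Phi>" if "\<Phi> \<in> Mult s l R" for \<Phi>
      by (rule inj_on_subset[OF inj_on_image_Pow[OF gR]]) (use that in_Mult_iff in blast)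
    then have "card ((`) g ` \<Phi>) = card \<Phi>" if "\<Phi> \<in> Mult s l R" for \<Phi>
      using that by (intro card_image)
    moreover have "finite \<Phi>" if "\<Phi> \<in> Mult s l R" for \<Phi>
      using that unfolding in_Mult_iff by simp
    ultimately show ?thesis unfolding simplices_def Mult_image[OF gR s] by auto
  qed
  have fin: "finite (simplices (Mult s l R) p)" if "R \<subseteq> P'" for s l R p
    using finite_Mult[of R s l] finite_subset[OF that P(2)] by (simp add: simplices_def)
  have adm: "admissible (simplices (Mult s l R) p)" if "R \<subseteq> P'" for s l R p
    unfolding admissible_def simplices_def
  proof (intro ballI conjI)
    fix \<Phi> assume "\<Phi> \<in> {\<Phi> \<in> Mult s l R. finite \<Phi> \<and> card \<Phi> = p + 1}"
    then have "finite \<Phi>" "\<Union>\<Phi> \<subseteq> R" unfolding in_Mult_iff by simp_all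
    then show "finite \<Phi>" "\<Phi> \<subseteq> Pow P'" using that by auto
  qed
  note fK = simplicial_on_Mult[OF par P(1)]
  have gPP: "g ` P \<subseteq> g ` P'" using P(1) by (rule image_mono)
  note fK' = simplicial_on_Mult[OF par gPP]
  have f: "lex_smallest k' \<phi> \<in> Pow P' \<and> lex_smallest k' (g ` \<phi>) = g ` lex_smallest k' \<phi>" if "\<phi> \<in> Pow P'" for \<phi>
    using lex_smallest_image[OF g lex, of \<phi> k'] that by (auto simp: lex_smallest_def)
  have finK: "finite (simplices (Mult r k P) q)" "finite (simplices (Mult r' k' P') (Suc q))" using fin P(1) by auto
  have finK': "finite (simplices (Mult r k (g ` P)) q)" "finite (simplices (Mult r' k' (g ` P')) (Suc q))"
    using sim[OF P(1) shP] sim[OF subset_refl sh(2)] finK by simp_all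
  have bc: "card (bounded_cycles_on (lex_smallest k') ((`) ((`) g) ` simplices (Mult r k P) q) ((`) ((`) g) ` simplices (Mult r' k' P') (Suc q)))
      = card (bounded_cycles_on (lex_smallest k') (simplices (Mult r k P) q) (simplices (Mult r' k' P') (Suc q)))"
    by (rule card_bounded_cycles_on_image[where f = "lex_smallest k'" and g = "lex_smallest k'", OF adm[OF P(1)] adm[OF subset_refl] f])
  have "real (homology_rank (Mult r k (g ` P)) (Mult r' k' (g ` P')) q (lex_smallest k'))
    = real (homology_rank (Mult r k P) (Mult r' k' P') q (lex_smallest k'))"
    unfolding homology_rank_eq[OF finK fK] homology_rank_eq[OF finK' fK']
    unfolding sim[OF P(1) shP] sim[OF subset_refl sh(2)] card_cycles_on_image[OF adm[OF P(1)]]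
      card_cycles_on_image[OF adm[OF subset_refl]] bc ..
  then show ?thesis by simp
qed

section \<open>Variance of functions of independent coordinates\<close>

abbreviation iid_field :: "'s measure \<Rightarrow> ('i \<Rightarrow> 's) measure" where
  "iid_field N \<equiv> Pi\<^sub>M UNIV (\<lambda>_. N)"

text \<open>Equality on \<open>A\<close> is required only between points of the product space.\<close>
definition depends_on :: "'s measure \<Rightarrow> 'i set \<Rightarrow> (('i \<Rightarrow> 's) \<Rightarrow> 'b) \<Rightarrow> bool" where
  "depends_on N A g \<longleftrightarrow> (\<forall>\<omega>\<in>space (iid_field N). \<forall>\<omega>'\<in>space (iid_field N).
     (\<forall>i\<in>A. \<omega> i = \<omega>' i) \<longrightarrow> g \<omega> = g \<omega>')"

lemma depends_onD:
  assumes "depends_on N A g" "\<omega> \<in> space (iid_field N)" "\<omega>' \<in> space (iid_field N)" "\<And>i. i \<in> A \<Longrightarrow> \<omega> i = \<omega>' i"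
  shows "g \<omega> = g \<omega>'"
  using assms unfolding depends_on_def by blast

lemma depends_on_mono: "depends_on N A g \<Longrightarrow> A \<subseteq> B \<Longrightarrow> depends_on N B g"
  unfolding depends_on_def by blast

lemma reindex_in_space:
  "\<omega> \<in> space (iid_field N) \<Longrightarrow> (\<lambda>i. \<omega> (f i)) \<in> space (iid_field N)"
  by (auto simp: space_PiM PiE_iff)

lemma reindex_measurable:
  "(\<lambda>\<omega> i. \<omega> (f i)) \<in> measurable (iid_field N) (iid_field N)"
  by (rule measurable_PiM_single') (auto simp: space_PiM PiE_iff)

lemma distr_reindex:
  fixes N :: "'s measure" and f :: "'i \<Rightarrow> 'j"
  assumes "prob_space N" "inj f"
  shows "distr (iid_field N) (iid_field N) (\<lambda>\<omega> i. \<omega> (f i)) = iid_field N"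
  using distr_PiM_reindex[of UNIV "\<lambda>_. N" f UNIV] assms by (simp add: restrict_UNIV)

lemma reindex_integrable:
  fixes N :: "'s measure" and f :: "'i \<Rightarrow> 'j" and g :: "('i \<Rightarrow> 's) \<Rightarrow> real"
  assumes "prob_space N" "inj f" "integrable (iid_field N) g"
  shows "integrable (iid_field N) (\<lambda>\<omega>. g (\<lambda>i. \<omega> (f i)))"
proof -
  have "integrable (distr (iid_field N) (iid_field N) (\<lambda>\<omega> i. \<omega> (f i))) g"
    using assms by (simp add: distr_reindex)
  then show ?thesis
    by (rule integrable_distr[OF reindex_measurable])
qed

lemma reindex_integral:
  fixes N :: "'s measure" and f :: "'i \<Rightarrow> 'j" and g :: "('i \<Rightarrow> 's) \<Rightarrow> real"
  assumes "prob_space N" "inj f" "g \<in> borel_measurable (iid_field N)"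
  shows "(LINT \<omega>|iid_field N. g (\<lambda>i. \<omega> (f i))) = (LINT \<omega>|iid_field N. g \<omega>)"
proof -
  have "(LINT \<omega>|distr (iid_field N) (iid_field N) (\<lambda>\<omega> i. \<omega> (f i)). g \<omega>)
      = (LINT \<omega>|iid_field N. g (\<lambda>i. \<omega> (f i)))"
    by (rule integral_distr[OF reindex_measurable assms(3)])
  then show ?thesis unfolding distr_reindex[OF assms(1,2)] by (rule sym)
qed

lemma indep_coordinates:
  fixes N :: "'s measure"
  assumes "prob_space N"
  shows "prob_space.indep_vars (iid_field N) (\<lambda>_. N) (\<lambda>i \<omega>. \<omega> i) (UNIV :: 'i set)"
proof -
  interpret P: prob_space "iid_field N :: ('i \<Rightarrow> 's) measure"
    by (intro prob_space_PiM assms)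
  have c: "distr (iid_field N) N (\<lambda>\<omega>. \<omega> i) = N" for i :: 'i
    by (rule distr_PiM_component) (use assms in auto)
  have "distr (iid_field N :: ('i \<Rightarrow> 's) measure) (iid_field N) (\<lambda>x. \<lambda>i\<in>UNIV. x i) = iid_field N"
    using distr_reindex[OF assms, of id] by (simp add: restrict_UNIV)
  then show ?thesis
    by (subst P.indep_vars_iff_distr_eq_PiM) (auto simp: c restrict_UNIV)
qed

text \<open>Fixing the coordinates outside \<open>K j\<close> exhibits \<open>g j\<close> as a function of the coordinates in \<open>K j\<close>.\<close>
lemma indep_disjoint_dependence:
  fixes N :: "'s measure" and g :: "'j \<Rightarrow> ('i \<Rightarrow> 's) \<Rightarrow> real"
  assumes N: "prob_space N" and "J \<noteq> {}"
    and disj: "disjoint_family_on K J"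
    and meas: "\<And>j. j \<in> J \<Longrightarrow> g j \<in> borel_measurable (iid_field N)"
    and dep: "\<And>j. j \<in> J \<Longrightarrow> depends_on N (K j) (g j)"
  shows "prob_space.indep_vars (iid_field N) (\<lambda>_. borel) g J"
proof -
  interpret P: prob_space "iid_field N :: ('i \<Rightarrow> 's) measure"
    by (intro prob_space_PiM N)
  obtain e where e: "e \<in> space N"
    using prob_space.not_empty[OF N] by blast
  have 1: "P.indep_vars (\<lambda>j. Pi\<^sub>M (K j) (\<lambda>_. N)) (\<lambda>j \<omega>. restrict (\<lambda>i. \<omega> i) (K j)) J"
    by (rule P.indep_vars_restrict[OF indep_coordinates[OF N] _ disj]) auto
  define ext where "ext j \<eta> = (\<lambda>i. if i \<in> K j then \<eta> i else e)" for j and \<eta> :: "'i \<Rightarrow> 's"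
  have ext: "ext j \<in> measurable (Pi\<^sub>M (K j) (\<lambda>_. N)) (iid_field N)" for j
  proof (rule measurable_PiM_single')
    show "(\<lambda>\<eta>. ext j \<eta> i) \<in> measurable (Pi\<^sub>M (K j) (\<lambda>_. N)) N" for i
      unfolding ext_def using e by (cases "i \<in> K j") auto
    show "ext j \<in> space (Pi\<^sub>M (K j) (\<lambda>_. N)) \<rightarrow> (UNIV \<rightarrow>\<^sub>E space N)"
      using e by (auto simp: ext_def space_PiM PiE_iff)
  qed
  have "P.indep_vars (\<lambda>_. borel) (\<lambda>j. (\<lambda>\<eta>. g j (ext j \<eta>)) \<circ> (\<lambda>\<omega>. restrict (\<lambda>i. \<omega> i) (K j))) J"
    by (rule P.indep_vars_compose[OF 1]) (use ext meas in measurable)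
  moreover have "((\<lambda>\<eta>. g j (ext j \<eta>)) \<circ> (\<lambda>\<omega>. restrict (\<lambda>i. \<omega> i) (K j))) \<omega> = g j \<omega>"
    if "j \<in> J" "\<omega> \<in> space (iid_field N)" for j \<omega>
  proof -
    have "ext j (restrict (\<lambda>i. \<omega> i) (K j)) \<in> space (iid_field N)"
      using e that by (auto simp: ext_def space_PiM PiE_iff)
    then show ?thesis
      unfolding comp_def by (rule depends_onD[OF dep[OF that(1)] _ that(2)]) (simp add: ext_def)
  qed
  then have "{((\<lambda>\<eta>. g j (ext j \<eta>)) \<circ> (\<lambda>\<omega>. restrict (\<lambda>i. \<omega> i) (K j))) -` A \<inter> space (iid_field N) |A. A \<in> sets borel}
      = {g j -` A \<inter> space (iid_field N) |A. A \<in> sets borel}" if "j \<in> J" for j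
    using that by (intro Collect_cong ex_cong1 conj_cong refl arg_cong[where f = "\<lambda>B. _ = B"]) auto
  ultimately show ?thesis
    unfolding P.indep_vars_def2 using meas by (simp cong: P.indep_sets_cong)
qed

lemma (in prob_space) square_integrable_mult:
  fixes f g :: "'a \<Rightarrow> real"
  assumes [measurable]: "f \<in> borel_measurable M" "g \<in> borel_measurable M"
    and "integrable M (\<lambda>x. (f x)\<^sup>2)" "integrable M (\<lambda>x. (g x)\<^sup>2)"
  shows "integrable M (\<lambda>x. f x * g x)"
proof (rule Bochner_Integration.integrable_bound[of _ "\<lambda>x. (f x)\<^sup>2 + (g x)\<^sup>2"])
  have "\<bar>a * b\<bar> \<le> \<bar>a\<^sup>2 + b\<^sup>2\<bar>" for a b :: real
  proof -
    have "2 * \<bar>a\<bar> * \<bar>b\<bar> \<le> \<bar>a\<bar>\<^sup>2 + \<bar>b\<bar>\<^sup>2" by (rule sum_squares_bound)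
    moreover have "0 \<le> \<bar>a\<bar> * \<bar>b\<bar>" by simp
    ultimately show ?thesis unfolding power2_abs abs_mult by linarith
  qed
  then show "AE x in M. norm (f x * g x) \<le> norm ((f x)\<^sup>2 + (g x)\<^sup>2)" by simp
qed (use assms in auto)

lemma (in prob_space) square_integrable_diff:
  fixes f g :: "'a \<Rightarrow> real"
  assumes [measurable]: "f \<in> borel_measurable M" "g \<in> borel_measurable M"
    and "integrable M (\<lambda>x. (f x)\<^sup>2)" "integrable M (\<lambda>x. (g x)\<^sup>2)"
  shows "integrable M (\<lambda>x. (f x - g x)\<^sup>2)"
proof -
  have "(\<lambda>x. (f x - g x)\<^sup>2) = (\<lambda>x. (f x)\<^sup>2 + (g x)\<^sup>2 - 2 * (f x * g x))"
    by (auto simp: power2_diff)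
  then show ?thesis
    using integrable_mult_right[of 2, OF square_integrable_mult[OF assms]] assms(3,4)
    by (simp only: Bochner_Integration.integrable_diff Bochner_Integration.integrable_add)
qed

lemma (in prob_space) square_integrable_sum:
  fixes f :: "'b \<Rightarrow> 'a \<Rightarrow> real"
  assumes "\<And>i. i \<in> I \<Longrightarrow> f i \<in> borel_measurable M" "\<And>i. i \<in> I \<Longrightarrow> integrable M (\<lambda>x. (f i x)\<^sup>2)"
  shows "integrable M (\<lambda>x. (\<Sum>i\<in>I. f i x)\<^sup>2)"
proof -
  have "(\<lambda>x. (\<Sum>i\<in>I. f i x)\<^sup>2) = (\<lambda>x. \<Sum>i\<in>I. \<Sum>j\<in>I. f i x * f j x)"
    by (simp add: power2_eq_square sum_product)
  moreover have "integrable M (\<lambda>x. f i x * f j x)" if "i \<in> I" "j \<in> I" for i j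
    using that assms by (intro square_integrable_mult)
  ultimately show ?thesis by simp
qed

text \<open>The Efron--Stein inequality in a form with explicit approximations: \<open>g c\<close> does not see the coordinate \<open>c\<close>.
  Take two independent copies of the field and write \<open>X A\<close> for \<open>G\<close> evaluated at the field whose coordinates in \<open>A\<close> come
  from the second copy. Then \<open>X {}\<close> and \<open>X W\<close> are independent, so the variance of \<open>G\<close> is the expectation of
  \<open>X {} * (X {} - X W)\<close>. The second factor telescopes along an enumeration of \<open>W\<close>. Exchanging the two copies of the coordinate \<open>c\<close>
  turns each term into half the expectation of \<open>(X {} - X {c}) * (X A - X (A \<union> {c}))\<close>, and both factors are small because
  \<open>G\<close> is close to \<open>g c\<close> before and after the coordinate \<open>c\<close> is resampled.\<close>
theorem efron_stein:
  fixes N :: "'s measure" and G :: "('i \<Rightarrow> 's) \<Rightarrow> real" and g :: "'i \<Rightarrow> ('i \<Rightarrow> 's) \<Rightarrow> real"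
  defines "P \<equiv> iid_field N :: ('i \<Rightarrow> 's) measure"
  assumes N: "prob_space N" and W: "finite W"
    and G: "G \<in> borel_measurable P" "integrable P (\<lambda>\<omega>. (G \<omega>)\<^sup>2)" "depends_on N W G"
    and g: "\<And>c. c \<in> W \<Longrightarrow> g c \<in> borel_measurable P" "\<And>c. c \<in> W \<Longrightarrow> integrable P (\<lambda>\<omega>. (g c \<omega>)\<^sup>2)"
      "\<And>c. c \<in> W \<Longrightarrow> depends_on N (- {c}) (g c)"
  shows "prob_space.variance P G \<le> (\<Sum>c\<in>W. 2 * (LINT \<omega>|P. (G \<omega> - g c \<omega>)\<^sup>2))"
proof -
  interpret P: prob_space P
    unfolding P_def by (intro prob_space_PiM N)
  \<comment> \<open>the second component of an index selects one of two independent copies of the field\<close>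
  define Q where "Q = (iid_field N :: ('i \<times> bool \<Rightarrow> 's) measure)"
  interpret Q: prob_space Q
    unfolding Q_def by (intro prob_space_PiM N)
  define pick where "pick A \<omega> = (\<lambda>c. \<omega> (c, c \<in> A))" for A and \<omega> :: "'i \<times> bool \<Rightarrow> 's"
  define X where "X A \<omega> = G (pick A \<omega>)" for A \<omega>
  have inj: "inj (\<lambda>c. (c, c \<in> A))" for A :: "'i set"
    by (auto intro!: injI)
  have pick_meas [measurable]: "pick A \<in> measurable Q P" for A
    unfolding pick_def Q_def P_def by (rule reindex_measurable)
  have pick_space: "pick A \<omega> \<in> space P" if "\<omega> \<in> space Q" for A \<omega>
    using measurable_space[OF pick_meas that] .
  have pick_integrable: "integrable Q (\<lambda>\<omega>. f (pick A \<omega>))" if "integrable P f" for f :: "_ \<Rightarrow> real" and A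
    unfolding pick_def Q_def by (rule reindex_integrable[OF N inj that[unfolded P_def]])
  have pick_integral: "(LINT \<omega>|Q. f (pick A \<omega>)) = (LINT \<omega>|P. f \<omega>)" if "f \<in> borel_measurable P" for f :: "_ \<Rightarrow> real" and A
    unfolding pick_def Q_def P_def by (rule reindex_integral[OF N inj that[unfolded P_def]])
  note [measurable] = G(1)
  have X_meas [measurable]: "X A \<in> borel_measurable Q" for A
    unfolding X_def by measurable
  have X_sq: "integrable Q (\<lambda>\<omega>. (X A \<omega>)\<^sup>2)" for A
    unfolding X_def by (rule pick_integrable[OF G(2)])
  have X_mult: "integrable Q (\<lambda>\<omega>. X A \<omega> * X B \<omega>)" for A B
    by (intro Q.square_integrable_mult X_meas X_sq)
  have X_diff_sq: "integrable Q (\<lambda>\<omega>. (X A \<omega> - X B \<omega>)\<^sup>2)" for A B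
    by (intro Q.square_integrable_diff X_meas X_sq)
  \<comment> \<open>resampling one more coordinate costs at most the distance to a function ignoring it\<close>
  have step: "(LINT \<omega>|Q. (X A \<omega> - X (insert c A) \<omega>)\<^sup>2) \<le> 4 * (LINT \<omega>|P. (G \<omega> - g c \<omega>)\<^sup>2)"
    if c: "c \<in> W" for A c
  proof -
    note [measurable] = g(1)[OF c]
    have i: "integrable P (\<lambda>\<omega>. (G \<omega> - g c \<omega>)\<^sup>2)"
      by (intro P.square_integrable_diff G g c)
    have eq: "g c (pick A \<omega>) = g c (pick (insert c A) \<omega>)" if "\<omega> \<in> space Q" for \<omega>
      by (rule depends_onD[OF g(3)[OF c] pick_space[OF that, unfolded P_def] pick_space[OF that, unfolded P_def]])
         (auto simp: pick_def)
    have sq: "(a - b)\<^sup>2 \<le> 2 * (a - e)\<^sup>2 + 2 * (b - e)\<^sup>2" for a b e :: real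
    proof -
      have "2 * (a - e)\<^sup>2 + 2 * (b - e)\<^sup>2 - (a - b)\<^sup>2 = (a + b - 2 * e)\<^sup>2"
        by (simp add: power2_eq_square algebra_simps)
      then show ?thesis using zero_le_power2[of "a + b - 2 * e"] by linarith
    qed
    have "(LINT \<omega>|Q. (X A \<omega> - X (insert c A) \<omega>)\<^sup>2) \<le>
      (LINT \<omega>|Q. 2 * (G (pick A \<omega>) - g c (pick A \<omega>))\<^sup>2 + 2 * (G (pick (insert c A) \<omega>) - g c (pick (insert c A) \<omega>))\<^sup>2)"
    proof (rule integral_mono[OF X_diff_sq])
      fix \<omega> assume "\<omega> \<in> space Q"
      then show "(X A \<omega> - X (insert c A) \<omega>)\<^sup>2 \<le> 2 * (G (pick A \<omega>) - g c (pick A \<omega>))\<^sup>2 + 2 * (G (pick (insert c A) \<omega>) - g c (pick (insert c A) \<omega>))\<^sup>2"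
        unfolding X_def using sq[of "G (pick A \<omega>)" "G (pick (insert c A) \<omega>)" "g c (pick A \<omega>)"] by (simp add: eq)
    qed (use pick_integrable[OF i] in auto)
    also have "\<dots> = 2 * (LINT \<omega>|P. (G \<omega> - g c \<omega>)\<^sup>2) + 2 * (LINT \<omega>|P. (G \<omega> - g c \<omega>)\<^sup>2)"
      using pick_integrable[OF i] by (simp add: pick_integral[of "\<lambda>\<omega>. (G \<omega> - g c \<omega>)\<^sup>2"])
    finally show ?thesis by simp
  qed
  have tele: "(LINT \<omega>|Q. X {} \<omega> * (X {} \<omega> - X A \<omega>)) \<le> (\<Sum>c\<in>A. 2 * (LINT \<omega>|P. (G \<omega> - g c \<omega>)\<^sup>2))"
    if "A \<subseteq> W" for A
  proof -
    have "finite A" using that W finite_subset by blast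
    then show ?thesis using that
    proof (induction A)
      case empty
      then show ?case by simp
    next
      case (insert c A)
      \<comment> \<open>exchange of the two copies of the coordinate \<open>c\<close>, which preserves the law\<close>
      define sw where "sw = (\<lambda>(x :: 'i, b). if x = c then (x, \<not> b) else (x, b))"
      have sw: "inj sw" by (auto simp: sw_def inj_on_def split: if_splits)
      have "pick {} (\<lambda>i. \<omega> (sw i)) = pick {c} \<omega>" "pick A (\<lambda>i. \<omega> (sw i)) = pick (insert c A) \<omega>"
           "pick (insert c A) (\<lambda>i. \<omega> (sw i)) = pick A \<omega>" for \<omega> :: "'i \<times> bool \<Rightarrow> 's"
        using insert(2) by (auto simp: pick_def sw_def)
      then have swX: "X {} (\<lambda>i. \<omega> (sw i)) = X {c} \<omega>" "X A (\<lambda>i. \<omega> (sw i)) = X (insert c A) \<omega>"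
           "X (insert c A) (\<lambda>i. \<omega> (sw i)) = X A \<omega>" for \<omega>
        by (simp_all add: X_def)
      have "(LINT \<omega>|Q. X {} \<omega> * (X A \<omega> - X (insert c A) \<omega>)) = (LINT \<omega>|Q. X {c} \<omega> * (X (insert c A) \<omega> - X A \<omega>))"
        using reindex_integral[OF N sw, of "\<lambda>\<omega>. X {} \<omega> * (X A \<omega> - X (insert c A) \<omega>)"]
        unfolding swX Q_def[symmetric] by simp
      then have "2 * (LINT \<omega>|Q. X {} \<omega> * (X A \<omega> - X (insert c A) \<omega>)) =
         (LINT \<omega>|Q. X {} \<omega> * (X A \<omega> - X (insert c A) \<omega>)) + (LINT \<omega>|Q. X {c} \<omega> * (X (insert c A) \<omega> - X A \<omega>))"
        by simp
      also have "\<dots> = (LINT \<omega>|Q. (X {} \<omega> - X {c} \<omega>) * (X A \<omega> - X (insert c A) \<omega>))"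
        by (subst Bochner_Integration.integral_add[symmetric])
           (auto simp: right_diff_distrib left_diff_distrib X_mult intro!: Bochner_Integration.integral_cong)
      also have "\<dots> \<le> (LINT \<omega>|Q. ((X {} \<omega> - X {c} \<omega>)\<^sup>2 + (X A \<omega> - X (insert c A) \<omega>)\<^sup>2) / 2)"
      proof (rule integral_mono)
        fix \<omega>
        have "u * v \<le> (u\<^sup>2 + v\<^sup>2) / 2" for u v :: real
          using sum_squares_bound[of u v] by simp
        then show "(X {} \<omega> - X {c} \<omega>) * (X A \<omega> - X (insert c A) \<omega>) \<le> ((X {} \<omega> - X {c} \<omega>)\<^sup>2 + (X A \<omega> - X (insert c A) \<omega>)\<^sup>2) / 2" .
      qed (auto intro!: Q.square_integrable_mult X_diff_sq)
      also have "\<dots> = ((LINT \<omega>|Q. (X {} \<omega> - X {c} \<omega>)\<^sup>2) + (LINT \<omega>|Q. (X A \<omega> - X (insert c A) \<omega>)\<^sup>2)) / 2"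
        by (simp add: X_diff_sq)
      also have "\<dots> \<le> 4 * (LINT \<omega>|P. (G \<omega> - g c \<omega>)\<^sup>2)"
        using step[of c "{}"] step[of c A] insert.prems by simp
      finally have 1: "(LINT \<omega>|Q. X {} \<omega> * (X A \<omega> - X (insert c A) \<omega>)) \<le> 2 * (LINT \<omega>|P. (G \<omega> - g c \<omega>)\<^sup>2)"
        by simp
      have "(LINT \<omega>|Q. X {} \<omega> * (X {} \<omega> - X (insert c A) \<omega>)) =
         (LINT \<omega>|Q. X {} \<omega> * (X {} \<omega> - X A \<omega>)) + (LINT \<omega>|Q. X {} \<omega> * (X A \<omega> - X (insert c A) \<omega>))"
        by (subst Bochner_Integration.integral_add[symmetric])
           (auto simp: right_diff_distrib X_mult intro!: Bochner_Integration.integral_cong)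
      then show ?case using 1 insert by simp
    qed
  qed
  have intG: "integrable P G" by (rule P.square_integrable_imp_integrable[OF G(1,2)])
  \<comment> \<open>resampling all coordinates has the same effect as resampling \<open>W\<close>, and gives an independent copy\<close>
  have XW: "X W \<omega> = X UNIV \<omega>" if "\<omega> \<in> space Q" for \<omega>
    unfolding X_def by (rule depends_onD[OF G(3) pick_space[OF that, unfolded P_def] pick_space[OF that, unfolded P_def]])
       (auto simp: pick_def)
  define Y where "Y b \<omega> = G (\<lambda>c. \<omega> (c, b))" for b :: bool and \<omega> :: "'i \<times> bool \<Rightarrow> 's"
  have "Q.indep_vars (\<lambda>_. borel) Y UNIV"
    unfolding Q_def
  proof (rule indep_disjoint_dependence[OF N, where K = "\<lambda>b. UNIV \<times> {b}"])
    show "disjoint_family_on (\<lambda>b. (UNIV :: 'i set) \<times> {b}) UNIV"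
      by (auto simp: disjoint_family_on_def)
    show "Y b \<in> borel_measurable (iid_field N)" for b
      unfolding Y_def using measurable_compose[OF reindex_measurable G(1)[unfolded P_def]] .
    show "depends_on N (UNIV \<times> {b}) (Y b)" for b
      unfolding depends_on_def Y_def by (auto intro!: arg_cong[of _ _ G])
  qed auto
  moreover have YX: "Y True = X UNIV" "Y False = X {}"
    by (auto simp: Y_def X_def pick_def)
  moreover have "integrable Q (Y b)" for b
    using pick_integrable[OF intG] by (cases b) (simp_all add: YX X_def[abs_def])
  ultimately have "(LINT \<omega>|Q. (\<Prod>b\<in>UNIV. Y b \<omega>)) = (\<Prod>b\<in>UNIV. LINT \<omega>|Q. Y b \<omega>)"
    by (intro Q.indep_vars_lebesgue_integral) auto
  then have "(LINT \<omega>|Q. X {} \<omega> * X UNIV \<omega>) = (LINT \<omega>|Q. X {} \<omega>) * (LINT \<omega>|Q. X UNIV \<omega>)"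
    by (simp add: UNIV_bool YX)
  then have prod: "(LINT \<omega>|Q. X {} \<omega> * X UNIV \<omega>) = (LINT \<omega>|P. G \<omega>)\<^sup>2"
    unfolding X_def by (simp add: pick_integral power2_eq_square)
  have "P.variance G = (LINT \<omega>|P. (G \<omega>)\<^sup>2) - (LINT \<omega>|P. G \<omega>)\<^sup>2"
    by (rule P.variance_eq[OF intG G(2)])
  also have "(LINT \<omega>|P. (G \<omega>)\<^sup>2) = (LINT \<omega>|Q. X {} \<omega> * X {} \<omega>)"
    unfolding X_def by (subst pick_integral[symmetric, of _ "{}"]) (simp_all add: power2_eq_square)
  also have "\<dots> - (LINT \<omega>|P. G \<omega>)\<^sup>2 = (LINT \<omega>|Q. X {} \<omega> * (X {} \<omega> - X UNIV \<omega>))"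
    unfolding prod[symmetric] by (simp add: right_diff_distrib X_mult)
  also have "\<dots> = (LINT \<omega>|Q. X {} \<omega> * (X {} \<omega> - X W \<omega>))"
    by (rule Bochner_Integration.integral_cong) (simp_all add: XW)
  also have "\<dots> \<le> (\<Sum>c\<in>W. 2 * (LINT \<omega>|P. (G \<omega> - g c \<omega>)\<^sup>2))"
    by (rule tele) simp
  finally show ?thesis .
qed

section \<open>Characteristic functions of normalized sums\<close>

text \<open>The characteristic function has a second order expansion at \<open>0\<close> whose remainder is at most \<open>(t a)\<^sup>2 / 6\<close> times the mean of \<open>min (6 x\<^sup>2) (\<bar>t a\<bar> \<bar>x\<bar>\<^sup>3)\<close>. The minimum makes dominated convergence work with a second moment alone.\<close>
lemma char_power_limit:
  fixes \<mu> :: "real measure" and a :: "nat \<Rightarrow> real" and K :: "nat \<Rightarrow> nat"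
  assumes "real_distribution \<mu>" and sq: "integrable \<mu> (\<lambda>x. x\<^sup>2)" and mean: "(LINT x|\<mu>. x) = 0"
    and K: "(\<lambda>n. real (K n) * (a n)\<^sup>2) \<longlonglongrightarrow> A" and a: "a \<longlonglongrightarrow> 0"
  shows "(\<lambda>n. char \<mu> (t * a n) ^ K n) \<longlonglongrightarrow> complex_of_real (exp (- (t\<^sup>2 * A * (LINT x|\<mu>. x\<^sup>2) / 2)))"
proof -
  interpret \<mu>: real_distribution \<mu> by fact
  define v where "v = (LINT x|\<mu>. x\<^sup>2)"
  have v0: "0 \<le> v" unfolding v_def by simp
  have int1: "integrable \<mu> (\<lambda>x. x)"
    by (rule \<mu>.square_integrable_imp_integrable[OF _ sq]) simp
  define y where "y n = (t * a n)\<^sup>2 * v / 2" for n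
  define e where "e n = (LINT x|\<mu>. min (6 * x\<^sup>2) (\<bar>t * a n\<bar> * \<bar>x\<bar> ^ 3))" for n
  have y0: "0 \<le> y n" for n unfolding y_def using v0 by simp
  have "(\<lambda>n. \<bar>t * a n\<bar>) \<longlonglongrightarrow> 0"
    using tendsto_mult_right_zero[OF a, of t] by (rule tendsto_rabs_zero)
  then have "(\<lambda>n. min (6 * x\<^sup>2) (\<bar>t * a n\<bar> * \<bar>x\<bar> ^ 3)) \<longlonglongrightarrow> min (6 * x\<^sup>2) (0 * \<bar>x\<bar> ^ 3)" for x :: real
    by (intro tendsto_intros)
  then have lim: "(\<lambda>n. min (6 * x\<^sup>2) (\<bar>t * a n\<bar> * \<bar>x\<bar> ^ 3)) \<longlonglongrightarrow> 0" for x :: real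
    by (simp add: min_absorb2)
  have "(\<lambda>n. LINT x|\<mu>. min (6 * x\<^sup>2) (\<bar>t * a n\<bar> * \<bar>x\<bar> ^ 3)) \<longlonglongrightarrow> (LINT x|\<mu>. 0)"
    by (rule integral_dominated_convergence[where w = "\<lambda>x. 6 * x\<^sup>2"]) (use sq lim in auto)
  then have e: "e \<longlonglongrightarrow> 0" unfolding e_def by simp
  have y: "y \<longlonglongrightarrow> 0" unfolding y_def using a by (auto intro!: tendsto_eq_intros)
  have Ky: "(\<lambda>n. real (K n) * y n) \<longlonglongrightarrow> t\<^sup>2 * A * v / 2"
  proof -
    have "(\<lambda>n. t\<^sup>2 * (real (K n) * (a n)\<^sup>2) * v / 2) \<longlonglongrightarrow> t\<^sup>2 * A * v / 2"
      by (intro tendsto_intros K) auto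
    then show ?thesis unfolding y_def by (simp add: power_mult_distrib mult_ac)
  qed
  have expbd: "\<bar>exp (- u) - (1 - u)\<bar> \<le> u\<^sup>2" if "0 \<le> u" for u :: real
  proof -
    have "1 - u \<le> exp (- u)" using exp_ge_add_one_self[of "- u"] by simp
    moreover have "exp (- u) \<le> 1 / (1 + u)"
      using exp_ge_add_one_self[of u] that by (simp add: exp_minus inverse_eq_divide frac_le)
    moreover have "1 / (1 + u) \<le> 1 - u + u\<^sup>2"
    proof -
      have "(1 - u + u\<^sup>2) * (1 + u) = 1 + u ^ 3" by (simp add: power2_eq_square power3_eq_cube algebra_simps)
      then show ?thesis using that by (simp add: divide_le_eq)
    qed
    ultimately show ?thesis by linarith
  qed
  have bound: "cmod (char \<mu> (t * a n) ^ K n - complex_of_real (exp (- (real (K n) * y n)))) \<le>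
      real (K n) * (a n)\<^sup>2 * (t\<^sup>2 / 6 * e n) + real (K n) * y n * y n" for n
  proof -
    have e1: "complex_of_real (exp (- (real (K n) * y n))) = complex_of_real (exp (- y n)) ^ K n"
      by (simp add: exp_of_nat_mult[symmetric] flip: of_real_power)
    have "cmod (char \<mu> (t * a n) - (1 - (t * a n)\<^sup>2 * v / 2)) \<le> (t * a n)\<^sup>2 / 6 * e n"
      unfolding e_def by (rule \<mu>.char_approx3) (use int1 mean sq in \<open>simp_all add: v_def\<close>)
    then have 1: "cmod (char \<mu> (t * a n) - complex_of_real (1 - y n)) \<le> (t * a n)\<^sup>2 / 6 * e n"
      by (simp add: y_def)
    have "cmod (complex_of_real (1 - y n) - complex_of_real (exp (- y n))) = \<bar>exp (- y n) - (1 - y n)\<bar>"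
      unfolding of_real_diff[symmetric] norm_of_real by linarith
    also have "\<dots> \<le> (y n)\<^sup>2" using expbd[OF y0] .
    finally have 2: "cmod (complex_of_real (1 - y n) - complex_of_real (exp (- y n))) \<le> (y n)\<^sup>2" .
    have "cmod (char \<mu> (t * a n) ^ K n - complex_of_real (exp (- y n)) ^ K n) \<le>
       real (K n) * cmod (char \<mu> (t * a n) - complex_of_real (exp (- y n)))"
      by (rule norm_power_diff) (use \<mu>.cmod_char_le_1 y0 in auto)
    also have "\<dots> \<le> real (K n) * ((t * a n)\<^sup>2 / 6 * e n + (y n)\<^sup>2)"
      by (intro mult_left_mono) (use norm_triangle_le[OF add_mono[OF 1 2]] in auto)
    finally show ?thesis unfolding e1 by (simp add: algebra_simps power2_eq_square)
  qed
  have "(\<lambda>n. real (K n) * (a n)\<^sup>2 * (t\<^sup>2 / 6 * e n) + real (K n) * y n * y n) \<longlonglongrightarrow> A * (t\<^sup>2 / 6 * 0) + t\<^sup>2 * A * v / 2 * 0"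
    by (intro tendsto_intros K Ky e y)
  then have "(\<lambda>n. char \<mu> (t * a n) ^ K n - complex_of_real (exp (- (real (K n) * y n)))) \<longlonglongrightarrow> 0"
    by (intro Lim_null_comparison[OF eventuallyI[OF bound]]) simp
  moreover have "(\<lambda>n. complex_of_real (exp (- (real (K n) * y n)))) \<longlonglongrightarrow> complex_of_real (exp (- (t\<^sup>2 * A * v / 2)))"
    by (intro tendsto_intros Ky)
  ultimately show ?thesis unfolding v_def
    by (rule Lim_transform[rotated])
qed

text \<open>The map \<open>x \<mapsto> exp (i t x)\<close> is \<open>\<bar>t\<bar>\<close>-Lipschitz; then apply the Cauchy--Schwarz inequality.\<close>
lemma (in prob_space) char_distr_diff:
  fixes X Y :: "'a \<Rightarrow> real"
  assumes X[measurable]: "X \<in> borel_measurable M" and Y[measurable]: "Y \<in> borel_measurable M"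
    and sq: "integrable M (\<lambda>x. (X x)\<^sup>2)" "integrable M (\<lambda>x. (Y x)\<^sup>2)"
  shows "cmod (char (distr M borel X) t - char (distr M borel Y) t) \<le> \<bar>t\<bar> * sqrt (expectation (\<lambda>x. (X x - Y x)\<^sup>2))"
proof -
  have i: "integrable M (\<lambda>x. (X x - Y x)\<^sup>2)" by (rule square_integrable_diff[OF X Y sq])
  have i1: "integrable M (\<lambda>x. \<bar>X x - Y x\<bar>)"
    using square_integrable_imp_integrable[OF _ i] by simp
  have ie: "integrable M (\<lambda>x. iexp (t * f x))" if "f \<in> borel_measurable M" for f :: "'a \<Rightarrow> real"
    by (rule integrable_const_bound[where B = 1]) (use that in auto)
  have ch: "char (distr M borel f) t = (CLINT x|M. iexp (t * f x))" if "f \<in> borel_measurable M" for f :: "'a \<Rightarrow> real"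
    unfolding char_def by (rule integral_distr[OF that]) measurable
  have "char (distr M borel X) t - char (distr M borel Y) t = (CLINT x|M. iexp (t * X x) - iexp (t * Y x))"
    unfolding ch[OF X] ch[OF Y] by (rule Bochner_Integration.integral_diff[symmetric, OF ie[OF X] ie[OF Y]])
  also have "cmod \<dots> \<le> (LINT x|M. \<bar>t\<bar> * \<bar>X x - Y x\<bar>)"
  proof (rule order_trans[OF integral_norm_bound], rule integral_mono)
    show "integrable M (\<lambda>x. cmod (iexp (t * X x) - iexp (t * Y x)))"
      by (intro integrable_norm Bochner_Integration.integrable_diff ie) auto
    fix x
    have "iexp (t * X x) - iexp (t * Y x) = iexp (t * Y x) * (iexp (t * (X x - Y x)) - 1)"
      by (simp add: algebra_simps exp_add[symmetric])
    also have "cmod \<dots> = cmod (iexp (t * (X x - Y x)) - 1)"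
      by (simp add: norm_mult)
    also have "\<dots> \<le> \<bar>t\<bar> * \<bar>X x - Y x\<bar>"
      using iexp_approx1[of "t * (X x - Y x)" 0] by (simp add: abs_mult)
    finally show "cmod (iexp (t * X x) - iexp (t * Y x)) \<le> \<bar>t\<bar> * \<bar>X x - Y x\<bar>" .
  qed (use i1 in auto)
  also have "\<dots> = \<bar>t\<bar> * expectation (\<lambda>x. \<bar>X x - Y x\<bar>)" by simp
  also have "expectation (\<lambda>x. \<bar>X x - Y x\<bar>) \<le> sqrt (expectation (\<lambda>x. (X x - Y x)\<^sup>2))"
  proof (rule real_le_rsqrt)
    have "0 \<le> variance (\<lambda>x. \<bar>X x - Y x\<bar>)" by (rule variance_positive)
    also have "\<dots> = expectation (\<lambda>x. \<bar>X x - Y x\<bar>\<^sup>2) - (expectation (\<lambda>x. \<bar>X x - Y x\<bar>))\<^sup>2"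
      by (rule variance_eq[OF i1]) (use i in simp)
    finally show "(expectation (\<lambda>x. \<bar>X x - Y x\<bar>))\<^sup>2 \<le> expectation (\<lambda>x. (X x - Y x)\<^sup>2)" by simp
  qed
  finally show ?thesis by (simp add: mult_left_mono)
qed

text \<open>The sites of the unit cells that tile \<open>[0, n)\<^sup>d\<close>.\<close>
definition lattice_cube :: "nat \<Rightarrow> (int ^ 'd) set" where
  "lattice_cube n = {z. \<forall>i. 0 \<le> z $ i \<and> z $ i < int n}"

definition lattice_ball :: "nat \<Rightarrow> (int ^ 'd) set" where
  "lattice_ball R = {z. \<forall>i. \<bar>z $ i\<bar> \<le> int R}"

definition block :: "nat \<Rightarrow> int ^ 'd \<Rightarrow> (int ^ 'd) set" where
  "block L w = (\<lambda>z. z + (\<chi> i. int L * w $ i)) ` lattice_cube L"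

lemma finite_vec_box: "finite {z :: int ^ 'd::finite. \<forall>i. z $ i \<in> {a..<b}}"
proof (rule finite_subset)
  show "{z :: int ^ 'd. \<forall>i. z $ i \<in> {a..<b}} \<subseteq> vec_lambda ` (Pi\<^sub>E UNIV (\<lambda>_. {a..<b}))"
    by (rule subsetI, rule_tac x = "\<lambda>i. x $ i" in image_eqI) (auto simp: PiE_def)
qed (auto intro!: finite_PiE)

lemma card_lattice_cube:
  "finite (lattice_cube n :: (int ^ 'd::finite) set)" "card (lattice_cube n :: (int ^ 'd::finite) set) = n ^ CARD('d)"
proof -
  have eq: "(lattice_cube n :: (int ^ 'd) set) = vec_lambda ` (Pi\<^sub>E UNIV (\<lambda>_. {0..<int n}))"
  proof (intro equalityI subsetI)
    fix z :: "int ^ 'd" assume "z \<in> lattice_cube n"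
    then show "z \<in> vec_lambda ` (Pi\<^sub>E UNIV (\<lambda>_. {0..<int n}))"
      by (intro image_eqI[of _ _ "\<lambda>i. z $ i"]) (auto simp: lattice_cube_def PiE_def)
  qed (auto simp: lattice_cube_def)
  have "inj_on vec_lambda (Pi\<^sub>E (UNIV :: 'd set) (\<lambda>_. {0..<int n}))"
    by (auto intro!: inj_onI simp: vec_lambda_inject)
  then have "card (lattice_cube n :: (int ^ 'd) set) = card (Pi\<^sub>E (UNIV :: 'd set) (\<lambda>_. {0..<int n}))"
    unfolding eq by (rule card_image)
  then show "card (lattice_cube n :: (int ^ 'd) set) = n ^ CARD('d)" by (simp add: card_PiE)
  show "finite (lattice_cube n :: (int ^ 'd::finite) set)"
    unfolding eq by (auto intro!: finite_PiE)
qed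

lemma finite_lattice_ball: "finite (lattice_ball R :: (int ^ 'd::finite) set)"
proof (rule finite_subset[OF _ finite_vec_box[of "- int R" "int R + 1"]], rule subsetI)
  fix z :: "int ^ 'd" assume "z \<in> lattice_ball R"
  then have "\<bar>z $ i\<bar> \<le> int R" for i by (simp add: lattice_ball_def)
  then show "z \<in> {z. \<forall>i. z $ i \<in> {- int R..<int R + 1}}" by (auto simp: abs_le_iff minus_le_iff intro: order.strict_trans1)
qed

lemma finite_block: "finite (block L w :: (int ^ 'd::finite) set)"
  by (simp add: block_def card_lattice_cube)

lemma in_block_iff: "z \<in> block L w \<longleftrightarrow> (\<forall>i. int L * w $ i \<le> z $ i \<and> z $ i < int L * w $ i + int L)"
proof
  assume "\<forall>i. int L * w $ i \<le> z $ i \<and> z $ i < int L * w $ i + int L"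
  then show "z \<in> block L w"
    unfolding block_def
    by (intro image_eqI[of _ _ "z - (\<chi> i. int L * w $ i)"]) (auto simp: lattice_cube_def Finite_Cartesian_Product.vec_eq_iff algebra_simps)
qed (auto simp: block_def lattice_cube_def algebra_simps)

lemma block_unique:
  assumes "z \<in> block L w" "z \<in> block L w'"
  shows "w = w'"
proof -
  have "w $ i = w' $ i" for i
  proof -
    have *: "int L * w $ i \<le> z $ i" "z $ i < int L * w $ i + int L"
        "int L * w' $ i \<le> z $ i" "z $ i < int L * w' $ i + int L"
      using assms unfolding in_block_iff by blast+
    then have L: "0 < int L" by linarith
    have "int L * w $ i < int L * (w' $ i + 1)" "int L * w' $ i < int L * (w $ i + 1)"
      using * unfolding distrib_left mult_1_right by linarith+
    then have "w $ i < w' $ i + 1" "w' $ i < w $ i + 1"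
      unfolding mult_less_cancel_left_pos[OF L] .
    then show ?thesis by linarith
  qed
  then show ?thesis by (simp add: Finite_Cartesian_Product.vec_eq_iff)
qed

lemma block_subset_cube:
  assumes "w \<in> lattice_cube (n div L)"
  shows "block L w \<subseteq> lattice_cube n"
proof
  fix z assume z: "z \<in> block L w"
  have "0 \<le> z $ i \<and> z $ i < int n" for i
  proof -
    have w: "0 \<le> w $ i" "w $ i + 1 \<le> int (n div L)" using assms by (auto simp: lattice_cube_def dest: spec[of _ i])
    have "int L * (w $ i + 1) \<le> int L * int (n div L)" using w(2) by (intro mult_left_mono) auto
    also have "\<dots> \<le> int n" by (metis of_nat_le_iff of_nat_mult times_div_less_eq_dividend)
    finally have "int L * (w $ i + 1) \<le> int n" .
    moreover have "0 \<le> int L * w $ i" using w(1) by simp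
    moreover have "int L * w $ i \<le> z $ i" "z $ i < int L * w $ i + int L" using z by (auto simp: in_block_iff)
    ultimately show ?thesis by (auto simp: distrib_left)
  qed
  then show "z \<in> lattice_cube n" by (simp add: lattice_cube_def)
qed

text \<open>Each of the \<open>m\<^sup>d\<close> blocks of side \<open>L\<close> contains a cube of side \<open>L - 2 R\<close> of sites at distance more than \<open>R\<close> from its complement.\<close>
lemma card_interior:
  fixes c :: "int ^ 'd::finite"
  defines "good \<equiv> \<lambda>R L m. {c :: int ^ 'd. \<exists>w\<in>lattice_cube m. (\<lambda>z. z + c) ` lattice_ball R \<subseteq> block L w}"
  assumes R: "2 * R \<le> L"
  shows "(m * (L - 2 * R)) ^ CARD('d) \<le> card (good R L m \<inter> (\<Union>w\<in>lattice_cube m. block L w))"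
proof -
  let ?A = "(lattice_cube m :: (int ^ 'd) set) \<times> (lattice_cube (L - 2 * R) :: (int ^ 'd) set)"
  define f where "f = (\<lambda>(w :: int ^ 'd, u :: int ^ 'd). (\<chi> i. int L * w $ i + int R + u $ i) :: int ^ 'd)"
  have ball: "(\<lambda>z. z + f (w, u)) ` lattice_ball R \<subseteq> block L w" if "u \<in> lattice_cube (L - 2 * R)" for w u
  proof (clarsimp simp: in_block_iff f_def lattice_ball_def)
    fix z :: "int ^ 'd" and i assume "\<forall>i. \<bar>z $ i\<bar> \<le> int R"
    moreover have "0 \<le> u $ i" "u $ i < int L - 2 * int R" using that R by (auto simp: lattice_cube_def)
    ultimately show "0 \<le> z $ i + (int R + u $ i) \<and> z $ i + (int R + u $ i) < int L" by (smt (verit) )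
  qed
  have fb: "f (w, u) \<in> block L w" if "u \<in> lattice_cube (L - 2 * R)" for w u
  proof -
    have "(0 :: int ^ 'd) \<in> lattice_ball R" by (simp add: lattice_ball_def)
    then have "0 + f (w, u) \<in> (\<lambda>z. z + f (w, u)) ` lattice_ball R" by (rule imageI)
    then show ?thesis using ball[OF that] by auto
  qed
  have "inj_on f ?A"
  proof (rule inj_onI, clarify)
    fix w u w' u' assume *: "u \<in> lattice_cube (L - 2 * R)" "u' \<in> lattice_cube (L - 2 * R)" "f (w, u) = f (w', u')"
    have w: "w = w'" by (rule block_unique[OF fb[OF *(1), of w] fb[OF *(2), of w', folded *(3)]])
    have "f (w, u) $ i = f (w', u') $ i" for i by (simp only: *(3))
    then have "u $ i = u' $ i" for i unfolding w f_def by simp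
    then show "w = w' \<and> u = u'" using w by (simp add: Finite_Cartesian_Product.vec_eq_iff)
  qed
  then have "card (f ` ?A) = card ?A" by (rule card_image)
  also have "\<dots> = (m * (L - 2 * R)) ^ CARD('d)"
    by (simp add: card_cartesian_product card_lattice_cube power_mult_distrib)
  finally have "card (f ` ?A) = (m * (L - 2 * R)) ^ CARD('d)" .
  moreover have "f ` ?A \<subseteq> good R L m \<inter> (\<Union>w\<in>lattice_cube m. block L w)"
  proof (rule image_subsetI)
    fix p assume "p \<in> ?A"
    then obtain w u where p: "p = (w, u)" "w \<in> lattice_cube m" "u \<in> lattice_cube (L - 2 * R)" by blast
    show "f p \<in> good R L m \<inter> (\<Union>w\<in>lattice_cube m. block L w)"
      unfolding good_def p(1) using ball[OF p(3), of w] fb[OF p(3), of w] p(2) by blast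
  qed
  moreover have "finite (good R L m \<inter> (\<Union>w\<in>lattice_cube m. block L w))"
    by (rule finite_subset[OF Int_lower2], rule finite_UN_I[OF card_lattice_cube(1)], rule finite_block)
  ultimately show ?thesis
    using card_mono by metis
qed

section \<open>Stabilizing functionals of an independent lattice field\<close>

text \<open>A functional \<open>F\<close> of finite windows of a field with independent identically distributed values of law \<open>N\<close>. The field \<open>H\<close>, seen from a site, bounds
  the effect of removing this site from any window, and \<open>F_stabilizes\<close> says that the effect no longer depends on the window once it is large. Both are stated
  for all configurations rather than almost all, which spares null sets when windows are shifted.\<close>
locale stabilizing_field =
  fixes N :: "'s measure" and F :: "(int ^ 'd::finite) set \<Rightarrow> (int ^ 'd \<Rightarrow> 's) \<Rightarrow> real"
    and H :: "(int ^ 'd \<Rightarrow> 's) \<Rightarrow> real"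
  assumes N: "prob_space N"
    and F_measurable: "\<And>W. finite W \<Longrightarrow> F W \<in> borel_measurable (iid_field N)"
    and F_local: "\<And>W. finite W \<Longrightarrow> depends_on N W (F W)"
    and F_translate: "\<And>W v \<omega>. finite W \<Longrightarrow> \<omega> \<in> space (iid_field N) \<Longrightarrow>
        F ((\<lambda>z. z + v) ` W) \<omega> = F W (\<lambda>z. \<omega> (z + v))"
    and H_measurable: "H \<in> borel_measurable (iid_field N)"
    and H_square_integrable: "integrable (iid_field N) (\<lambda>\<omega>. (H \<omega>)\<^sup>2)"
    and F_increment: "\<And>W c \<omega>. finite W \<Longrightarrow> c \<in> W \<Longrightarrow> \<omega> \<in> space (iid_field N) \<Longrightarrow>
        \<bar>F W \<omega> - F (W - {c}) \<omega>\<bar> \<le> H (\<lambda>z. \<omega> (z + c))"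
    and F_stabilizes: "\<And>\<omega>. \<omega> \<in> space (iid_field N) \<Longrightarrow> \<exists>R. \<forall>W W'. finite W \<longrightarrow> finite W' \<longrightarrow>
        lattice_ball R \<subseteq> W \<longrightarrow> lattice_ball R \<subseteq> W' \<longrightarrow>
        F W \<omega> - F (W - {0}) \<omega> = F W' \<omega> - F (W' - {0}) \<omega>"
begin

abbreviation "\<P> \<equiv> (iid_field N :: (int ^ 'd \<Rightarrow> 's) measure)"

definition increment :: "(int ^ 'd) set \<Rightarrow> int ^ 'd \<Rightarrow> (int ^ 'd \<Rightarrow> 's) \<Rightarrow> real" where
  "increment W c \<omega> = F W \<omega> - F (W - {c}) \<omega>"

definition unstable :: "nat \<Rightarrow> (int ^ 'd \<Rightarrow> 's) set" where
  "unstable R = {\<omega>\<in>space \<P>. \<exists>W W'. finite W \<and> finite W' \<and> lattice_ball R \<subseteq> W \<and> lattice_ball R \<subseteq> W'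
     \<and> increment W 0 \<omega> \<noteq> increment W' 0 \<omega>}"

text \<open>The increments at a site seen from two windows differ by at most \<open>2 H\<close>, and they differ only on the unstable event: this is the price of a site whose surroundings up to distance \<open>R\<close> lie in both windows.\<close>
definition instability :: "nat \<Rightarrow> real" where
  "instability R = (LINT \<omega>|\<P>. 4 * (H \<omega>)\<^sup>2 * indicator (unstable R) \<omega>)"

text \<open>The price of a site without any information on its surroundings.\<close>
definition cost :: real where
  "cost = (LINT \<omega>|\<P>. 4 * (H \<omega>)\<^sup>2)"

lemma prob_space_P: "prob_space \<P>"
  by (intro prob_space_PiM N)

lemma increment_outside: "c \<notin> W \<Longrightarrow> increment W c \<omega> = 0"
  by (simp add: increment_def)

lemma H_nonneg: "\<omega> \<in> space \<P> \<Longrightarrow> 0 \<le> H \<omega>"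
  using F_increment[of "{0}" 0 \<omega>] by (simp add: order_trans[OF abs_ge_zero])

lemma abs_increment_le: "finite W \<Longrightarrow> \<omega> \<in> space \<P> \<Longrightarrow> \<bar>increment W c \<omega>\<bar> \<le> H (\<lambda>z. \<omega> (z + c))"
  using F_increment[of W c \<omega>] H_nonneg[OF reindex_in_space[of \<omega> N "\<lambda>z. z + c"]]
  by (cases "c \<in> W") (simp_all add: increment_outside, simp add: increment_def)

lemma increment_measurable: "finite W \<Longrightarrow> increment W c \<in> borel_measurable \<P>"
  unfolding increment_def[abs_def] by (intro borel_measurable_diff F_measurable) auto

lemma inj_translate: "inj (\<lambda>z :: int ^ 'd. z + c)"
  by (auto intro: injI)

lemma increment_translate:
  assumes "finite W" "\<omega> \<in> space \<P>"
  shows "increment W c \<omega> = increment ((\<lambda>z. z - c) ` W) 0 (\<lambda>z. \<omega> (z + c))"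
proof -
  have "(\<lambda>z. z + c) ` ((\<lambda>z. z - c) ` W) = W" "(\<lambda>z. z + c) ` ((\<lambda>z. z - c) ` W - {0}) = W - {c}"
    by (simp_all add: image_image image_set_diff[OF inj_translate])
  then show ?thesis
    unfolding increment_def using F_translate[of "(\<lambda>z. z - c) ` W" \<omega> c] F_translate[of "(\<lambda>z. z - c) ` W - {0}" \<omega> c] assms
    by simp
qed

lemma H_shift:
  "(\<lambda>\<omega>. H (\<lambda>z. \<omega> (z + c))) \<in> borel_measurable \<P>"
  "integrable \<P> (\<lambda>\<omega>. (H (\<lambda>z. \<omega> (z + c)))\<^sup>2)"
  by (rule measurable_compose[OF reindex_measurable H_measurable])
     (rule reindex_integrable[OF N inj_translate H_square_integrable])

lemma increment_square_integrable:
  assumes "finite W"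
  shows "integrable \<P> (\<lambda>\<omega>. (increment W c \<omega>)\<^sup>2)"
proof (rule Bochner_Integration.integrable_bound[OF H_shift(2)[of c]])
  show "(\<lambda>\<omega>. (increment W c \<omega>)\<^sup>2) \<in> borel_measurable \<P>"
    by (intro borel_measurable_power increment_measurable assms)
  show "AE \<omega> in \<P>. norm ((increment W c \<omega>)\<^sup>2) \<le> norm ((H (\<lambda>z. \<omega> (z + c)))\<^sup>2)"
  proof (rule AE_I2)
    fix \<omega> assume "\<omega> \<in> space \<P>"
    from power_mono[OF abs_increment_le[OF assms this, of c] abs_ge_zero, of 2]
    show "norm ((increment W c \<omega>)\<^sup>2) \<le> norm ((H (\<lambda>z. \<omega> (z + c)))\<^sup>2)" by simp
  qed
qed

text \<open>Remove the sites one by one; what remains is \<open>F {}\<close>, a constant.\<close>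
lemma F_square_integrable:
  assumes "finite W"
  shows "integrable \<P> (\<lambda>\<omega>. (F W \<omega>)\<^sup>2)"
  using assms
proof (induction W)
  case empty
  interpret P: prob_space \<P> by (rule prob_space_P)
  obtain \<omega>0 where "\<omega>0 \<in> space \<P>" using P.not_empty by blast
  then have "F {} \<omega> = F {} \<omega>0" if "\<omega> \<in> space \<P>" for \<omega>
    by (intro depends_onD[OF F_local[of "{}"]]) (use that in auto)
  then have "integrable \<P> (\<lambda>\<omega>. (F {} \<omega>)\<^sup>2) \<longleftrightarrow> integrable \<P> (\<lambda>\<omega>. (F {} \<omega>0)\<^sup>2)"
    by (intro Bochner_Integration.integrable_cong) auto
  then show ?case by simp
next
  case (insert c W)
  interpret P: prob_space \<P> by (rule prob_space_P)
  have "integrable \<P> (\<lambda>\<omega>. (increment (insert c W) c \<omega> - (- F W \<omega>))\<^sup>2)"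
    by (rule P.square_integrable_diff)
       (use insert increment_measurable increment_square_integrable F_measurable in auto)
  then show ?case using insert by (simp add: increment_def)
qed

text \<open>There are only countably many pairs of finite windows.\<close>
lemma unstable_measurable: "unstable R \<in> sets \<P>"
proof -
  define \<A> where "\<A> = {W :: (int ^ 'd) set. finite W \<and> lattice_ball R \<subseteq> W}"
  have "countable \<A>"
    unfolding \<A>_def by (rule countable_subset[OF _ countable_Collect_finite]) auto
  moreover have "unstable R = (\<Union>W\<in>\<A>. \<Union>W'\<in>\<A>. {\<omega>\<in>space \<P>. increment W 0 \<omega> \<noteq> increment W' 0 \<omega>})"
    unfolding unstable_def \<A>_def by blast
  moreover have "{\<omega>\<in>space \<P>. increment W 0 \<omega> \<noteq> increment W' 0 \<omega>} \<in> sets \<P>" if "W \<in> \<A>" "W' \<in> \<A>" for W W'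
  proof -
    have [measurable]: "increment W 0 \<in> borel_measurable \<P>" "increment W' 0 \<in> borel_measurable \<P>"
      using that by (auto simp: \<A>_def intro: increment_measurable)
    show ?thesis by (rule borel_measurable_neq) measurable
  qed
  ultimately show ?thesis by (auto intro!: sets.countable_UN')
qed

lemma instability_integrable: "integrable \<P> (\<lambda>\<omega>. 4 * (H \<omega>)\<^sup>2 * indicator (unstable R) \<omega>)"
  using H_square_integrable unstable_measurable by (intro integrable_real_mult_indicator) auto

lemma instability_nonneg: "0 \<le> instability R"
  unfolding instability_def by simp

lemma cost_nonneg: "0 \<le> cost"
  unfolding cost_def by simp

text \<open>Stabilization makes the unstable events decrease to the empty set; \<open>H\<^sup>2\<close> dominates.\<close>
lemma instability_tendsto_0: "instability \<longlonglongrightarrow> 0"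
proof -
  have "(\<lambda>R. LINT \<omega>|\<P>. 4 * (H \<omega>)\<^sup>2 * indicator (unstable R) \<omega>) \<longlonglongrightarrow> (LINT \<omega>|\<P>. 0)"
  proof (rule integral_dominated_convergence[where w = "\<lambda>\<omega>. 4 * (H \<omega>)\<^sup>2"])
    show "AE \<omega> in \<P>. (\<lambda>R. 4 * (H \<omega>)\<^sup>2 * indicator (unstable R) \<omega>) \<longlonglongrightarrow> 0"
    proof (rule AE_I2)
      fix \<omega> assume \<omega>: "\<omega> \<in> space \<P>"
      obtain R where R: "\<And>W W'. finite W \<Longrightarrow> finite W' \<Longrightarrow> lattice_ball R \<subseteq> W \<Longrightarrow> lattice_ball R \<subseteq> W' \<Longrightarrow>
          increment W 0 \<omega> = increment W' 0 \<omega>"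
        using F_stabilizes[OF \<omega>] unfolding increment_def by blast
      have "4 * (H \<omega>)\<^sup>2 * indicator (unstable R') \<omega> = 0" if "R' \<ge> R" for R'
      proof -
        have sub: "(lattice_ball R :: (int ^ 'd) set) \<subseteq> lattice_ball R'"
        proof
          fix z :: "int ^ 'd" assume "z \<in> lattice_ball R"
          then have "\<bar>z $ i\<bar> \<le> int R'" for i
            using that by (simp add: lattice_ball_def) (meson of_nat_mono order_trans)
          then show "z \<in> lattice_ball R'" by (simp add: lattice_ball_def)
        qed
        have "\<omega> \<notin> unstable R'"
          unfolding unstable_def using R sub by (blast dest: order_trans[OF sub])
        then show ?thesis by simp
      qed
      then show "(\<lambda>R. 4 * (H \<omega>)\<^sup>2 * indicator (unstable R) \<omega>) \<longlonglongrightarrow> 0"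
        by (intro tendsto_eventually) (auto simp: eventually_sequentially)
    qed
    show "(\<lambda>\<omega>. 4 * (H \<omega>)\<^sup>2 * indicator (unstable R) \<omega>) \<in> borel_measurable \<P>" for R
      using instability_integrable by auto
  qed (use H_square_integrable in \<open>auto simp: indicator_def abs_mult\<close>)
  then show ?thesis unfolding instability_def[abs_def] by simp
qed

lemma shifted_cost: "(LINT \<omega>|\<P>. 4 * (H (\<lambda>z. \<omega> (z + c)))\<^sup>2) = cost"
  unfolding cost_def
  by (rule reindex_integral[OF N inj_translate]) (use H_measurable in measurable)

lemma shifted_instability:
  "(LINT \<omega>|\<P>. 4 * (H (\<lambda>z. \<omega> (z + c)))\<^sup>2 * indicator (unstable R) (\<lambda>z. \<omega> (z + c))) = instability R"
  unfolding instability_def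
  by (rule reindex_integral[OF N inj_translate, of "\<lambda>\<omega>. 4 * (H \<omega>)\<^sup>2 * indicator (unstable R) \<omega>"])
     (use instability_integrable in auto)

text \<open>Efron--Stein with \<open>F\<close> on the window without \<open>c\<close> as the approximation that ignores the coordinate \<open>c\<close>.\<close>
lemma variance_window_le:
  assumes W: "finite W"
  shows "prob_space.variance \<P> (F W) \<le> real (card W) * (2 * cost)"
proof -
  have "(LINT \<omega>|\<P>. (F W \<omega> - F (W - {c}) \<omega>)\<^sup>2) \<le> cost" for c
  proof -
    have "(LINT \<omega>|\<P>. (increment W c \<omega>)\<^sup>2) \<le> (LINT \<omega>|\<P>. 4 * (H (\<lambda>z. \<omega> (z + c)))\<^sup>2)"
    proof (rule integral_mono)
      show "integrable \<P> (\<lambda>\<omega>. (increment W c \<omega>)\<^sup>2)" by (rule increment_square_integrable[OF W])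
      show "integrable \<P> (\<lambda>\<omega>. 4 * (H (\<lambda>z. \<omega> (z + c)))\<^sup>2)" using H_shift(2) by simp
      fix \<omega> assume "\<omega> \<in> space \<P>"
      from power_mono[OF abs_increment_le[OF W this, of c] abs_ge_zero, of 2]
      show "(increment W c \<omega>)\<^sup>2 \<le> 4 * (H (\<lambda>z. \<omega> (z + c)))\<^sup>2"
        using zero_le_power2[of "H (\<lambda>z. \<omega> (z + c))"] unfolding power2_abs by linarith
    qed
    then show ?thesis unfolding shifted_cost by (simp add: increment_def)
  qed
  then have "(\<Sum>c\<in>W. 2 * (LINT \<omega>|\<P>. (F W \<omega> - F (W - {c}) \<omega>)\<^sup>2)) \<le> (\<Sum>c\<in>W. 2 * cost)"
    by (intro sum_mono) simp
  moreover have "prob_space.variance \<P> (F W) \<le> (\<Sum>c\<in>W. 2 * (LINT \<omega>|\<P>. (F W \<omega> - F (W - {c}) \<omega>)\<^sup>2))"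
  proof (rule efron_stein[OF N W F_measurable[OF W] F_square_integrable[OF W] F_local[OF W]])
    fix c
    show "F (W - {c}) \<in> borel_measurable \<P>" "integrable \<P> (\<lambda>\<omega>. (F (W - {c}) \<omega>)\<^sup>2)"
      using W by (simp_all add: F_measurable F_square_integrable)
    show "depends_on N (- {c}) (F (W - {c}))"
      by (rule depends_on_mono[OF F_local]) (use W in auto)
  qed
  ultimately show ?thesis by simp
qed

definition block_sum :: "nat \<Rightarrow> nat \<Rightarrow> (int ^ 'd \<Rightarrow> 's) \<Rightarrow> real" where
  "block_sum L n \<omega> = (\<Sum>w\<in>lattice_cube (n div L). F (block L w) \<omega>)"

lemma block_sum_measurable: "block_sum L n \<in> borel_measurable \<P>"
  unfolding block_sum_def[abs_def] by (intro borel_measurable_sum F_measurable finite_block)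

lemma block_sum_square_integrable: "integrable \<P> (\<lambda>\<omega>. (block_sum L n \<omega>)\<^sup>2)"
proof -
  interpret P: prob_space \<P> by (rule prob_space_P)
  show ?thesis
    unfolding block_sum_def by (rule P.square_integrable_sum) (auto intro: F_measurable F_square_integrable finite_block)
qed

lemma depends_on_diff:
  assumes "depends_on N A f" "depends_on N A g"
  shows "depends_on N A (\<lambda>\<omega>. f \<omega> - g \<omega> :: real)"
  unfolding depends_on_def
proof (intro ballI impI)
  fix \<omega> \<omega>' assume *: "\<omega> \<in> space (iid_field N)" "\<omega>' \<in> space (iid_field N)" "\<forall>i\<in>A. \<omega> i = \<omega>' i"
  show "f \<omega> - g \<omega> = f \<omega>' - g \<omega>'"
    by (intro arg_cong2[where f = "(-)"] depends_onD[OF assms(1) *(1,2)] depends_onD[OF assms(2) *(1,2)]) (use *(3) in blast)+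
qed

lemma depends_on_sum:
  assumes "\<And>i. i \<in> I \<Longrightarrow> depends_on N A (f i)"
  shows "depends_on N A (\<lambda>\<omega>. \<Sum>i\<in>I. f i \<omega> :: real)"
  unfolding depends_on_def
proof (intro ballI impI)
  fix \<omega> \<omega>' assume *: "\<omega> \<in> space (iid_field N)" "\<omega>' \<in> space (iid_field N)" "\<forall>i\<in>A. \<omega> i = \<omega>' i"
  show "(\<Sum>i\<in>I. f i \<omega>) = (\<Sum>i\<in>I. f i \<omega>')"
    by (intro sum.cong refl depends_onD[OF assms *(1,2)]) (use *(3) in blast)+
qed

text \<open>Efron--Stein for the difference, compared at each site \<open>c\<close> with the same difference after the removal of \<open>c\<close> from the cube and from the block that contains it.
  The error at \<open>c\<close> is the difference of the increments in the cube and in the block. At a site whose \<open>R\<close>-neighbourhood lies in a block this vanishes off the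
  unstable event; the other sites, near block boundaries or in no block at all, are counted by \<open>card_interior\<close>.\<close>
lemma variance_block_error:
  assumes R: "2 * R \<le> L"
  shows "prob_space.variance \<P> (\<lambda>\<omega>. F (lattice_cube n) \<omega> - block_sum L n \<omega>) \<le>
    2 * (real n ^ CARD('d) * instability R
       + (real n ^ CARD('d) - real ((n div L) * (L - 2 * R)) ^ CARD('d)) * cost)"
proof -
  interpret P: prob_space \<P> by (rule prob_space_P)
  let ?C = "lattice_cube n :: (int ^ 'd) set"
  let ?M = "lattice_cube (n div L) :: (int ^ 'd) set"
  define g where "g c \<omega> = F (?C - {c}) \<omega> - (\<Sum>w\<in>?M. F (block L w - {c}) \<omega>)" for c \<omega>
  define G where "G \<omega> = F ?C \<omega> - block_sum L n \<omega>" for \<omega>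
  \<comment> \<open>sites at which the increments of the cube and of a block agree off the unstable event\<close>
  define good where "good = {c :: int ^ 'd. \<exists>w\<in>?M. (\<lambda>z. z + c) ` lattice_ball R \<subseteq> block L w} \<inter> (\<Union>w\<in>?M. block L w)"
  have fC: "finite ?C" by (rule card_lattice_cube)
  have fM: "finite ?M" by (rule card_lattice_cube)
  have goodC: "good \<subseteq> ?C"
    unfolding good_def using block_subset_cube by blast
  have Gg: "G \<omega> - g c \<omega> = increment ?C c \<omega> - (\<Sum>w\<in>?M. increment (block L w) c \<omega>)" for c \<omega>
    unfolding G_def g_def block_sum_def increment_def by (simp add: sum_subtractf)
  have one: "(\<Sum>w\<in>?M. increment (block L w) c \<omega>) = increment (block L w) c \<omega>" if "w \<in> ?M" "c \<in> block L w" for c w \<omega>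
  proof -
    have "increment (block L w') c \<omega> = 0" if "w' \<in> ?M - {w}" for w'
      by (rule increment_outside) (use block_unique[of c L w w'] \<open>c \<in> block L w\<close> that in blast)
    then have "(\<Sum>w\<in>?M. increment (block L w) c \<omega>) = (\<Sum>w\<in>{w}. increment (block L w) c \<omega>)"
      by (intro sum.mono_neutral_right) (use fM \<open>w \<in> ?M\<close> in auto)
    then show ?thesis by simp
  qed
  have sum_le: "\<bar>\<Sum>w\<in>?M. increment (block L w) c \<omega>\<bar> \<le> H (\<lambda>z. \<omega> (z + c))" if "\<omega> \<in> space \<P>" for c \<omega>
  proof (cases "\<exists>w\<in>?M. c \<in> block L w")
    case True
    then obtain w where w: "w \<in> ?M" "c \<in> block L w" by blast
    then show ?thesis using abs_increment_le[OF finite_block that] by (simp add: one[OF w])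
  next
    case False
    then have "(\<Sum>w\<in>?M. increment (block L w) c \<omega>) = 0"
      by (intro sum.neutral) (auto simp: increment_outside)
    then show ?thesis using H_nonneg[OF reindex_in_space[OF that]] by simp
  qed
  have Gg_sq: "(G \<omega> - g c \<omega>)\<^sup>2 \<le> 4 * (H (\<lambda>z. \<omega> (z + c)))\<^sup>2" if "\<omega> \<in> space \<P>" for c \<omega>
  proof -
    have "\<bar>G \<omega> - g c \<omega>\<bar> \<le> 2 * H (\<lambda>z. \<omega> (z + c))"
      unfolding Gg using sum_le[OF that, of c] abs_increment_le[OF fC that, of c] by linarith
    then have "\<bar>G \<omega> - g c \<omega>\<bar>\<^sup>2 \<le> (2 * H (\<lambda>z. \<omega> (z + c)))\<^sup>2" by (rule power_mono) simp
    then show ?thesis by (simp add: power_mult_distrib)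
  qed
  have stable: "G \<omega> - g c \<omega> = 0" if \<omega>: "\<omega> \<in> space \<P>" and c: "c \<in> good" and st: "(\<lambda>z. \<omega> (z + c)) \<notin> unstable R" for c \<omega>
  proof -
    obtain w where w: "w \<in> ?M" "(\<lambda>z. z + c) ` lattice_ball R \<subseteq> block L w"
      using c unfolding good_def by blast
    have "0 + c \<in> (\<lambda>z. z + c) ` lattice_ball R" by (rule imageI) (simp add: lattice_ball_def)
    then have cw: "c \<in> block L w" using w(2) by auto
    have b1: "lattice_ball R \<subseteq> (\<lambda>z. z - c) ` block L w"
    proof
      fix z :: "int ^ 'd" assume "z \<in> lattice_ball R"
      then have "z + c \<in> block L w" using w(2) by blast
      then have "(z + c) - c \<in> (\<lambda>z. z - c) ` block L w" by (rule imageI)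
      then show "z \<in> (\<lambda>z. z - c) ` block L w" by simp
    qed
    have b2: "lattice_ball R \<subseteq> (\<lambda>z. z - c) ` ?C"
      using b1 block_subset_cube[OF w(1)] by blast
    have "increment ((\<lambda>z. z - c) ` ?C) 0 (\<lambda>z. \<omega> (z + c)) = increment ((\<lambda>z. z - c) ` block L w) 0 (\<lambda>z. \<omega> (z + c))"
      using st b1 b2 reindex_in_space[OF \<omega>, of "\<lambda>z. z + c"] fC finite_block[of L w]
      unfolding unstable_def by blast
    then have "increment ?C c \<omega> = increment (block L w) c \<omega>"
      using increment_translate[OF fC \<omega>] increment_translate[OF finite_block \<omega>] by metis
    then show ?thesis unfolding Gg one[OF w(1) cw] by simp
  qed
  have G_meas: "G \<in> borel_measurable \<P>"
    unfolding G_def[abs_def] by (intro borel_measurable_diff F_measurable fC block_sum_measurable)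
  have g_meas: "g c \<in> borel_measurable \<P>" for c
    unfolding g_def[abs_def] by (intro borel_measurable_diff borel_measurable_sum F_measurable finite_Diff fC finite_block)
  have G_sq: "integrable \<P> (\<lambda>\<omega>. (G \<omega>)\<^sup>2)"
    unfolding G_def by (intro P.square_integrable_diff F_measurable fC block_sum_measurable F_square_integrable block_sum_square_integrable)
  have g_sq: "integrable \<P> (\<lambda>\<omega>. (g c \<omega>)\<^sup>2)" for c
    unfolding g_def by (intro P.square_integrable_diff P.square_integrable_sum borel_measurable_sum F_measurable finite_Diff fC finite_block F_square_integrable)
  have G_dep: "depends_on N ?C G"
    unfolding G_def[abs_def] block_sum_def
    by (intro depends_on_diff depends_on_sum F_local fC depends_on_mono[OF F_local[OF finite_block] block_subset_cube])
  have g_dep: "depends_on N (- {c}) (g c)" for c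
  proof -
    have dep: "depends_on N (- {c}) (F (W - {c}))" if "finite W" for W
      by (rule depends_on_mono[OF F_local]) (use that in auto)
    show ?thesis unfolding g_def[abs_def] by (intro depends_on_diff depends_on_sum dep fC finite_block)
  qed
  have Gg_int: "integrable \<P> (\<lambda>\<omega>. (G \<omega> - g c \<omega>)\<^sup>2)" for c
    by (intro P.square_integrable_diff G_meas g_meas G_sq g_sq)
  have bad: "(LINT \<omega>|\<P>. (G \<omega> - g c \<omega>)\<^sup>2) \<le> cost" for c
    unfolding shifted_cost[of c, symmetric]
    by (rule integral_mono[OF Gg_int _ Gg_sq]) (use H_shift(2) in simp)
  have shI: "integrable \<P> (\<lambda>\<omega>. 4 * (H (\<lambda>z. \<omega> (z + c)))\<^sup>2 * indicator (unstable R) (\<lambda>z. \<omega> (z + c)))" for c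
    by (rule reindex_integrable[OF N inj_translate instability_integrable])
  have fine: "(LINT \<omega>|\<P>. (G \<omega> - g c \<omega>)\<^sup>2) \<le> instability R" if "c \<in> good" for c
    unfolding shifted_instability[of c, symmetric]
  proof (rule integral_mono[OF Gg_int shI])
    fix \<omega> assume "\<omega> \<in> space \<P>"
    then show "(G \<omega> - g c \<omega>)\<^sup>2 \<le> 4 * (H (\<lambda>z. \<omega> (z + c)))\<^sup>2 * indicator (unstable R) (\<lambda>z. \<omega> (z + c))"
      using Gg_sq[of \<omega> c] stable[OF _ that, of \<omega>] by (cases "(\<lambda>z. \<omega> (z + c)) \<in> unstable R") auto
  qed
  have cd: "real (card (?C - good)) = real (card ?C) - real (card good)"
    unfolding card_Diff_subset[OF finite_subset[OF goodC fC] goodC] by (rule of_nat_diff[OF card_mono[OF fC goodC]])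
  define s where "s c = 2 * (LINT \<omega>|\<P>. (G \<omega> - g c \<omega>)\<^sup>2)" for c
  have v: "P.variance G \<le> sum s ?C"
    unfolding s_def by (rule efron_stein[OF N fC G_meas G_sq G_dep g_meas g_sq g_dep])
  have "sum s ?C = sum s (?C - good) + sum s good"
    by (rule sum.subset_diff[OF goodC fC])
  also have "\<dots> \<le> (\<Sum>c\<in>?C - good. 2 * cost) + (\<Sum>c\<in>good. 2 * instability R)"
    unfolding s_def by (intro add_mono sum_mono mult_left_mono fine bad) auto
  also have "\<dots> = 2 * (real (card good) * instability R + (real (card ?C) - real (card good)) * cost)"
    unfolding sum_constant cd by (simp add: distrib_left)
  finally have u: "sum s ?C \<le> 2 * (real (card good) * instability R + (real (card ?C) - real (card good)) * cost)" .
  have 1: "real (card good) \<le> real n ^ CARD('d)"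
    unfolding of_nat_power[symmetric] of_nat_le_iff using card_mono[OF fC goodC] unfolding card_lattice_cube(2) .
  have 2: "real ((n div L) * (L - 2 * R)) ^ CARD('d) \<le> real (card good)"
    unfolding of_nat_power[symmetric] of_nat_le_iff good_def by (rule card_interior[OF R])
  have 3: "real (card ?C) = real n ^ CARD('d)" unfolding card_lattice_cube(2) by (rule of_nat_power)
  have "2 * (real (card good) * instability R + (real n ^ CARD('d) - real (card good)) * cost)
      \<le> 2 * (real n ^ CARD('d) * instability R + (real n ^ CARD('d) - real ((n div L) * (L - 2 * R)) ^ CARD('d)) * cost)"
    by (rule mult_left_mono[OF add_mono[OF mult_right_mono[OF 1 instability_nonneg]
            mult_right_mono[OF diff_left_mono[OF 2] cost_nonneg]]]) simp
  with v u show ?thesis unfolding 3 G_def[abs_def] by (meson order_trans)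
qed

end

section \<open>Normal limits for stabilizing functionals\<close>

lemma nat_div_tendsto:
  assumes "0 < L"
  shows "(\<lambda>n. real (n div L) / real n) \<longlonglongrightarrow> 1 / real L"
proof (rule tendsto_sandwich[of "\<lambda>n. 1 / real L - 1 / real n" _ _ "\<lambda>n. 1 / real L"])
  have "1 / real L - 1 / real n \<le> real (n div L) / real n" if "0 < n" for n
  proof -
    have "n < L * (n div L) + L" using assms by (metis add_less_cancel_left mod_less_divisor mult_div_mod_eq)
    then have "real n \<le> real L * (real (n div L) + 1)"
      by (metis distrib_left less_imp_le mult.right_neutral of_nat_1 of_nat_add of_nat_le_iff of_nat_mult)
    then have "real n / real L \<le> real (n div L) + 1" using assms by (simp add: divide_le_eq mult.commute)
    then have "(real n / real L) / real n \<le> (real (n div L) + 1) / real n" by (rule divide_right_mono) simp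
    then show ?thesis using that by (simp add: add_divide_distrib)
  qed
  then show "\<forall>\<^sub>F n in sequentially. 1 / real L - 1 / real n \<le> real (n div L) / real n"
    by (intro eventually_sequentiallyI[of 1]) auto
  have "real (n div L) / real n \<le> 1 / real L" if "0 < n" for n
  proof -
    have "real L * real (n div L) \<le> real n" by (metis of_nat_le_iff of_nat_mult times_div_less_eq_dividend)
    then show ?thesis using that assms by (simp add: field_simps)
  qed
  then show "\<forall>\<^sub>F n in sequentially. real (n div L) / real n \<le> 1 / real L"
    by (intro eventually_sequentiallyI[of 1]) auto
  show "(\<lambda>n. 1 / real L - 1 / real n) \<longlonglongrightarrow> 1 / real L"
    using tendsto_diff[OF tendsto_const lim_1_over_n[where 'a = real], of "1 / real L"] by simp
qed simp

context stabilizing_field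
begin

definition mean :: "nat \<Rightarrow> real" where "mean L = (LINT \<omega>|\<P>. F (lattice_cube L) \<omega>)"

definition scale :: "nat \<Rightarrow> real" where "scale n = real n powr (real CARD('d) / 2)"

lemma scale_square: "(scale n)\<^sup>2 = real n ^ CARD('d)"
proof (cases "n = 0")
  case False
  then have "(scale n)\<^sup>2 = real n powr (real CARD('d))"
    by (simp add: scale_def power2_eq_square flip: powr_add)
  then show ?thesis using False by (simp add: powr_realpow)
qed (simp add: scale_def)

lemma inverse_scale_tendsto: "(\<lambda>n. 1 / scale n) \<longlonglongrightarrow> 0"
proof -
  have "(\<lambda>n. real n powr - (real CARD('d) / 2)) \<longlonglongrightarrow> 0"
    by (rule tendsto_neg_powr) (auto intro: filterlim_real_sequentially)
  then show ?thesis by (simp add: scale_def powr_minus inverse_eq_divide)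
qed

definition normalized :: "nat \<Rightarrow> (int ^ 'd \<Rightarrow> 's) \<Rightarrow> real" where
  "normalized n \<omega> = (F (lattice_cube n) \<omega> - mean n) / scale n"

definition normalized_block_sum :: "nat \<Rightarrow> nat \<Rightarrow> (int ^ 'd \<Rightarrow> 's) \<Rightarrow> real" where
  "normalized_block_sum L n \<omega> = (\<Sum>w\<in>lattice_cube (n div L). (F (block L w) \<omega> - mean L) / scale n)"

lemma distr_block:
  assumes h: "h \<in> borel_measurable borel"
  shows "distr \<P> borel (\<lambda>\<omega>. h (F (block L w) \<omega>) :: real) = distr \<P> borel (\<lambda>\<omega>. h (F (lattice_cube L) \<omega>))"
proof -
  let ?v = "(\<chi> i. int L * w $ i) :: int ^ 'd"
  have m: "(\<lambda>\<omega>. h (F (lattice_cube L) \<omega>)) \<in> borel_measurable \<P>"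
    by (rule measurable_compose[OF F_measurable[OF card_lattice_cube(1)] h])
  have "distr \<P> borel (\<lambda>\<omega>. h (F (lattice_cube L) \<omega>))
      = distr (distr \<P> \<P> (\<lambda>\<omega> z. \<omega> (z + ?v))) borel (\<lambda>\<omega>. h (F (lattice_cube L) \<omega>))"
    by (subst distr_reindex[OF N inj_translate]) (rule refl)
  also have "\<dots> = distr \<P> borel ((\<lambda>\<omega>. h (F (lattice_cube L) \<omega>)) \<circ> (\<lambda>\<omega> z. \<omega> (z + ?v)))"
    by (rule distr_distr[OF m reindex_measurable])
  also have "\<dots> = distr \<P> borel (\<lambda>\<omega>. h (F (block L w) \<omega>))"
    by (rule distr_cong) (simp_all add: block_def F_translate[OF card_lattice_cube(1)])
  finally show ?thesis by (rule sym)
qed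

lemma block_mean: "(LINT \<omega>|\<P>. F (block L w) \<omega>) = mean L"
proof -
  have "(LINT \<omega>|\<P>. F (block L w) \<omega>) = (LINT x|distr \<P> borel (F (block L w)). x)"
    by (rule integral_distr[symmetric]) (auto intro: F_measurable finite_block)
  also have "\<dots> = (LINT x|distr \<P> borel (F (lattice_cube L)). x)"
    using distr_block[of "\<lambda>x. x" L w] by simp
  also have "\<dots> = mean L"
    unfolding mean_def by (rule integral_distr) (auto intro: F_measurable card_lattice_cube)
  finally show ?thesis .
qed

lemma F_integrable: "finite W \<Longrightarrow> integrable \<P> (F W)"
  by (rule finite_measure.square_integrable_imp_integrable[OF prob_space.finite_measure[OF prob_space_P] F_measurable F_square_integrable])

text \<open>Distinct blocks are disjoint, hence independent, and equally distributed by translation.\<close>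
lemma char_normalized_block_sum:
  assumes L: "0 < L" "L \<le> n"
  shows "char (distr \<P> borel (normalized_block_sum L n)) t
    = char (distr \<P> borel (\<lambda>\<omega>. F (lattice_cube L) \<omega> - mean L)) (t * (1 / scale n)) ^ ((n div L) ^ CARD('d))"
proof -
  interpret P: prob_space \<P> by (rule prob_space_P)
  let ?M = "lattice_cube (n div L) :: (int ^ 'd) set"
  define Y where "Y w \<omega> = (F (block L w) \<omega> - mean L) / scale n" for w \<omega>
  have Ym: "Y w \<in> borel_measurable \<P>" for w
    unfolding Y_def[abs_def] by (intro borel_measurable_divide borel_measurable_diff F_measurable finite_block) auto
  have "(0 :: int ^ 'd) \<in> ?M" using L by (simp add: lattice_cube_def div_greater_zero_iff)
  then have "P.indep_vars (\<lambda>_. borel) Y ?M"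
  proof (intro indep_disjoint_dependence[OF N, where K = "block L"])
    show "disjoint_family_on (block L) ?M"
      unfolding disjoint_family_on_def using block_unique by blast
    show "depends_on N (block L w) (Y w)" for w
      unfolding depends_on_def Y_def
      using depends_onD[OF F_local[OF finite_block]] by (metis (no_types, lifting))
  qed (auto intro: Ym)
  then have "char (distr \<P> borel (\<lambda>\<omega>. \<Sum>w\<in>?M. Y w \<omega>)) t = (\<Prod>w\<in>?M. char (distr \<P> borel (Y w)) t)"
    by (rule P.char_distr_sum)
  also have "\<dots> = (\<Prod>w\<in>?M. char (distr \<P> borel (\<lambda>\<omega>. F (lattice_cube L) \<omega> - mean L)) (t * (1 / scale n)))"
  proof (intro prod.cong refl)
    fix w
    have m: "F (lattice_cube L) \<in> borel_measurable \<P>" by (rule F_measurable[OF card_lattice_cube(1)])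
    have "distr \<P> borel (Y w) = distr \<P> borel (\<lambda>\<omega>. (F (lattice_cube L) \<omega> - mean L) / scale n)"
      unfolding Y_def[abs_def] by (rule distr_block[of "\<lambda>x. (x - mean L) / scale n"]) measurable
    also have "char \<dots> t = (CLINT \<omega>|\<P>. iexp (t * ((F (lattice_cube L) \<omega> - mean L) / scale n)))"
      unfolding char_def by (rule integral_distr) (use m in measurable)
    also have "\<dots> = (CLINT \<omega>|\<P>. iexp (t * (1 / scale n) * (F (lattice_cube L) \<omega> - mean L)))"
      by simp
    also have "\<dots> = char (distr \<P> borel (\<lambda>\<omega>. F (lattice_cube L) \<omega> - mean L)) (t * (1 / scale n))"
      unfolding char_def by (rule integral_distr[symmetric]) (use m in measurable)
    finally show "char (distr \<P> borel (Y w)) t = char (distr \<P> borel (\<lambda>\<omega>. F (lattice_cube L) \<omega> - mean L)) (t * (1 / scale n))" .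
  qed
  also have "\<dots> = char (distr \<P> borel (\<lambda>\<omega>. F (lattice_cube L) \<omega> - mean L)) (t * (1 / scale n)) ^ ((n div L) ^ CARD('d))"
    by (simp only: prod_constant card_lattice_cube)
  finally show ?thesis unfolding normalized_block_sum_def[abs_def] Y_def .
qed

lemma block_density_tendsto:
  assumes "0 < L"
  shows "(\<lambda>n. (real ((n div L) * k) / real n) ^ CARD('d)) \<longlonglongrightarrow> (real k / real L) ^ CARD('d)"
proof -
  have "(\<lambda>n. (real (n div L) / real n * real k) ^ CARD('d)) \<longlonglongrightarrow> (1 / real L * real k) ^ CARD('d)"
    by (intro tendsto_intros nat_div_tendsto assms)
  then show ?thesis by (simp add: mult_ac)
qed

lemma char_normalized_block_sum_tendsto:
  assumes L: "0 < L"
  shows "(\<lambda>n. char (distr \<P> borel (normalized_block_sum L n)) t) \<longlonglongrightarrow>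
    complex_of_real (exp (- (t\<^sup>2 * (prob_space.variance \<P> (F (lattice_cube L)) / real L ^ CARD('d)) / 2)))"
proof -
  interpret P: prob_space \<P> by (rule prob_space_P)
  define \<mu> where "\<mu> = distr \<P> borel (\<lambda>\<omega>. F (lattice_cube L) \<omega> - mean L)"
  have m: "(\<lambda>\<omega>. F (lattice_cube L) \<omega> - mean L) \<in> borel_measurable \<P>"
    by (intro borel_measurable_diff F_measurable[OF card_lattice_cube(1)]) auto
  have sq: "integrable \<P> (\<lambda>\<omega>. (F (lattice_cube L) \<omega> - mean L)\<^sup>2)"
    by (intro P.square_integrable_diff F_measurable F_square_integrable card_lattice_cube(1)) auto
  have "(\<lambda>n. char \<mu> (t * (1 / scale n)) ^ ((n div L) ^ CARD('d))) \<longlonglongrightarrow>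
    complex_of_real (exp (- (t\<^sup>2 * (1 / real L) ^ CARD('d) * (LINT x|\<mu>. x\<^sup>2) / 2)))"
  proof (rule char_power_limit)
    show "real_distribution \<mu>" unfolding \<mu>_def by (rule P.real_distribution_distr[OF m])
    show "integrable \<mu> (\<lambda>x. x\<^sup>2)" unfolding \<mu>_def using sq by (subst integrable_distr_eq[OF m]) auto
    have "(LINT x|\<mu>. x) = (LINT \<omega>|\<P>. F (lattice_cube L) \<omega> - mean L)"
      unfolding \<mu>_def by (rule integral_distr[OF m]) simp
    also have "\<dots> = 0"
      using F_integrable[OF card_lattice_cube(1)] by (simp add: mean_def P.prob_space)
    finally show "(LINT x|\<mu>. x) = 0" .
    have "(\<lambda>n. (real ((n div L) * 1) / real n) ^ CARD('d)) \<longlonglongrightarrow> (real 1 / real L) ^ CARD('d)"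
      by (rule block_density_tendsto[OF L])
    then show "(\<lambda>n. real ((n div L) ^ CARD('d)) * (1 / scale n)\<^sup>2) \<longlonglongrightarrow> (1 / real L) ^ CARD('d)"
      by (simp add: power_divide scale_square)
  qed (rule inverse_scale_tendsto)
  moreover have "(LINT x|\<mu>. x\<^sup>2) = P.variance (F (lattice_cube L))"
    unfolding \<mu>_def mean_def[symmetric] by (rule integral_distr[OF m]) simp
  ultimately have "(\<lambda>n. char \<mu> (t * (1 / scale n)) ^ ((n div L) ^ CARD('d))) \<longlonglongrightarrow>
    complex_of_real (exp (- (t\<^sup>2 * (P.variance (F (lattice_cube L)) / real L ^ CARD('d)) / 2)))"
    by (simp add: power_divide)
  then show ?thesis
    by (rule Lim_transform_eventually)
       (use char_normalized_block_sum[OF L] in \<open>auto simp: \<mu>_def eventually_sequentially intro!: exI[of _ L]\<close>)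
qed

text \<open>The bound for the difference of characteristic functions at argument \<open>1\<close>, when a proportion \<open>x\<close> of the sites has its \<open>R\<close>-neighbourhood inside a block.\<close>
definition block_error :: "nat \<Rightarrow> real \<Rightarrow> real" where
  "block_error R x = sqrt (2 * (instability R + (1 - x) * cost))"

text \<open>The centred difference has standard deviation controlled by \<open>variance_block_error\<close>; dividing by \<open>n\<^sup>d\<close> leaves the proportion of interior sites.\<close>
lemma char_normalized_diff:
  assumes R: "2 * R \<le> L" and n: "0 < n"
  shows "cmod (char (distr \<P> borel (normalized n)) t - char (distr \<P> borel (normalized_block_sum L n)) t)
    \<le> \<bar>t\<bar> * block_error R ((real ((n div L) * (L - 2 * R)) / real n) ^ CARD('d))"
proof -
  interpret P: prob_space \<P> by (rule prob_space_P)
  define G where "G \<omega> = F (lattice_cube n) \<omega> - block_sum L n \<omega>" for \<omega>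
  have nm: "normalized n \<in> borel_measurable \<P>"
    unfolding normalized_def[abs_def] by (intro borel_measurable_divide borel_measurable_diff F_measurable[OF card_lattice_cube(1)]) auto
  have bm: "normalized_block_sum L n \<in> borel_measurable \<P>"
    unfolding normalized_block_sum_def[abs_def]
    by (intro borel_measurable_sum borel_measurable_divide borel_measurable_diff F_measurable finite_block) auto
  have nsq: "integrable \<P> (\<lambda>\<omega>. (normalized n \<omega>)\<^sup>2)"
  proof -
    have "integrable \<P> (\<lambda>\<omega>. (F (lattice_cube n) \<omega> - mean n)\<^sup>2)"
      by (intro P.square_integrable_diff F_measurable F_square_integrable card_lattice_cube(1)) auto
    then show ?thesis unfolding normalized_def power_divide by simp
  qed
  have bsq: "integrable \<P> (\<lambda>\<omega>. (normalized_block_sum L n \<omega>)\<^sup>2)"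
    unfolding normalized_block_sum_def
  proof (rule P.square_integrable_sum)
    fix w
    have "integrable \<P> (\<lambda>\<omega>. (F (block L w) \<omega> - mean L)\<^sup>2)"
      by (intro P.square_integrable_diff F_measurable F_square_integrable finite_block) auto
    then show "integrable \<P> (\<lambda>\<omega>. ((F (block L w) \<omega> - mean L) / scale n)\<^sup>2)" unfolding power_divide by simp
    show "(\<lambda>\<omega>. (F (block L w) \<omega> - mean L) / scale n) \<in> borel_measurable \<P>"
      by (intro borel_measurable_divide borel_measurable_diff F_measurable finite_block) auto
  qed
  have EG: "P.expectation G = mean n - (\<Sum>w\<in>(lattice_cube (n div L) :: (int ^ 'd) set). mean L)"
    unfolding G_def[abs_def] block_sum_def mean_def[of n]
    by (subst Bochner_Integration.integral_diff)
       (simp_all add: F_integrable card_lattice_cube(1) finite_block Bochner_Integration.integral_sum block_mean)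
  have eq: "normalized n \<omega> - normalized_block_sum L n \<omega> = (G \<omega> - P.expectation G) / scale n" for \<omega>
    unfolding EG G_def normalized_def normalized_block_sum_def block_sum_def
    by (simp add: sum_divide_distrib[symmetric] sum_subtractf diff_divide_distrib[symmetric] algebra_simps)
  have "P.expectation (\<lambda>\<omega>. (normalized n \<omega> - normalized_block_sum L n \<omega>)\<^sup>2) = P.variance G / real n ^ CARD('d)"
    unfolding eq power_divide scale_square by simp
  also have "\<dots> \<le> 2 * (real n ^ CARD('d) * instability R
       + (real n ^ CARD('d) - real ((n div L) * (L - 2 * R)) ^ CARD('d)) * cost) / real n ^ CARD('d)"
    unfolding G_def[abs_def] by (intro divide_right_mono variance_block_error R) simp
  also have "\<dots> = 2 * (instability R + (1 - (real ((n div L) * (L - 2 * R)) / real n) ^ CARD('d)) * cost)"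
  proof -
    have *: "2 * (a * i + (a - b) * c) / a = 2 * (i + (1 - b / a) * c)" if "a \<noteq> 0" for a b c i :: real
      using that by (simp add: field_simps)
    show ?thesis unfolding power_divide by (rule *) (use n in simp)
  qed
  finally have "sqrt (P.expectation (\<lambda>\<omega>. (normalized n \<omega> - normalized_block_sum L n \<omega>)\<^sup>2))
     \<le> block_error R ((real ((n div L) * (L - 2 * R)) / real n) ^ CARD('d))"
    unfolding block_error_def by (rule real_sqrt_le_mono)
  then show ?thesis
    using P.char_distr_diff[OF nm bm nsq bsq, of t] by (meson abs_ge_zero mult_left_mono order_trans)
qed

text \<open>For fixed side \<open>L\<close> the block sums have a normal limit with variance \<open>v L\<close>, the variance of the functional on one block per unit of volume. The numbers \<open>v L\<close> are bounded, so they
  converge along a subsequence of sides; block sums with these sides approximate the functional uniformly for large \<open>n\<close>, which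
  forces convergence of the whole sequence in \<open>n\<close>.\<close>
theorem central_limit_char:
  "\<exists>s\<ge>0. \<forall>t. (\<lambda>n. char (distr \<P> borel (normalized n)) t) \<longlonglongrightarrow> complex_of_real (exp (- (s * t)\<^sup>2 / 2))"
proof -
  interpret P: prob_space \<P> by (rule prob_space_P)
  define v where "v L = P.variance (F (lattice_cube L)) / real L ^ CARD('d)" for L
  have v_le: "v (Suc L) \<le> 2 * cost" for L
  proof -
    have "P.variance (F (lattice_cube (Suc L))) \<le> real (Suc L) ^ CARD('d) * (2 * cost)"
      using variance_window_le[OF card_lattice_cube(1)[of "Suc L"]] unfolding card_lattice_cube(2) of_nat_power .
    then show ?thesis unfolding v_def by (simp add: divide_le_eq mult.commute)
  qed
  have v_ge: "0 \<le> v L" for L unfolding v_def by (simp add: P.variance_positive)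
  \<comment> \<open>the shift by one keeps away from the side \<open>0\<close>\<close>
  have seq: "\<forall>L. (\<lambda>L. v (Suc L)) L \<in> {0..2 * cost}" using v_le v_ge by simp
  have "\<exists>l\<in>{0..2 * cost}. \<exists>r. strict_mono r \<and> ((\<lambda>L. v (Suc L)) \<circ> r) \<longlonglongrightarrow> l"
    using compact_Icc[of 0 "2 * cost", unfolded compact_def, rule_format, of "\<lambda>L. v (Suc L)"] seq by simp
  then obtain s2 r where r: "s2 \<in> {0..2 * cost}" "strict_mono r" "((\<lambda>L. v (Suc L)) \<circ> r) \<longlonglongrightarrow> s2"
    by blast
  define Ls where "Ls k = Suc (r k)" for k
  have Ls_lim: "filterlim Ls at_top sequentially"
    unfolding Ls_def by (rule filterlim_compose[OF filterlim_Suc filterlim_subseq[OF r(2)]])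
  have vLs: "(\<lambda>k. v (Ls k)) \<longlonglongrightarrow> s2" using r(3) by (simp add: Ls_def comp_def)
  have "(\<lambda>n. char (distr \<P> borel (normalized n)) t) \<longlonglongrightarrow> complex_of_real (exp (- (t\<^sup>2 * s2 / 2)))" for t
  proof (rule tendstoI)
    fix e :: real assume e: "0 < e"
    let ?g = "\<lambda>x. complex_of_real (exp (- (t\<^sup>2 * x / 2)))"
    \<comment> \<open>four errors of size \<open>e / 4\<close>: choose \<open>R\<close> for the instability, then the side \<open>L\<close>, then \<open>n\<close>\<close>
    have "(\<lambda>R. \<bar>t\<bar> * block_error R 1) \<longlonglongrightarrow> \<bar>t\<bar> * sqrt (2 * (0 + (1 - 1) * cost))"
      unfolding block_error_def by (intro tendsto_intros instability_tendsto_0)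
    then have "\<forall>\<^sub>F R in sequentially. \<bar>t\<bar> * block_error R 1 < e / 4"
      using e by (intro order_tendstoD(2)[of _ "\<bar>t\<bar> * sqrt (2 * (0 + (1 - 1) * cost))"]) auto
    then obtain R where R: "\<bar>t\<bar> * block_error R 1 < e / 4"
      using eventually_happens'[OF sequentially_bot] by blast
    have "(\<lambda>L. 1 - 2 * real R / real L) \<longlonglongrightarrow> 1 - 0"
      by (intro tendsto_intros real_tendsto_divide_at_top[OF tendsto_const] filterlim_real_sequentially)
    then have "(\<lambda>L. (1 - 2 * real R / real L) ^ CARD('d)) \<longlonglongrightarrow> 1"
      by (auto intro!: tendsto_eq_intros)
    then have "(\<lambda>L. (real (L - 2 * R) / real L) ^ CARD('d)) \<longlonglongrightarrow> 1"
      by (rule Lim_transform_eventually)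
         (auto simp: eventually_sequentially of_nat_diff diff_divide_distrib intro!: exI[of _ "Suc (2 * R)"])
    then have "(\<lambda>L. \<bar>t\<bar> * block_error R ((real (L - 2 * R) / real L) ^ CARD('d))) \<longlonglongrightarrow> \<bar>t\<bar> * block_error R 1"
      unfolding block_error_def by (intro tendsto_intros)
    then have "\<forall>\<^sub>F L in sequentially. \<bar>t\<bar> * block_error R ((real (L - 2 * R) / real L) ^ CARD('d)) < e / 4"
      by (rule order_tendstoD(2)[OF _ R])
    then have 1: "\<forall>\<^sub>F k in sequentially. \<bar>t\<bar> * block_error R ((real (Ls k - 2 * R) / real (Ls k)) ^ CARD('d)) < e / 4"
      by (rule eventually_compose_filterlim[OF _ Ls_lim])
    have 2: "\<forall>\<^sub>F k in sequentially. 2 * R \<le> Ls k"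
      using Ls_lim unfolding filterlim_at_top by blast
    have "(\<lambda>k. ?g (v (Ls k))) \<longlonglongrightarrow> ?g s2" by (intro tendsto_intros vLs) auto
    then have 3: "\<forall>\<^sub>F k in sequentially. dist (?g (v (Ls k))) (?g s2) < e / 4"
      by (rule tendstoD) (use e in simp)
    obtain k where k: "\<bar>t\<bar> * block_error R ((real (Ls k - 2 * R) / real (Ls k)) ^ CARD('d)) < e / 4"
        "2 * R \<le> Ls k" "dist (?g (v (Ls k))) (?g s2) < e / 4"
      using eventually_conj[OF 1 eventually_conj[OF 2 3]] unfolding eventually_sequentially by blast
    define L where "L = Ls k"
    have L: "0 < L" by (simp add: L_def Ls_def)
    have "(\<lambda>n. \<bar>t\<bar> * block_error R ((real ((n div L) * (L - 2 * R)) / real n) ^ CARD('d)))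
        \<longlonglongrightarrow> \<bar>t\<bar> * block_error R ((real (L - 2 * R) / real L) ^ CARD('d))"
      unfolding block_error_def by (intro tendsto_intros block_density_tendsto L)
    then have 4: "\<forall>\<^sub>F n in sequentially. \<bar>t\<bar> * block_error R ((real ((n div L) * (L - 2 * R)) / real n) ^ CARD('d)) < e / 4"
      by (rule order_tendstoD(2)) (use k(1) in \<open>simp add: L_def\<close>)
    have 5: "\<forall>\<^sub>F n in sequentially. dist (char (distr \<P> borel (normalized_block_sum L n)) t) (?g (v L)) < e / 4"
      unfolding v_def by (rule tendstoD[OF char_normalized_block_sum_tendsto[OF L]]) (use e in simp)
    show "\<forall>\<^sub>F n in sequentially. dist (char (distr \<P> borel (normalized n)) t) (?g s2) < e"
      using 4 5 eventually_gt_at_top[of 0]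
    proof eventually_elim
      case (elim n)
      have "dist (char (distr \<P> borel (normalized n)) t) (char (distr \<P> borel (normalized_block_sum L n)) t) < e / 4"
        using char_normalized_diff[of R L n t] k(2) elim unfolding dist_norm L_def[symmetric] by linarith
      moreover have "dist (?g (v L)) (?g s2) < e / 4" using k(3) unfolding L_def .
      ultimately show ?case
        using dist_triangle[of "char (distr \<P> borel (normalized n)) t" "?g s2" "char (distr \<P> borel (normalized_block_sum L n)) t"]
          dist_triangle[of "char (distr \<P> borel (normalized_block_sum L n)) t" "?g s2" "?g (v L)"] elim(2) e by linarith
    qed
  qed
  then have "\<forall>t. (\<lambda>n. char (distr \<P> borel (normalized n)) t) \<longlonglongrightarrow> complex_of_real (exp (- (sqrt s2 * t)\<^sup>2 / 2))"
    using r(1) by (simp add: power_mult_distrib mult.commute)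
  then show ?thesis using r(1) by (intro exI[of _ "sqrt s2"]) auto
qed

end

section \<open>Labelled point configurations and unit cells\<close>

text \<open>The label records all that matters about a mark: \<open>0\<close> for a mark at most \<open>s\<close>, \<open>1\<close> for one in \<open>(s, s']\<close> and \<open>2\<close> for a larger one. Real labels make a configuration a subset of a Euclidean space, with its Borel sets at hand.\<close>
type_synonym 'n labelled = "(real ^ 'n) \<times> real"

definition low_points :: "'n labelled set \<Rightarrow> (real ^ 'n) set" where
  "low_points Q = {x. (x, 0) \<in> Q}"

definition high_points :: "'n labelled set \<Rightarrow> (real ^ 'n) set" where
  "high_points Q = {x. (x, 0) \<in> Q \<or> (x, 1) \<in> Q}"

definition embed :: "int ^ 'n \<Rightarrow> real ^ 'n" where
  "embed z = (\<chi> i. real_of_int (z $ i))"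

definition cell :: "int ^ 'n \<Rightarrow> (real ^ 'n) set" where
  "cell z = {x. \<forall>i. real_of_int (z $ i) \<le> x $ i \<and> x $ i < real_of_int (z $ i) + 1}"

definition move :: "real ^ 'n \<Rightarrow> 'n labelled set \<Rightarrow> 'n labelled set" where
  "move v Q = (\<lambda>(x, t). (x + v, t)) ` Q"

definition assemble :: "(int ^ 'n) set \<Rightarrow> (int ^ 'n \<Rightarrow> 'n labelled set) \<Rightarrow> 'n labelled set" where
  "assemble W \<omega> = (\<Union>z\<in>W. move (embed z) (\<omega> z))"

text \<open>Configurations in one cell are stored relative to the corner of the cell, so that those of different cells are comparable.\<close>
definition cell_configurations :: "'n::finite labelled set set" where
  "cell_configurations = {Q. finite Q \<and> Q \<subseteq> cell 0 \<times> {0, 1, 2}}"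

lemma embed_add: "embed (z + w) = embed z + embed w"
  by (simp add: embed_def Finite_Cartesian_Product.vec_eq_iff)

lemma move_add: "move (u + v) Q = move v (move u Q)"
  by (force simp: move_def image_image add.assoc)

lemma move_UN: "move v (\<Union>i\<in>I. Q i) = (\<Union>i\<in>I. move v (Q i))"
  by (auto simp: move_def)

lemma assemble_translate:
  "assemble ((\<lambda>z. z + v) ` W) \<omega> = move (embed v) (assemble W (\<lambda>z. \<omega> (z + v)))"
  unfolding assemble_def move_UN by (simp add: embed_add move_add)

lemma cell_disjoint:
  assumes "x \<in> cell z" "x \<in> cell w"
  shows "z = w"
proof -
  have "z $ i = w $ i" for i
  proof -
    have "real_of_int (z $ i) \<le> x $ i" "x $ i < real_of_int (z $ i) + 1"
      "real_of_int (w $ i) \<le> x $ i" "x $ i < real_of_int (w $ i) + 1"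
      using assms unfolding cell_def by blast+
    then show ?thesis by linarith
  qed
  then show ?thesis by (simp add: Finite_Cartesian_Product.vec_eq_iff)
qed

lemma move_in_cell:
  assumes "Q \<in> cell_configurations" "p \<in> move (embed z) Q"
  shows "fst p \<in> cell z"
proof -
  obtain x t where x: "(x, t) \<in> Q" "p = (x + embed z, t)" using assms(2) unfolding move_def by auto
  have "x \<in> cell 0" using x(1) assms(1) unfolding cell_configurations_def by blast
  then have "\<forall>i. 0 \<le> x $ i \<and> x $ i < 1" by (simp add: cell_def)
  then show ?thesis unfolding x(2) cell_def embed_def by simp
qed

lemma finite_move: "finite Q \<Longrightarrow> finite (move v Q)"
  by (simp add: move_def)

lemma finite_assemble:
  assumes "finite W" "\<And>z. \<omega> z \<in> cell_configurations"
  shows "finite (assemble W \<omega>)"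
  unfolding assemble_def using assms by (auto simp: cell_configurations_def intro: finite_move)

text \<open>Cells are disjoint, so emptying the cell \<open>c\<close> removes exactly its points.\<close>
lemma assemble_delete:
  assumes "\<And>z. \<omega> z \<in> cell_configurations"
  shows "assemble (W - {c}) \<omega> = assemble W \<omega> - cell c \<times> UNIV"
proof (intro equalityI subsetI)
  fix p assume "p \<in> assemble (W - {c}) \<omega>"
  then obtain z where z: "z \<in> W" "z \<noteq> c" "p \<in> move (embed z) (\<omega> z)" unfolding assemble_def by blast
  have "fst p \<notin> cell c" using cell_disjoint[OF move_in_cell[OF assms z(3)]] z(2) by blast
  then show "p \<in> assemble W \<omega> - cell c \<times> UNIV" using z unfolding assemble_def by auto
next
  fix p assume p: "p \<in> assemble W \<omega> - cell c \<times> UNIV"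
  then obtain z where z: "z \<in> W" "p \<in> move (embed z) (\<omega> z)" unfolding assemble_def by blast
  have "z \<noteq> c" using move_in_cell[OF assms z(2)] p by (cases p) auto
  then show "p \<in> assemble (W - {c}) \<omega>" using z unfolding assemble_def by blast
qed

text \<open>Points at distance at most \<open>D\<close> differ by at most \<open>D\<close> in each coordinate, and rounding down loses at most one more.\<close>
lemma near_cells:
  assumes "\<And>z. \<omega> z \<in> cell_configurations" and p: "p \<in> assemble W \<omega>" and c: "x \<in> cell c"
    and d: "dist (fst p) x \<le> real D"
  shows "\<exists>z\<in>lattice_ball (D + 1). p \<in> move (embed (z + c)) (\<omega> (z + c))"
proof -
  obtain w where w: "w \<in> W" "p \<in> move (embed w) (\<omega> w)" using p unfolding assemble_def by blast
  have pw: "fst p \<in> cell w" by (rule move_in_cell[OF assms(1) w(2)])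
  have "\<bar>(w - c) $ i\<bar> \<le> int (D + 1)" for i
  proof -
    have 1: "real_of_int (w $ i) \<le> fst p $ i" "fst p $ i < real_of_int (w $ i) + 1"
      "real_of_int (c $ i) \<le> x $ i" "x $ i < real_of_int (c $ i) + 1"
      using pw c unfolding cell_def by blast+
    have "\<bar>fst p $ i - x $ i\<bar> \<le> real D"
      using component_le_norm_cart[of "fst p - x" i] d by (simp add: dist_norm)
    then have "\<bar>real_of_int (w $ i) - real_of_int (c $ i)\<bar> < real D + 1" using 1 by linarith
    then have "\<bar>w $ i - c $ i\<bar> < int D + 1" by linarith
    then show ?thesis by simp
  qed
  then have "w - c \<in> lattice_ball (D + 1)" by (simp add: lattice_ball_def)
  then show ?thesis using w(2) by (intro bexI[of _ "w - c"]) simp_all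
qed

locale multicover_parameters =
  fixes r r' :: real and k k' q T :: nat
  assumes par: "0 \<le> r" "r \<le> r'" "r' \<le> real T" "k' \<le> k" "1 \<le> k'"
begin

definition labelled_betti :: "('n::{finite,linorder}) labelled set \<Rightarrow> nat" where
  "labelled_betti Q = homology_rank (Mult r k (low_points Q)) (Mult r' k' (high_points Q)) q (lex_smallest k')"

definition low_cells :: "('n::{finite,linorder}) labelled set \<Rightarrow> (real ^ 'n::{finite,linorder}) set set set" where
  "low_cells Q = simplices (Mult r k (low_points Q)) q"

definition high_cells :: "('n::{finite,linorder}) labelled set \<Rightarrow> (real ^ 'n::{finite,linorder}) set set set" where
  "high_cells Q = simplices (Mult r' k' (high_points Q)) (Suc q)"

text \<open>The simplices with a point in \<open>C\<close>: those that disappear when \<open>C\<close> is emptied.\<close>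
definition touching :: "(real ^ 'n) set \<Rightarrow> (real ^ 'n) set set set" where
  "touching C = {\<Phi>. \<Union>\<Phi> \<inter> C \<noteq> {}}"

lemma low_subset_high: "low_points Q \<subseteq> high_points Q"
  by (auto simp: low_points_def high_points_def)

lemma points_subset: "high_points Q \<subseteq> fst ` Q"
  by (force simp: high_points_def)

lemma finite_points: "finite Q \<Longrightarrow> finite (high_points Q)" "finite Q \<Longrightarrow> finite (low_points Q)"
  using points_subset[of Q] low_subset_high[of Q] by (meson finite_imageI finite_subset)+

lemma simplicial_selection: "simplicial_on (Mult r k (low_points Q)) (Mult r' k' (high_points Q)) (lex_smallest k')"
  by (rule simplicial_on_Mult[OF par(2,4,5) low_subset_high])

lemma simplices_delete: "simplices (Mult s l (P - C)) p = simplices (Mult s l P) p - touching C"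
proof -
  have "\<Phi> \<in> Mult s l (P - C) \<longleftrightarrow> \<Phi> \<in> Mult s l P \<and> \<Phi> \<notin> touching C" for \<Phi>
    unfolding in_Mult_iff touching_def by blast
  then show ?thesis unfolding simplices_def by blast
qed

lemma finite_cells: "finite Q \<Longrightarrow> finite (low_cells Q)" "finite Q \<Longrightarrow> finite (high_cells Q)"
  unfolding low_cells_def high_cells_def simplices_def
  by (rule finite_subset[OF _ finite_Mult[OF finite_points(2)]], auto)
     (rule finite_subset[OF _ finite_Mult[OF finite_points(1)]], auto)

lemma betti_increment:
  assumes "finite Q"
  shows "real (labelled_betti Q) - real (labelled_betti (Q - C \<times> UNIV)) =
    trace_increment (lex_smallest k') (low_cells Q) (high_cells Q) (touching C) (touching C)"
proof -
  have l: "low_points (Q - C \<times> UNIV) = low_points Q - C" "high_points (Q - C \<times> UNIV) = high_points Q - C"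
    by (auto simp: low_points_def high_points_def)
  show ?thesis
    unfolding labelled_betti_def low_cells_def high_cells_def
    by (rule homology_rank_increment[OF finite_cells[OF assms, unfolded low_cells_def high_cells_def] simplicial_selection simplicial_selection])
       (simp_all only: l simplices_delete)
qed

lemma cells_mono: "Q \<subseteq> Q' \<Longrightarrow> low_cells Q \<subseteq> low_cells Q'" "Q \<subseteq> Q' \<Longrightarrow> high_cells Q \<subseteq> high_cells Q'"
proof -
  assume "Q \<subseteq> Q'"
  then have "low_points Q \<subseteq> low_points Q'" "high_points Q \<subseteq> high_points Q'"
    by (auto simp: low_points_def high_points_def)
  then show "low_cells Q \<subseteq> low_cells Q'" "high_cells Q \<subseteq> high_cells Q'"
    unfolding low_cells_def high_cells_def simplices_def using Mult_mono by blast+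
qed

text \<open>Simplices have diameter at most \<open>2 T\<close>; the summand \<open>1\<close> accounts for passing from points to their cells.\<close>
definition reach :: nat where "reach = 2 * T + 1"

definition nearby :: "int ^ 'n::finite \<Rightarrow> (int ^ 'n::finite \<Rightarrow> 'n::finite labelled set) \<Rightarrow> (real ^ 'n::finite) set" where
  "nearby c \<omega> = fst ` (\<Union>z\<in>lattice_ball reach. move (embed (z + c)) (\<omega> (z + c)))"

text \<open>A simplex that meets the cell \<open>c\<close> has all its points at distance at most \<open>2 T\<close> from a point of this cell.\<close>
lemma touching_local:
  fixes \<omega> :: "int ^ 'n::{finite,linorder} \<Rightarrow> 'n::{finite,linorder} labelled set"
  assumes \<omega>: "\<And>z. \<omega> z \<in> cell_configurations"
    and \<Phi>: "\<Phi> \<in> Mult s l P" "P \<subseteq> high_points (assemble W \<omega>)" "s \<le> real T" "\<Phi> \<in> touching (cell c)"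
  shows "\<Phi> \<subseteq> Pow (nearby c \<omega>)"
proof -
  obtain x where x: "x \<in> \<Union>\<Phi>" "x \<in> cell c" using \<Phi>(4) unfolding touching_def by blast
  have U: "\<Union>\<Phi> \<subseteq> P" "covered s (\<Union>\<Phi>)" using \<Phi>(1) unfolding in_Mult_iff by simp_all
  have "y \<in> nearby c \<omega>" if y: "y \<in> \<Union>\<Phi>" for y
  proof -
    have "dist y x \<le> real (2 * T)" using covered_dist[OF U(2) y x(1)] \<Phi>(3) by simp
    moreover obtain p where p: "p \<in> assemble W \<omega>" "y = fst p"
      using U(1) \<Phi>(2) y points_subset[of "assemble W \<omega>"] by blast
    ultimately have "\<exists>z\<in>lattice_ball (2 * T + 1). p \<in> move (embed (z + c)) (\<omega> (z + c))"
      by (intro near_cells[OF \<omega> p(1) x(2)]) simp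
    then show ?thesis unfolding nearby_def reach_def p(2) by blast
  qed
  then show ?thesis by blast
qed

lemma finite_nearby: "(\<And>z. \<omega> z \<in> cell_configurations) \<Longrightarrow> finite (nearby c \<omega>)"
  unfolding nearby_def cell_configurations_def
  by (intro finite_imageI finite_UN_I finite_lattice_ball finite_move) blast

lemma card_nearby: 
  assumes "\<And>z. \<omega> z \<in> cell_configurations"
  shows "card (nearby c \<omega>) \<le> (\<Sum>z\<in>lattice_ball reach. card (\<omega> (z + c)))"
proof -
  let ?U = "\<Union>z\<in>lattice_ball reach. move (embed (z + c)) (\<omega> (z + c))"
  have f: "finite (\<omega> z)" for z using assms unfolding cell_configurations_def by blast
  have "card (nearby c \<omega>) \<le> card ?U"
    unfolding nearby_def by (rule card_image_le) (auto simp: finite_lattice_ball f intro!: finite_move)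
  also have "\<dots> \<le> (\<Sum>z\<in>lattice_ball reach. card (move (embed (z + c)) (\<omega> (z + c))))"
    by (rule card_UN_le[OF finite_lattice_ball])
  also have "\<dots> \<le> (\<Sum>z\<in>lattice_ball reach. card (\<omega> (z + c)))"
    unfolding move_def by (intro sum_mono card_image_le f)
  finally show ?thesis .
qed

lemma card_simplices_le:
  assumes "finite P" "\<And>\<Phi>. \<Phi> \<in> A \<Longrightarrow> \<Phi> \<subseteq> Pow P \<and> card \<Phi> = m"
  shows "card A \<le> 2 ^ (card P * m)" "finite A"
proof -
  have sub: "A \<subseteq> {\<Phi>. \<Phi> \<subseteq> Pow P \<and> card \<Phi> = m}" using assms(2) by blast
  have fin: "finite {\<Phi>. \<Phi> \<subseteq> Pow P \<and> card \<Phi> = m}"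
    by (rule finite_subset[of _ "Pow (Pow P)"]) (use assms(1) in auto)
  show "finite A" by (rule finite_subset[OF sub fin])
  have "card A \<le> card {\<Phi>. \<Phi> \<subseteq> Pow P \<and> card \<Phi> = m}" by (rule card_mono[OF fin sub])
  also have "\<dots> = card (Pow P) choose m" by (rule n_subsets) (use assms(1) in simp)
  also have "\<dots> \<le> card (Pow P) ^ m"
    by (cases "m \<le> card (Pow P)") (simp_all add: binomial_le_pow binomial_eq_0)
  also have "card (Pow P) = 2 ^ card P" by (rule card_Pow[OF assms(1)])
  finally show "card A \<le> 2 ^ (card P * m)" by (simp add: power_mult)
qed

lemma local_cells:
  fixes \<omega> :: "int ^ 'n::{finite,linorder} \<Rightarrow> 'n::{finite,linorder} labelled set"
  assumes \<omega>: "\<And>z. \<omega> z \<in> cell_configurations"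
  shows "\<Phi> \<in> low_cells (assemble W \<omega>) \<inter> touching (cell c) \<Longrightarrow> \<Phi> \<subseteq> Pow (nearby c \<omega>) \<and> card \<Phi> = q + 1"
    and "\<Phi> \<in> high_cells (assemble W \<omega>) \<inter> touching (cell c) \<Longrightarrow> \<Phi> \<subseteq> Pow (nearby c \<omega>) \<and> card \<Phi> = q + 2"
proof -
  assume \<Phi>: "\<Phi> \<in> low_cells (assemble W \<omega>) \<inter> touching (cell c)"
  have "\<Phi> \<subseteq> Pow (nearby c \<omega>)"
    by (rule touching_local[OF \<omega>, where s = r and l = k and P = "low_points (assemble W \<omega>)" and W = W])
       (use \<Phi> low_subset_high par in \<open>auto simp: low_cells_def simplices_def\<close>)
  then show "\<Phi> \<subseteq> Pow (nearby c \<omega>) \<and> card \<Phi> = q + 1" using \<Phi> by (simp add: low_cells_def simplices_def)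
next
  assume \<Phi>: "\<Phi> \<in> high_cells (assemble W \<omega>) \<inter> touching (cell c)"
  have "\<Phi> \<subseteq> Pow (nearby c \<omega>)"
    by (rule touching_local[OF \<omega>, where s = r' and l = k' and P = "high_points (assemble W \<omega>)" and W = W])
       (use \<Phi> par in \<open>auto simp: high_cells_def simplices_def\<close>)
  then show "\<Phi> \<subseteq> Pow (nearby c \<omega>) \<and> card \<Phi> = q + 2" using \<Phi> by (simp add: high_cells_def simplices_def)
qed

text \<open>There are at most \<open>2 ^ (N * m)\<close> simplices with \<open>m\<close> vertices on \<open>N\<close> points, and the dimensions \<open>q\<close> and \<open>q + 1\<close> both contribute.\<close>
definition increment_bound :: "(int ^ 'n::{finite,linorder} \<Rightarrow> 'n::{finite,linorder} labelled set) \<Rightarrow> real" where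
  "increment_bound \<omega> = 2 * 2 ^ ((\<Sum>z\<in>lattice_ball reach. card (\<omega> z)) * (q + 2))"

lemma betti_increment_bound:
  fixes \<omega> :: "int ^ 'n::{finite,linorder} \<Rightarrow> 'n::{finite,linorder} labelled set"
  assumes \<omega>: "\<And>z. \<omega> z \<in> cell_configurations" and W: "finite W"
  shows "\<bar>real (labelled_betti (assemble W \<omega>)) - real (labelled_betti (assemble (W - {c}) \<omega>))\<bar> \<le> increment_bound (\<lambda>z. \<omega> (z + c))"
proof -
  let ?N = "\<Sum>z\<in>lattice_ball reach. card (\<omega> (z + c))"
  have le: "2 ^ (card (nearby c \<omega>) * m) \<le> (2 :: nat) ^ (?N * (q + 2))" if "m \<le> q + 2" for m
    by (rule power_increasing[OF mult_le_mono[OF card_nearby[OF \<omega>] that]]) simp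
  have fin: "finite (assemble W \<omega>)" by (rule finite_assemble[OF W \<omega>])
  have "\<bar>real (labelled_betti (assemble W \<omega>)) - real (labelled_betti (assemble (W - {c}) \<omega>))\<bar>
      \<le> real (card (low_cells (assemble W \<omega>) \<inter> touching (cell c))) + real (card (high_cells (assemble W \<omega>) \<inter> touching (cell c)))"
    unfolding assemble_delete[OF \<omega>] betti_increment[OF fin]
    by (rule abs_trace_increment_le[OF finite_cells[OF fin]])
  also have "\<dots> \<le> 2 ^ (?N * (q + 2)) + 2 ^ (?N * (q + 2))"
  proof (rule add_mono)
    have "card (low_cells (assemble W \<omega>) \<inter> touching (cell c)) \<le> 2 ^ (?N * (q + 2))"
      by (rule order_trans[OF card_simplices_le(1)[OF finite_nearby[OF \<omega>] local_cells(1)[where W = W and c = c, OF \<omega>]] le]) simp_all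
    then show "real (card (low_cells (assemble W \<omega>) \<inter> touching (cell c))) \<le> 2 ^ (?N * (q + 2))"
      by (simp flip: of_nat_le_iff)
    have "card (high_cells (assemble W \<omega>) \<inter> touching (cell c)) \<le> 2 ^ (?N * (q + 2))"
      by (rule order_trans[OF card_simplices_le(1)[OF finite_nearby[OF \<omega>] local_cells(2)[where W = W and c = c, OF \<omega>]] le]) simp_all
    then show "real (card (high_cells (assemble W \<omega>) \<inter> touching (cell c))) \<le> 2 ^ (?N * (q + 2))"
      by (simp flip: of_nat_le_iff)
  qed
  finally show ?thesis unfolding increment_bound_def by simp
qed

lemma finite_subset_lattice_ball:
  fixes W :: "(int ^ 'n::finite) set"
  assumes "finite W"
  shows "\<exists>R. W \<subseteq> lattice_ball R"
proof -
  define R where "R = Max (insert 0 ((\<lambda>(z, i). nat \<bar>z $ i\<bar>) ` (W \<times> UNIV)))"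
  have "z \<in> lattice_ball R" if "z \<in> W" for z
  proof -
    have "nat \<bar>z $ i\<bar> \<le> R" for i
      unfolding R_def by (rule Max_ge) (use assms that in \<open>auto intro!: image_eqI[of _ _ "(z, i)"]\<close>)
    then show ?thesis by (simp add: lattice_ball_def nat_le_iff)
  qed
  then show ?thesis by blast
qed

text \<open>Larger windows only add simplices, and those that meet the cell at the origin come from a fixed finite supply; apply \<open>trace_increment_stabilizes\<close>.\<close>
lemma betti_stabilizes:
  fixes \<omega> :: "int ^ 'n::{finite,linorder} \<Rightarrow> 'n::{finite,linorder} labelled set"
  assumes \<omega>: "\<And>z. \<omega> z \<in> cell_configurations"
  shows "\<exists>R. \<forall>W W'. finite W \<longrightarrow> finite W' \<longrightarrow> lattice_ball R \<subseteq> W \<longrightarrow> lattice_ball R \<subseteq> W' \<longrightarrow>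
    real (labelled_betti (assemble W \<omega>)) - real (labelled_betti (assemble (W - {0}) \<omega>)) =
    real (labelled_betti (assemble W' \<omega>)) - real (labelled_betti (assemble (W' - {0}) \<omega>))"
proof -
  let ?S = "touching (cell 0 :: (real ^ 'n::{finite,linorder}) set)"
  let ?I = "\<lambda>W. trace_increment (lex_smallest k') (low_cells (assemble W \<omega>)) (high_cells (assemble W \<omega>)) ?S ?S"
  have mono: "assemble W \<omega> \<subseteq> assemble W' \<omega>" if "W \<subseteq> W'" for W W'
    using that unfolding assemble_def by blast
  have "\<exists>W0. finite W0 \<and> (\<forall>W. finite W \<longrightarrow> W0 \<subseteq> W \<longrightarrow> ?I W = ?I W0)"
  proof (rule trace_increment_stabilizes)
    show "finite (\<Union>W\<in>Collect finite. low_cells (assemble W \<omega>) \<inter> ?S)"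
    proof (rule card_simplices_le(2)[where m = "q + 1" and P = "nearby 0 \<omega>", OF finite_nearby[OF \<omega>]])
      fix \<Phi> assume "\<Phi> \<in> (\<Union>W\<in>Collect finite. low_cells (assemble W \<omega>) \<inter> ?S)"
      then obtain W where "\<Phi> \<in> low_cells (assemble W \<omega>) \<inter> ?S" by blast
      then show "\<Phi> \<subseteq> Pow (nearby 0 \<omega>) \<and> card \<Phi> = q + 1" by (rule local_cells(1)[OF \<omega>])
    qed
    show "finite (\<Union>W\<in>Collect finite. high_cells (assemble W \<omega>) \<inter> ?S)"
    proof (rule card_simplices_le(2)[where m = "q + 2" and P = "nearby 0 \<omega>", OF finite_nearby[OF \<omega>]])
      fix \<Phi> assume "\<Phi> \<in> (\<Union>W\<in>Collect finite. high_cells (assemble W \<omega>) \<inter> ?S)"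
      then obtain W where "\<Phi> \<in> high_cells (assemble W \<omega>) \<inter> ?S" by blast
      then show "\<Phi> \<subseteq> Pow (nearby 0 \<omega>) \<and> card \<Phi> = q + 2" by (rule local_cells(2)[OF \<omega>])
    qed
  qed (rule cells_mono[OF mono], assumption)+
  then obtain W0 where W0: "finite W0" "\<And>W. finite W \<Longrightarrow> W0 \<subseteq> W \<Longrightarrow> ?I W = ?I W0" by blast
  obtain R where R: "W0 \<subseteq> lattice_ball R" using finite_subset_lattice_ball[OF W0(1)] by blast
  have "real (labelled_betti (assemble W \<omega>)) - real (labelled_betti (assemble (W - {0}) \<omega>)) = ?I W0" if "finite W" "lattice_ball R \<subseteq> W" for W
    unfolding assemble_delete[OF \<omega>] betti_increment[OF finite_assemble[OF that(1) \<omega>]]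
    by (rule W0(2)[OF that(1) order_trans[OF R that(2)]])
  then show ?thesis by (intro exI[of _ R]) simp
qed

lemma betti_move:
  fixes Q :: "'n::{finite,linorder} labelled set"
  assumes "finite Q"
  shows "labelled_betti (move v Q) = labelled_betti Q"
proof -
  let ?g = "\<lambda>x :: real ^ 'n::{finite,linorder}. x + v"
  have pts: "low_points (move v Q) = ?g ` low_points Q" "high_points (move v Q) = ?g ` high_points Q"
    by (force simp: low_points_def high_points_def move_def)+
  have sh: "shape_preserving s ?g P" for s P
    unfolding shape_preserving_def
  proof (intro allI impI iffI)
    fix \<sigma> :: "(real ^ 'n::{finite,linorder}) set"
    show "covered s \<sigma>" if c: "covered s (?g ` \<sigma>)"
    proof -
      obtain y where "\<forall>x\<in>?g ` \<sigma>. dist y x \<le> s" using c unfolding covered_def by blast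
      then have "\<forall>x\<in>\<sigma>. dist (y - v) x \<le> s" by (auto simp: dist_norm algebra_simps)
      then show ?thesis unfolding covered_def by blast
    qed
    show "covered s (?g ` \<sigma>)" if c: "covered s \<sigma>"
    proof -
      obtain y where "\<forall>x\<in>\<sigma>. dist y x \<le> s" using c unfolding covered_def by blast
      then have "\<forall>x\<in>?g ` \<sigma>. dist (y + v) x \<le> s" by (auto simp: dist_norm algebra_simps)
      then show ?thesis unfolding covered_def by blast
    qed
  qed
  show ?thesis
    unfolding labelled_betti_def pts
    by (rule multicover_rank_invariant[OF par(2,4,5) low_subset_high finite_points(1)[OF assms] _ sh sh])
       (auto simp: inj_on_def lex_less_def)
qed

end

section \<open>Functionals of random finite sets\<close>

text \<open>Only void events are required to be measurable; counting variables and more general functionals are recovered from them below.\<close>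
definition random_finite_set :: "'w measure \<Rightarrow> ('w \<Rightarrow> 'a::topological_space set) \<Rightarrow> bool" where
  "random_finite_set M Q \<longleftrightarrow> (\<forall>\<omega>\<in>space M. finite (Q \<omega>)) \<and>
     (\<forall>U\<in>sets borel. {\<omega>\<in>space M. Q \<omega> \<inter> U = {}} \<in> sets M)"

lemma finite_separation:
  fixes A :: "'a::metric_space set"
  assumes "finite A"
  shows "\<exists>e>0. \<forall>x\<in>A. \<forall>y\<in>A. x \<noteq> y \<longrightarrow> e \<le> dist x y"
  using assms
proof (induction A)
  case empty
  then show ?case by (intro exI[of _ 1]) simp
next
  case (insert a A)
  obtain e where e: "e > 0" "\<forall>x\<in>A. \<forall>y\<in>A. x \<noteq> y \<longrightarrow> e \<le> dist x y" using insert.IH by blast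
  obtain d where d: "d > 0" "\<forall>x\<in>A. x \<noteq> a \<longrightarrow> d \<le> dist a x" using finite_set_avoid[OF insert.hyps(1), of a] by blast
  show ?case
  proof (intro exI[of _ "min d e"] conjI ballI impI)
    fix x y assume "x \<in> insert a A" "y \<in> insert a A" "x \<noteq> y"
    then consider "x \<in> A" "y \<in> A" | "x = a" "y \<in> A" | "x \<in> A" "y = a" by blast
    then show "min d e \<le> dist x y"
    proof cases
      case 1 then show ?thesis using e \<open>x \<noteq> y\<close> by (simp add: min.coboundedI2)
    next
      case 2 then show ?thesis using d \<open>x \<noteq> y\<close> by (simp add: min.coboundedI1)
    next
      case 3
      then have "d \<le> dist a x" using d \<open>x \<noteq> y\<close> by simp
      then show ?thesis unfolding 3(2) dist_commute[of x a] by (rule min.coboundedI1)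
    qed
  qed (use d e in simp)
qed

text \<open>Distinct points of a finite set have disjoint basic neighbourhoods. Since a countable basis has countably many finite subfamilies, this expresses the number of points by void events.\<close>
lemma card_ge_iff_separated_hits:
  fixes A :: "'a::{metric_space, second_countable_topology} set"
  assumes B: "topological_basis B" and A: "finite A"
  shows "k \<le> card A \<longleftrightarrow> (\<exists>\<D>\<subseteq>B. finite \<D> \<and> card \<D> = k \<and> disjoint \<D> \<and> (\<forall>D\<in>\<D>. A \<inter> D \<noteq> {}))"
proof
  assume "k \<le> card A"
  then obtain A' where A': "A' \<subseteq> A" "card A' = k" "finite A'" using A by (meson obtain_subset_with_card_n)
  obtain e where e: "e > 0" "\<forall>x\<in>A'. \<forall>y\<in>A'. x \<noteq> y \<longrightarrow> e \<le> dist x y" using finite_separation[OF A'(3)] by blast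
  have "\<forall>x\<in>A'. \<exists>b\<in>B. x \<in> b \<and> b \<subseteq> ball x (e / 2)"
  proof
    fix x assume "x \<in> A'"
    have "x \<in> ball x (e / 2)" using e(1) by simp
    then obtain b where "b \<in> B" "x \<in> b" "b \<subseteq> ball x (e / 2)"
      by (rule topological_basisE[OF B open_ball])
    then show "\<exists>b\<in>B. x \<in> b \<and> b \<subseteq> ball x (e / 2)" by blast
  qed
  then obtain b where b: "\<And>x. x \<in> A' \<Longrightarrow> b x \<in> B \<and> x \<in> b x \<and> b x \<subseteq> ball x (e / 2)" by metis
  have sep: "b x \<inter> b y = {}" if xy: "x \<in> A'" "y \<in> A'" "x \<noteq> y" for x y
  proof (rule ccontr)
    assume "b x \<inter> b y \<noteq> {}"
    then obtain u where "u \<in> b x" "u \<in> b y" by blast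
    then have "u \<in> ball x (e / 2)" "u \<in> ball y (e / 2)" using b[OF xy(1)] b[OF xy(2)] by blast+
    then have "dist x y < e" using dist_triangle2[of x y u] by simp
    moreover have "e \<le> dist x y" using e(2) xy by blast
    ultimately show False by simp
  qed
  have inj: "inj_on b A'"
  proof (rule inj_onI, rule ccontr)
    fix x y assume "x \<in> A'" "y \<in> A'" "b x = b y" "x \<noteq> y"
    then show False using sep[of x y] b[of x] by blast
  qed
  show "\<exists>\<D>\<subseteq>B. finite \<D> \<and> card \<D> = k \<and> disjoint \<D> \<and> (\<forall>D\<in>\<D>. A \<inter> D \<noteq> {})"
  proof (intro exI[of _ "b ` A'"] conjI)
    show "b ` A' \<subseteq> B" using b by blast
    show "finite (b ` A')" using A'(3) by simp
    show "card (b ` A') = k" using card_image[OF inj] A'(2) by simp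
    show "disjoint (b ` A')" unfolding disjoint_def using sep by blast
    show "\<forall>D\<in>b ` A'. A \<inter> D \<noteq> {}" using b A'(1) by blast
  qed
next
  assume "\<exists>\<D>\<subseteq>B. finite \<D> \<and> card \<D> = k \<and> disjoint \<D> \<and> (\<forall>D\<in>\<D>. A \<inter> D \<noteq> {})"
  then obtain \<D> where \<D>: "finite \<D>" "card \<D> = k" "disjoint \<D>" "\<forall>D\<in>\<D>. A \<inter> D \<noteq> {}" by (elim exE conjE)
  have "\<forall>D\<in>\<D>. \<exists>x. x \<in> A \<inter> D" using \<D>(4) by (simp only: ex_in_conv simp_thms)
  then obtain p where p': "\<forall>D\<in>\<D>. p D \<in> A \<inter> D" by (rule bchoice[THEN exE])
  have p: "p D \<in> A" "p D \<in> D" if "D \<in> \<D>" for D using bspec[OF p' that] by simp_all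
  have "inj_on p \<D>"
  proof (rule inj_onI, rule ccontr)
    fix D D' assume *: "D \<in> \<D>" "D' \<in> \<D>" "p D = p D'" "D \<noteq> D'"
    then have "D \<inter> D' = {}" using \<D>(3) unfolding disjoint_def by simp
    moreover have "p D \<in> D" "p D \<in> D'" using p(2)[OF *(1)] p(2)[OF *(2)] *(3) by simp_all
    ultimately show False by (simp add: disjoint_iff)
  qed
  moreover have "p ` \<D> \<subseteq> A" using p(1) by (rule image_subsetI)
  ultimately have "card \<D> \<le> card A" by (rule card_inj_on_le[OF _ _ A])
  then show "k \<le> card A" using \<D>(2) by simp
qed

lemma card_Int_measurable:
  fixes Q :: "'w \<Rightarrow> 'a::{metric_space, second_countable_topology} set"
  assumes Q: "random_finite_set M Q" and U: "U \<in> sets borel"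
  shows "(\<lambda>\<omega>. real (card (Q \<omega> \<inter> U))) \<in> borel_measurable M"
proof -
  obtain B :: "'a set set" where B: "countable B" "topological_basis B" using ex_countable_basis by blast
  have ge: "{\<omega>\<in>space M. k \<le> card (Q \<omega> \<inter> U)} \<in> sets M" for k
  proof -
    define \<C> where "\<C> = {\<D>. finite \<D> \<and> \<D> \<subseteq> B \<and> card \<D> = k \<and> disjoint \<D>}"
    have c: "countable \<C>"
      unfolding \<C>_def by (rule countable_subset[OF _ countable_Collect_finite_subset[OF B(1)]]) blast
    have eq: "{\<omega>\<in>space M. k \<le> card (Q \<omega> \<inter> U)} = (\<Union>\<D>\<in>\<C>. {\<omega>\<in>space M. \<forall>D\<in>\<D>. Q \<omega> \<inter> (U \<inter> D) \<noteq> {}})"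
    proof (rule Set.set_eqI)
      fix \<omega>
      have "k \<le> card (Q \<omega> \<inter> U) \<longleftrightarrow> (\<exists>\<D>\<in>\<C>. \<forall>D\<in>\<D>. Q \<omega> \<inter> (U \<inter> D) \<noteq> {})" if "\<omega> \<in> space M"
      proof -
        have f: "finite (Q \<omega> \<inter> U)" using Q that unfolding random_finite_set_def by blast
        show ?thesis unfolding card_ge_iff_separated_hits[OF B(2) f] \<C>_def Int_assoc Bex_def mem_Collect_eq
          by (rule ex_cong1) (rule iffI; simp)
      qed
      then show "\<omega> \<in> {\<omega>\<in>space M. k \<le> card (Q \<omega> \<inter> U)} \<longleftrightarrow> \<omega> \<in> (\<Union>\<D>\<in>\<C>. {\<omega>\<in>space M. \<forall>D\<in>\<D>. Q \<omega> \<inter> (U \<inter> D) \<noteq> {}})"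
        by blast
    qed
    have m: "{\<omega>\<in>space M. \<forall>D\<in>\<D>. Q \<omega> \<inter> (U \<inter> D) \<noteq> {}} \<in> sets M" if "\<D> \<in> \<C>" for \<D>
    proof (rule sets.sets_Collect_finite_All)
      show "finite \<D>" using that by (simp add: \<C>_def)
      fix D assume "D \<in> \<D>"
      then have "open D" using that topological_basis_open[OF B(2)] unfolding \<C>_def by blast
      then have "U \<inter> D \<in> sets borel" using U by auto
      then have "{\<omega>\<in>space M. Q \<omega> \<inter> (U \<inter> D) = {}} \<in> sets M" using Q unfolding random_finite_set_def by blast
      then show "{\<omega>\<in>space M. Q \<omega> \<inter> (U \<inter> D) \<noteq> {}} \<in> sets M" by (rule sets.sets_Collect_neg)
    qed
    show ?thesis unfolding eq by (rule sets.countable_UN'[OF c]) (use m in blast)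
  qed
  have "(\<lambda>\<omega>. card (Q \<omega> \<inter> U)) \<in> measurable M (count_space UNIV)"
  proof (rule measurable_count_space_eq2_countable[THEN iffD2], intro conjI ballI)
    fix k :: nat
    have "(\<lambda>\<omega>. card (Q \<omega> \<inter> U)) -` {k} \<inter> space M = {\<omega>\<in>space M. k \<le> card (Q \<omega> \<inter> U)} - {\<omega>\<in>space M. Suc k \<le> card (Q \<omega> \<inter> U)}"
      by auto
    then show "(\<lambda>\<omega>. card (Q \<omega> \<inter> U)) -` {k} \<inter> space M \<in> sets M" using ge by auto
  qed auto
  then show ?thesis by (rule measurable_compose) simp
qed

text \<open>On rectangles the count is a product of numbers of points, and the general case follows from rectangles by an induction over the \<open>\<sigma>\<close>-algebra with disjoint unions.\<close>
lemma tuple_count_measurable: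
  fixes Q :: "'w \<Rightarrow> 'a::{metric_space, second_countable_topology} set"
  assumes Q: "random_finite_set M Q" and C: "C \<in> sets (Pi\<^sub>M {..<k :: nat} (\<lambda>_. borel :: 'a measure))"
  shows "(\<lambda>\<omega>. real (card ((\<Pi>\<^sub>E i\<in>{..<k}. Q \<omega>) \<inter> C))) \<in> borel_measurable M"
proof -
  let ?G = "prod_algebra {..<k} (\<lambda>_. borel :: 'a measure)"
  let ?\<Omega> = "\<Pi>\<^sub>E i\<in>{..<k}. space (borel :: 'a measure)"
  define N where "N C \<omega> = real (card ((\<Pi>\<^sub>E i\<in>{..<k}. Q \<omega>) \<inter> C))" for C \<omega>
  have finD: "finite (\<Pi>\<^sub>E i\<in>{..<k}. Q \<omega>)" if "\<omega> \<in> space M" for \<omega>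
    using Q that unfolding random_finite_set_def by (intro finite_PiE) auto
  have rect: "N (\<Pi>\<^sub>E i\<in>{..<k}. X i) \<in> borel_measurable M" if "\<And>i. i < k \<Longrightarrow> X i \<in> sets borel" for X
  proof -
    have "N (\<Pi>\<^sub>E i\<in>{..<k}. X i) = (\<lambda>\<omega>. \<Prod>i<k. real (card (Q \<omega> \<inter> X i)))"
      unfolding N_def PiE_Int by (simp add: card_PiE fun_eq_iff)
    then show ?thesis using card_Int_measurable[OF Q that] by (simp add: borel_measurable_prod)
  qed
  have "C \<in> sigma_sets ?\<Omega> ?G" using C by (simp add: sets_PiM)
  from Int_stable_prod_algebra prod_algebra_sets_into_space this
  have "N C \<in> borel_measurable M"
  proof (induction rule: sigma_sets_induct_disjoint)
    case (basic A)
    then obtain X where "A = (\<Pi>\<^sub>E i\<in>{..<k}. X i)" "X \<in> (\<Pi> j\<in>{..<k}. sets (borel :: 'a measure))"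
      unfolding prod_algebra_eq_finite[OF finite_lessThan] by blast
    then show ?case using rect[of X] by (simp add: Pi_iff)
  next
    case empty
    then show ?case by (simp add: N_def[abs_def])
  next
    case (compl A)
    have "N (?\<Omega> - A) \<omega> = N ?\<Omega> \<omega> - N A \<omega>" if "\<omega> \<in> space M" for \<omega>
    proof -
      let ?D = "\<Pi>\<^sub>E i\<in>{..<k}. Q \<omega>"
      have "?D \<inter> ?\<Omega> = ?D" by auto
      moreover have "?D \<inter> (?\<Omega> - A) = ?D - ?D \<inter> A" by auto
      moreover have "card (?D - ?D \<inter> A) = card ?D - card (?D \<inter> A)"
        by (rule card_Diff_subset) (use finD[OF that] in auto)
      moreover have "card (?D \<inter> A) \<le> card ?D" by (rule card_mono[OF finD[OF that]]) simp
      ultimately show ?thesis unfolding N_def by (simp add: of_nat_diff)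
    qed
    moreover have "(\<lambda>\<omega>. N ?\<Omega> \<omega> - N A \<omega>) \<in> borel_measurable M"
      using rect[of "\<lambda>_. UNIV"] compl(2) by (intro borel_measurable_diff) simp_all
    ultimately show ?case by (simp cong: measurable_cong)
  next
    case (union A)
    have "N (\<Union>i. A i) \<omega> = suminf (\<lambda>i. N (A i) \<omega>)" if "\<omega> \<in> space M" for \<omega>
    proof -
      let ?D = "\<Pi>\<^sub>E i\<in>{..<k}. Q \<omega>"
      interpret finite_measure "count_space ?D" by (rule finite_measure_count_space[OF finD[OF that]])
      have m: "measure (count_space ?D) (?D \<inter> E) = N E \<omega>" for E
      proof -
        have "emeasure (count_space ?D) (?D \<inter> E) = of_nat (card (?D \<inter> E))"
          by (rule emeasure_count_space_finite) (use finD[OF that] in auto)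
        then show ?thesis by (simp add: N_def Sigma_Algebra.measure_def)
      qed
      have "(\<lambda>i. measure (count_space ?D) (?D \<inter> A i)) sums measure (count_space ?D) (\<Union>i. ?D \<inter> A i)"
        by (rule finite_measure_UNION) (use union(1) in \<open>auto simp: disjoint_family_on_def\<close>)
      then have "(\<lambda>i. N (A i) \<omega>) sums N (\<Union>i. A i) \<omega>" unfolding m Int_UN_distrib[symmetric] .
      then show ?thesis by (rule sums_unique)
    qed
    moreover have "(\<lambda>\<omega>. suminf (\<lambda>i. N (A i) \<omega>)) \<in> borel_measurable M" using union(3) by (intro borel_measurable_suminf)
    ultimately show ?case by (simp cong: measurable_cong)
  qed
  then show ?thesis unfolding N_def[abs_def] .
qed

text \<open>A set of \<open>k\<close> points has the value \<open>v\<close> if and only if some injective \<open>k\<close>-tuple of its points enumerates a set with this value; the number of such tuples is measurable.\<close>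
theorem random_set_functional_measurable:
  fixes Q :: "'w \<Rightarrow> 'a::{metric_space, second_countable_topology} set"
  assumes Q: "random_finite_set M Q"
    and h: "\<And>k :: nat. {y\<in>space (Pi\<^sub>M {..<k} (\<lambda>_. borel :: 'a measure)). h (y ` {..<k}) = v} \<in> sets (Pi\<^sub>M {..<k} (\<lambda>_. borel))"
  shows "{\<omega>\<in>space M. h (Q \<omega>) = v} \<in> sets M"
proof -
  let ?T = "\<lambda>k :: nat. Pi\<^sub>M {..<k} (\<lambda>_. borel :: 'a measure)"
  define C where "C k = {y\<in>space (?T k). inj_on y {..<k} \<and> h (y ` {..<k}) = v}" for k
  have C: "C k \<in> sets (?T k)" for k
  proof -
    have 1: "C k = {y\<in>space (?T k). \<forall>i\<in>{..<k}. \<forall>j\<in>{..<k}. i \<noteq> j \<longrightarrow> y i \<noteq> y j} \<inter> {y\<in>space (?T k). h (y ` {..<k}) = v}"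
      unfolding C_def inj_on_def by blast
    have 2: "{y\<in>space (?T k). \<forall>i\<in>{..<k}. \<forall>j\<in>{..<k}. i \<noteq> j \<longrightarrow> y i \<noteq> y j} \<in> sets (?T k)"
    proof (intro sets.sets_Collect_finite_All finite_lessThan)
      fix i j assume ij: "i \<in> {..<k}" "j \<in> {..<k}"
      show "{y\<in>space (?T k). i \<noteq> j \<longrightarrow> y i \<noteq> y j} \<in> sets (?T k)"
      proof (cases "i = j")
        case False
        have "{y\<in>space (?T k). y i = y j} \<in> sets (?T k)"
          by (rule measurable_equality_set; rule measurable_component_singleton; rule ij)
        then have "{y\<in>space (?T k). y i \<noteq> y j} \<in> sets (?T k)" by (rule sets.sets_Collect_neg)
        then show ?thesis using False by simp
      qed simp
    qed
    show ?thesis unfolding 1 by (rule sets.Int[OF 2 h])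
  qed
  have eq: "h (Q \<omega>) = v \<longleftrightarrow> (\<exists>k. real (card (Q \<omega> \<inter> UNIV)) = real k \<and> real (card ((\<Pi>\<^sub>E i\<in>{..<k}. Q \<omega>) \<inter> C k)) \<noteq> 0)" if "\<omega> \<in> space M" for \<omega>
  proof -
    have f: "finite (Q \<omega>)" using Q that unfolding random_finite_set_def by blast
    have fD: "finite (\<Pi>\<^sub>E i\<in>{..<k}. Q \<omega>)" for k :: nat using f by (intro finite_PiE) auto
    show ?thesis
    proof
      assume hv: "h (Q \<omega>) = v"
      obtain y0 where y0: "bij_betw y0 {0..<card (Q \<omega>)} (Q \<omega>)" using ex_bij_betw_nat_finite[OF f] by blast
      define y where "y = restrict y0 {..<card (Q \<omega>)}"
      have y: "inj_on y {..<card (Q \<omega>)}" "y ` {..<card (Q \<omega>)} = Q \<omega>"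
        using y0 unfolding y_def bij_betw_def lessThan_atLeast0 by (auto simp: inj_on_restrict_eq)
      have "y \<in> (\<Pi>\<^sub>E i\<in>{..<card (Q \<omega>)}. Q \<omega>) \<inter> C (card (Q \<omega>))"
        using y hv unfolding C_def space_PiM by (auto simp: y_def)
      then have "card ((\<Pi>\<^sub>E i\<in>{..<card (Q \<omega>)}. Q \<omega>) \<inter> C (card (Q \<omega>))) \<noteq> 0" using fD by (auto simp: card_eq_0_iff)
      then show "\<exists>k. real (card (Q \<omega> \<inter> UNIV)) = real k \<and> real (card ((\<Pi>\<^sub>E i\<in>{..<k}. Q \<omega>) \<inter> C k)) \<noteq> 0" by auto
    next
      assume "\<exists>k. real (card (Q \<omega> \<inter> UNIV)) = real k \<and> real (card ((\<Pi>\<^sub>E i\<in>{..<k}. Q \<omega>) \<inter> C k)) \<noteq> 0"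
      then obtain k where k: "card (Q \<omega>) = k" "card ((\<Pi>\<^sub>E i\<in>{..<k}. Q \<omega>) \<inter> C k) \<noteq> 0" by auto
      then have "(\<Pi>\<^sub>E i\<in>{..<k}. Q \<omega>) \<inter> C k \<noteq> {}" by auto
      then obtain y where y: "y \<in> (\<Pi>\<^sub>E i\<in>{..<k}. Q \<omega>)" "y \<in> C k" by blast
      have "y ` {..<k} = Q \<omega>"
        by (rule card_subset_eq[OF f]) (use y k in \<open>auto simp: C_def card_image\<close>)
      then show "h (Q \<omega>) = v" using y(2) unfolding C_def by simp
    qed
  qed
  have "{\<omega>\<in>space M. h (Q \<omega>) = v} = (\<Union>k. {\<omega>\<in>space M. real (card (Q \<omega> \<inter> UNIV)) = real k} \<inter> {\<omega>\<in>space M. real (card ((\<Pi>\<^sub>E i\<in>{..<k}. Q \<omega>) \<inter> C k)) \<noteq> 0})"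
    (is "?L = ?R")
  proof (rule Set.set_eqI)
    fix \<omega>
    show "\<omega> \<in> ?L \<longleftrightarrow> \<omega> \<in> ?R" using eq[of \<omega>] by (cases "\<omega> \<in> space M") simp_all
  qed
  moreover have "{\<omega>\<in>space M. real (card (Q \<omega> \<inter> UNIV)) = real k} \<inter> {\<omega>\<in>space M. real (card ((\<Pi>\<^sub>E i\<in>{..<k}. Q \<omega>) \<inter> C k)) \<noteq> 0} \<in> sets M" for k
    by (intro sets.Int borel_measurable_eq borel_measurable_neq card_Int_measurable[OF Q] tuple_count_measurable[OF Q C]) auto
  ultimately show ?thesis by auto
qed

section \<open>Measurability of persistent Betti numbers\<close>

text \<open>By \<open>cech_radius_le_iff\<close> it is enough to find centres for all radii larger than \<open>r\<close>, and these may be taken in a countable dense set. This makes the condition measurable.\<close>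
lemma covered_iff_rational:
  fixes \<sigma> :: "(real ^ 'n) set"
  assumes \<sigma>: "finite \<sigma>" "\<sigma> \<noteq> {}" and D: "\<And>U :: (real ^ 'n) set. open U \<Longrightarrow> U \<noteq> {} \<Longrightarrow> \<exists>d\<in>D. d \<in> U"
  shows "covered r \<sigma> \<longleftrightarrow> (\<forall>m. \<exists>z\<in>D. \<forall>x\<in>\<sigma>. dist z x \<le> r + 1 / real (Suc m))"
proof
  assume "covered r \<sigma>"
  then obtain y where y: "\<forall>x\<in>\<sigma>. dist y x \<le> r" unfolding covered_def by blast
  show "\<forall>m. \<exists>z\<in>D. \<forall>x\<in>\<sigma>. dist z x \<le> r + 1 / real (Suc m)"
  proof
    fix m
    obtain z where z: "z \<in> D" "z \<in> ball y (1 / real (Suc m))"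
      using D[OF open_ball[of y "1 / real (Suc m)"]] by auto
    have "dist z x \<le> r + 1 / real (Suc m)" if "x \<in> \<sigma>" for x
    proof -
      have "dist z x \<le> dist z y + dist y x" by (rule dist_triangle)
      moreover have "dist z y < 1 / real (Suc m)" using z(2) by (simp add: dist_commute)
      moreover have "dist y x \<le> r" using y that by blast
      ultimately show ?thesis by linarith
    qed
    then show "\<exists>z\<in>D. \<forall>x\<in>\<sigma>. dist z x \<le> r + 1 / real (Suc m)" using z(1) by blast
  qed
next
  assume a: "\<forall>m. \<exists>z\<in>D. \<forall>x\<in>\<sigma>. dist z x \<le> r + 1 / real (Suc m)"
  have "cech_radius \<sigma> \<le> r + 1 / real (Suc m)" for m
    unfolding cech_radius_le_iff[OF \<sigma>] covered_def using spec[OF a, of m] by blast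
  moreover have "(\<lambda>m. r + 1 / real (Suc m)) \<longlonglongrightarrow> r + 0"
    by (intro tendsto_intros LIMSEQ_Suc[OF lim_1_over_n])
  ultimately have "cech_radius \<sigma> \<le> r + 0" by (intro LIMSEQ_le_const) auto
  then show "covered r \<sigma>" using cech_radius_le_iff[OF \<sigma>] by simp
qed

lemma sets_Collect_iff_const:
  "{y\<in>space M. P y} \<in> sets M \<Longrightarrow> {y\<in>space M. P y \<longleftrightarrow> b} \<in> sets M"
  by (cases b) (auto intro: sets.sets_Collect_neg)

lemma covered_measurable:
  fixes f :: "nat \<Rightarrow> 'w \<Rightarrow> real ^ 'n"
  assumes J: "finite J" and f: "\<And>i. i \<in> J \<Longrightarrow> f i \<in> borel_measurable M"
  shows "{y\<in>space M. covered r ((\<lambda>i. f i y) ` J)} \<in> sets M"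
proof (cases "J = {}")
  case True
  then show ?thesis by (simp add: covered_def)
next
  case False
  obtain D :: "(real ^ 'n) set" where D: "countable D" "\<And>U. open U \<Longrightarrow> U \<noteq> {} \<Longrightarrow> \<exists>d\<in>D. d \<in> U"
    using countable_dense_setE by blast
  have eq: "covered r ((\<lambda>i. f i y) ` J) \<longleftrightarrow> (\<forall>m. \<exists>z\<in>D. \<forall>i\<in>J. dist z (f i y) \<le> r + 1 / real (Suc m))" for y
    using covered_iff_rational[OF _ _ D(2), of "(\<lambda>i. f i y) ` J" r] J False by simp
  have "{y\<in>space M. dist z (f i y) \<le> c} \<in> sets M" if "i \<in> J" for z i c
    by (rule borel_measurable_le[OF borel_measurable_dist[OF borel_measurable_const f[OF that]] borel_measurable_const])
  then have "{y\<in>space M. \<forall>i\<in>J. dist z (f i y) \<le> c} \<in> sets M" for z c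
    by (intro sets.sets_Collect_finite_All J)
  then have "(\<Union>z\<in>D. {y\<in>space M. \<forall>i\<in>J. dist z (f i y) \<le> c}) \<in> sets M" for c
    by (intro sets.countable_UN'[OF D(1)]) blast
  moreover have "(\<Union>z\<in>D. {y\<in>space M. \<forall>i\<in>J. dist z (f i y) \<le> c}) = {y\<in>space M. \<exists>z\<in>D. \<forall>i\<in>J. dist z (f i y) \<le> c}" for c
    by blast
  ultimately show ?thesis
    unfolding eq by (intro sets.sets_Collect_countable_All) simp
qed

lemma lex_less_measurable:
  fixes f g :: "'w \<Rightarrow> real ^ 'n::{finite,linorder}"
  assumes f: "f \<in> borel_measurable M" and g: "g \<in> borel_measurable M"
  shows "{y\<in>space M. lex_less (f y) (g y)} \<in> sets M"
proof -
  have nth: "(\<lambda>y. h y $ i) \<in> borel_measurable M" if "h \<in> borel_measurable M" for h :: "'w \<Rightarrow> real ^ 'n::{finite,linorder}" and i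
    by (rule measurable_compose[OF that], rule borel_measurable_continuous_onI) (intro continuous_intros)
  have eq: "{y\<in>space M. lex_less (f y) (g y)} =
      (\<Union>i\<in>UNIV. {y\<in>space M. f y $ i < g y $ i} \<inter> {y\<in>space M. \<forall>j\<in>{..<i}. f y $ j = g y $ j})"
    unfolding lex_less_def by auto
  have "{y\<in>space M. \<forall>j\<in>{..<i}. f y $ j = g y $ j} \<in> sets M" for i
    by (intro sets.sets_Collect_finite_All finite borel_measurable_eq nth f g)
  then show ?thesis
    unfolding eq by (intro sets.finite_UN finite sets.Int borel_measurable_less nth f g)
qed

context multicover_parameters
begin

text \<open>All that a Betti number can see of a tuple of labelled points: labels, coincidences, order, and the subsets covered at the two radii. It takes finitely many values.\<close>
definition pattern :: "nat \<Rightarrow> (nat \<Rightarrow> 'n::{finite,linorder} labelled) \<Rightarrow>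
    nat set \<times> nat set \<times> (nat \<times> nat) set \<times> (nat \<times> nat) set \<times> nat set set \<times> nat set set" where
  "pattern m y = ({i. i < m \<and> snd (y i) = 0}, {i. i < m \<and> snd (y i) = 1},
     {(i, j). i < m \<and> j < m \<and> fst (y i) = fst (y j)}, {(i, j). i < m \<and> j < m \<and> lex_less (fst (y i)) (fst (y j))},
     {J. J \<subseteq> {..<m} \<and> covered r ((\<lambda>i. fst (y i)) ` J)}, {J. J \<subseteq> {..<m} \<and> covered r' ((\<lambda>i. fst (y i)) ` J)})"

text \<open>Equal patterns make \<open>x i \<mapsto> x' i\<close> a well defined bijection that preserves the lexicographic order and the covered subsets, so \<open>multicover_rank_invariant\<close> applies.\<close>
lemma pattern_determines_betti:
  fixes y y' :: "nat \<Rightarrow> 'n::{finite,linorder} labelled"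
  assumes eq: "pattern m y = pattern m y'"
  shows "labelled_betti (y ` {..<m}) = labelled_betti (y' ` {..<m})"
proof -
  define x where "x i = fst (y i)" for i
  define x' where "x' i = fst (y' i)" for i
  define A0 where "A0 = {i. i < m \<and> snd (y i) = 0}"
  define A1 where "A1 = {i. i < m \<and> snd (y i) = 1}"
  have A0': "A0 = {i. i < m \<and> snd (y' i) = 0}" and A1': "A1 = {i. i < m \<and> snd (y' i) = 1}"
    using eq unfolding pattern_def A0_def A1_def by (simp_all only: prod.inject)
  have E: "x i = x j \<longleftrightarrow> x' i = x' j" if "i < m" "j < m" for i j
  proof -
    have "{(i, j). i < m \<and> j < m \<and> fst (y i) = fst (y j)} = {(i, j). i < m \<and> j < m \<and> fst (y' i) = fst (y' j)}"
      using eq unfolding pattern_def by (simp only: prod.inject)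
    then have "(i, j) \<in> {(i, j). i < m \<and> j < m \<and> fst (y i) = fst (y j)} \<longleftrightarrow> (i, j) \<in> {(i, j). i < m \<and> j < m \<and> fst (y' i) = fst (y' j)}"
      by (simp only:)
    then show ?thesis using that unfolding x_def x'_def by simp
  qed
  have Lx: "lex_less (x i) (x j) \<longleftrightarrow> lex_less (x' i) (x' j)" if "i < m" "j < m" for i j
  proof -
    have "{(i, j). i < m \<and> j < m \<and> lex_less (fst (y i)) (fst (y j))} = {(i, j). i < m \<and> j < m \<and> lex_less (fst (y' i)) (fst (y' j))}"
      using eq unfolding pattern_def by (simp only: prod.inject)
    then have "(i, j) \<in> {(i, j). i < m \<and> j < m \<and> lex_less (fst (y i)) (fst (y j))} \<longleftrightarrow> (i, j) \<in> {(i, j). i < m \<and> j < m \<and> lex_less (fst (y' i)) (fst (y' j))}"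
      by (simp only:)
    then show ?thesis using that unfolding x_def x'_def by simp
  qed
  have cov: "covered r (x ` J) \<longleftrightarrow> covered r (x' ` J)" "covered r' (x ` J) \<longleftrightarrow> covered r' (x' ` J)" if "J \<subseteq> {..<m}" for J
  proof -
    have "{J. J \<subseteq> {..<m} \<and> covered r (x ` J)} = {J. J \<subseteq> {..<m} \<and> covered r (x' ` J)}"
      "{J. J \<subseteq> {..<m} \<and> covered r' (x ` J)} = {J. J \<subseteq> {..<m} \<and> covered r' (x' ` J)}"
      using eq unfolding pattern_def x_def[abs_def] x'_def[abs_def] by (simp_all only: prod.inject)
    then have "J \<in> {J. J \<subseteq> {..<m} \<and> covered r (x ` J)} \<longleftrightarrow> J \<in> {J. J \<subseteq> {..<m} \<and> covered r (x' ` J)}"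
      "J \<in> {J. J \<subseteq> {..<m} \<and> covered r' (x ` J)} \<longleftrightarrow> J \<in> {J. J \<subseteq> {..<m} \<and> covered r' (x' ` J)}" by (simp_all only:)
    then show "covered r (x ` J) \<longleftrightarrow> covered r (x' ` J)" "covered r' (x ` J) \<longleftrightarrow> covered r' (x' ` J)" using that by simp_all
  qed
  define A where "A = A0 \<union> A1"
  have Am: "A \<subseteq> {..<m}" "A0 \<subseteq> A" by (auto simp: A_def A0_def A1_def)
  have hit: "(p, t) \<in> u ` {..<m} \<longleftrightarrow> (\<exists>i<m. p = fst (u i) \<and> snd (u i) = t)" for u :: "nat \<Rightarrow> 'n labelled" and p t
  proof
    assume "(p, t) \<in> u ` {..<m}"
    then obtain i where "(p, t) = u i" "i \<in> {..<m}" by (rule imageE)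
    then show "\<exists>i<m. p = fst (u i) \<and> snd (u i) = t" by (intro exI[of _ i]) (simp flip: \<open>(p, t) = u i\<close>)
  next
    assume "\<exists>i<m. p = fst (u i) \<and> snd (u i) = t"
    then obtain i where "i < m" "(p, t) = u i" by (elim exE conjE) (simp add: prod_eq_iff)
    then show "(p, t) \<in> u ` {..<m}" by (intro image_eqI[of _ _ i]) simp_all
  qed
  have low: "low_points (u ` {..<m}) = (\<lambda>i. fst (u i)) ` {i. i < m \<and> snd (u i) = 0}" for u :: "nat \<Rightarrow> 'n labelled"
    unfolding low_points_def hit by blast
  have high: "high_points (u ` {..<m}) = (\<lambda>i. fst (u i)) ` ({i. i < m \<and> snd (u i) = 0} \<union> {i. i < m \<and> snd (u i) = 1})" for u :: "nat \<Rightarrow> 'n labelled"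
    unfolding high_points_def hit image_Un Collect_disj_eq by (intro arg_cong2[where f = "(\<union>)"]) blast+
  have pts: "low_points (y ` {..<m}) = x ` A0" "high_points (y ` {..<m}) = x ` A"
    unfolding low high A_def A0_def A1_def x_def by (rule refl)+
  have pts': "low_points (y' ` {..<m}) = x' ` A0" "high_points (y' ` {..<m}) = x' ` A"
    unfolding low high A_def A0' A1' x'_def by (rule refl)+
  \<comment> \<open>the choice of an index is harmless because both tuples have the same coincidences\<close>
  define g where "g p = x' (SOME i. i < m \<and> x i = p)" for p
  have gx: "g (x i) = x' i" if "i < m" for i
  proof -
    have s: "(SOME j. j < m \<and> x j = x i) < m \<and> x (SOME j. j < m \<and> x j = x i) = x i"
      by (rule someI[of "\<lambda>j. j < m \<and> x j = x i" i]) (use that in simp)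
    show ?thesis unfolding g_def by (rule iffD1[OF E[OF conjunct1[OF s] that] conjunct2[OF s]])
  qed
  have gI: "g ` x ` J = x' ` J" if "J \<subseteq> {..<m}" for J
    unfolding image_image by (rule image_cong[OF refl gx]) (use that in blast)
  have inj: "inj_on g (x ` A)"
  proof (rule inj_onI)
    fix p p' assume "p \<in> x ` A" "p' \<in> x ` A" "g p = g p'"
    obtain i where i: "p = x i" "i \<in> A" using \<open>p \<in> x ` A\<close> by (rule imageE)
    obtain j where j: "p' = x j" "j \<in> A" using \<open>p' \<in> x ` A\<close> by (rule imageE)
    have "i < m" "j < m" using Am(1) i(2) j(2) by auto
    have "x' i = x' j" using \<open>g p = g p'\<close> unfolding i(1) j(1) gx[OF \<open>i < m\<close>] gx[OF \<open>j < m\<close>] .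
    then show "p = p'" unfolding i(1) j(1) by (rule iffD2[OF E[OF \<open>i < m\<close> \<open>j < m\<close>]])
  qed
  have sh: "shape_preserving r g (x ` A)" "shape_preserving r' g (x ` A)"
  proof -
    have "(covered r (g ` \<sigma>) \<longleftrightarrow> covered r \<sigma>) \<and> (covered r' (g ` \<sigma>) \<longleftrightarrow> covered r' \<sigma>)" if \<sigma>: "\<sigma> \<subseteq> x ` A" for \<sigma>
    proof -
      obtain J where J: "J \<subseteq> A" "\<sigma> = x ` J" using \<sigma> unfolding subset_image_iff by blast
      have Jm: "J \<subseteq> {..<m}" using J(1) Am(1) by (rule order_trans)
      show ?thesis unfolding J(2) gI[OF Jm] using cov[OF Jm] by simp
    qed
    then show "shape_preserving r g (x ` A)" "shape_preserving r' g (x ` A)"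
      unfolding shape_preserving_def by simp_all
  qed
  have lx: "lex_less (g p) (g p') \<longleftrightarrow> lex_less p p'" if pp: "p \<in> x ` A" "p' \<in> x ` A" for p p'
  proof -
    obtain i where i: "p = x i" "i \<in> A" using pp(1) by (rule imageE)
    obtain j where j: "p' = x j" "j \<in> A" using pp(2) by (rule imageE)
    have "i < m" "j < m" using Am(1) i(2) j(2) by auto
    show ?thesis unfolding i(1) j(1) gx[OF \<open>i < m\<close>] gx[OF \<open>j < m\<close>] by (rule Lx[OF \<open>i < m\<close> \<open>j < m\<close>, symmetric])
  qed
  have fin: "finite (x ` A)" by (rule finite_imageI[OF finite_subset[OF Am(1) finite_lessThan]])
  have i1: "x' ` A0 = g ` x ` A0" and i2: "x' ` A = g ` x ` A" by (rule gI[symmetric], rule order_trans[OF Am(2,1)], rule gI[symmetric], rule Am(1))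
  show ?thesis
    unfolding labelled_betti_def pts pts' i1 i2
    by (rule multicover_rank_invariant[symmetric, OF par(2,4,5) image_mono[OF Am(2)] fin inj sh lx])
qed

lemma betti_tuple_measurable:
  "{y\<in>space (Pi\<^sub>M {..<m :: nat} (\<lambda>_. borel :: 'n::{finite,linorder} labelled measure)). labelled_betti (y ` {..<m}) = v}
     \<in> sets (Pi\<^sub>M {..<m} (\<lambda>_. borel))"
proof -
  let ?T = "Pi\<^sub>M {..<m :: nat} (\<lambda>_. borel :: 'n::{finite,linorder} labelled measure)"
  have f: "(\<lambda>y. fst (y i)) \<in> borel_measurable ?T" and s: "(\<lambda>y. snd (y i)) \<in> borel_measurable ?T" if "i < m" for i
    by (rule measurable_compose[OF measurable_component_singleton[of i "{..<m}"]],
        use that in simp, rule borel_measurable_continuous_onI, intro continuous_on_fst continuous_on_snd continuous_on_id)+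
  have level: "{y\<in>space ?T. pattern m y = pattern m y0} \<in> sets ?T" for y0
  proof -
    have coords: "{y\<in>space ?T. snd (y i) = c \<longleftrightarrow> snd (y0 i) = c} \<in> sets ?T" if "i \<in> {..<m}" for i and c :: real
      by (rule sets_Collect_iff_const, rule borel_measurable_eq) (use s that in simp_all)
    have same: "{y\<in>space ?T. fst (y i) = fst (y j) \<longleftrightarrow> fst (y0 i) = fst (y0 j)} \<in> sets ?T" if "i \<in> {..<m}" "j \<in> {..<m}" for i j
      by (rule sets_Collect_iff_const, rule measurable_equality_set) (use f that in simp_all)
    have lex: "{y\<in>space ?T. lex_less (fst (y i)) (fst (y j)) \<longleftrightarrow> lex_less (fst (y0 i)) (fst (y0 j))} \<in> sets ?T" if "i \<in> {..<m}" "j \<in> {..<m}" for i j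
      by (rule sets_Collect_iff_const, rule lex_less_measurable) (use f that in simp_all)
    have cov: "{y\<in>space ?T. covered t ((\<lambda>i. fst (y i)) ` J) \<longleftrightarrow> covered t ((\<lambda>i. fst (y0 i)) ` J)} \<in> sets ?T" if "J \<in> Pow {..<m}" for J t
    proof (rule sets_Collect_iff_const, rule covered_measurable)
      show "finite J" using that finite_subset[of J "{..<m}"] by simp
      show "(\<lambda>y. fst (y i)) \<in> borel_measurable ?T" if "i \<in> J" for i using f[of i] that \<open>J \<in> Pow {..<m}\<close> by blast
    qed
    have "{y\<in>space ?T. pattern m y = pattern m y0} = {y\<in>space ?T.
        (\<forall>i\<in>{..<m}. snd (y i) = 0 \<longleftrightarrow> snd (y0 i) = 0) \<and> (\<forall>i\<in>{..<m}. snd (y i) = 1 \<longleftrightarrow> snd (y0 i) = 1) \<and>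
        (\<forall>i\<in>{..<m}. \<forall>j\<in>{..<m}. fst (y i) = fst (y j) \<longleftrightarrow> fst (y0 i) = fst (y0 j)) \<and>
        (\<forall>i\<in>{..<m}. \<forall>j\<in>{..<m}. lex_less (fst (y i)) (fst (y j)) \<longleftrightarrow> lex_less (fst (y0 i)) (fst (y0 j))) \<and>
        (\<forall>J\<in>Pow {..<m}. covered r ((\<lambda>i. fst (y i)) ` J) \<longleftrightarrow> covered r ((\<lambda>i. fst (y0 i)) ` J)) \<and>
        (\<forall>J\<in>Pow {..<m}. covered r' ((\<lambda>i. fst (y i)) ` J) \<longleftrightarrow> covered r' ((\<lambda>i. fst (y0 i)) ` J))}"
    proof (rule Collect_cong, rule conj_cong[OF refl])
      fix y
      have 1: "({i. i < m \<and> P i} = {i. i < m \<and> P' i}) = (\<forall>i\<in>{..<m}. P i \<longleftrightarrow> P' i)" for P P' by blast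
      have 2: "({(i, j). i < m \<and> j < m \<and> R i j} = {(i, j). i < m \<and> j < m \<and> R' i j}) = (\<forall>i\<in>{..<m}. \<forall>j\<in>{..<m}. R i j \<longleftrightarrow> R' i j)" for R R' by blast
      have 3: "({J. J \<subseteq> {..<m} \<and> P J} = {J. J \<subseteq> {..<m} \<and> P' J}) = (\<forall>J\<in>Pow {..<m}. P J \<longleftrightarrow> P' J)" for P P' by blast
      show "(pattern m y = pattern m y0) = ((\<forall>i\<in>{..<m}. snd (y i) = 0 \<longleftrightarrow> snd (y0 i) = 0) \<and> (\<forall>i\<in>{..<m}. snd (y i) = 1 \<longleftrightarrow> snd (y0 i) = 1) \<and>
        (\<forall>i\<in>{..<m}. \<forall>j\<in>{..<m}. fst (y i) = fst (y j) \<longleftrightarrow> fst (y0 i) = fst (y0 j)) \<and>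
        (\<forall>i\<in>{..<m}. \<forall>j\<in>{..<m}. lex_less (fst (y i)) (fst (y j)) \<longleftrightarrow> lex_less (fst (y0 i)) (fst (y0 j))) \<and>
        (\<forall>J\<in>Pow {..<m}. covered r ((\<lambda>i. fst (y i)) ` J) \<longleftrightarrow> covered r ((\<lambda>i. fst (y0 i)) ` J)) \<and>
        (\<forall>J\<in>Pow {..<m}. covered r' ((\<lambda>i. fst (y i)) ` J) \<longleftrightarrow> covered r' ((\<lambda>i. fst (y0 i)) ` J)))"
        unfolding pattern_def prod.inject 1 2 3 by (rule refl)
    qed
    also have "\<dots> \<in> sets ?T"
      by (intro sets.sets_Collect_conj sets.sets_Collect_finite_All finite_lessThan finite_Pow_iff[THEN iffD2] coords same lex cov)
    finally show ?thesis .
  qed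
  let ?V = "{y\<in>space ?T. labelled_betti (y ` {..<m}) = v}"
  have "pattern m ` ?V \<subseteq> Pow {..<m} \<times> Pow {..<m} \<times> Pow ({..<m} \<times> {..<m}) \<times> Pow ({..<m} \<times> {..<m}) \<times> Pow (Pow {..<m}) \<times> Pow (Pow {..<m})"
  proof (rule image_subsetI)
    show "pattern m y \<in> Pow {..<m} \<times> Pow {..<m} \<times> Pow ({..<m} \<times> {..<m}) \<times> Pow ({..<m} \<times> {..<m}) \<times> Pow (Pow {..<m}) \<times> Pow (Pow {..<m})" for y
      unfolding pattern_def by (intro SigmaI PowI) auto
  qed
  then have fin: "finite (pattern m ` ?V)" by (rule finite_subset) (intro finite_cartesian_product finite_Pow_iff[THEN iffD2] finite_lessThan)
  have "?V = (\<Union>p\<in>pattern m ` ?V. {y\<in>space ?T. pattern m y = p})"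
  proof (intro equalityI subsetI)
    fix y assume "y \<in> (\<Union>p\<in>pattern m ` ?V. {y\<in>space ?T. pattern m y = p})"
    then obtain y0 where "y0 \<in> ?V" "y \<in> space ?T" "pattern m y = pattern m y0" by blast
    then show "y \<in> ?V" using pattern_determines_betti[of m y y0] by simp
  next
    fix y assume "y \<in> ?V"
    then show "y \<in> (\<Union>p\<in>pattern m ` ?V. {y\<in>space ?T. pattern m y = p})" by (intro UN_I[of "pattern m y"] imageI) simp_all
  qed
  also have "\<dots> \<in> sets ?T"
  proof (rule sets.finite_UN[OF fin])
    fix p assume "p \<in> pattern m ` ?V"
    then obtain y0 :: "nat \<Rightarrow> 'n::{finite,linorder} labelled" where "p = pattern m y0" by (rule imageE)
    then show "{y\<in>space ?T. pattern m y = p} \<in> sets ?T" using level[of y0] by simp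
  qed
  finally show ?thesis .
qed

end

section \<open>Void probabilities of marked Poisson processes\<close>

lemma vimage_algebra_events:
  assumes f: "f \<in> measurable M N" and A: "A \<in> sets (vimage_algebra (space M) f N)"
  shows "A \<in> sets M"
proof -
  have s: "f \<in> space M \<rightarrow> space N" by (rule funcsetI) (rule measurable_space[OF f])
  obtain B where B: "B \<in> sets N" "A = f -` B \<inter> space M" using A unfolding sets_vimage_algebra2[OF s] by blast
  show ?thesis unfolding B(2) by (rule measurable_sets[OF f B(1)])
qed

locale marked_poisson =
  fixes M :: "'w measure" and X :: "nat \<Rightarrow> 'w \<Rightarrow> real ^ 'n" and mark :: "nat \<Rightarrow> 'w \<Rightarrow> real" and T :: nat and l :: real
  assumes imp: "independently_marked_poisson M X mark T l"
begin

lemma mp: "marked_point_process M X mark T" "0 < l" "homogeneous_poisson_process M X l"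
  "prob_space.indep_vars M (\<lambda>_. borel) mark UNIV" "distr M borel (mark i) = distr M borel (mark j)"
  "prob_space.indep_set M
         (sets (vimage_algebra (space M) (\<lambda>\<omega> i. X i \<omega>) (Pi\<^sub>M UNIV (\<lambda>_. borel))))
         (sets (vimage_algebra (space M) (\<lambda>\<omega> i. mark i \<omega>) (Pi\<^sub>M UNIV (\<lambda>_. borel))))"
proof -
  note i = imp[unfolded independently_marked_poisson_def]
  show "marked_point_process M X mark T" by (rule i[THEN conjunct1])
  note i = i[THEN conjunct2]
  show "0 < l" by (rule i[THEN conjunct1])
  note i = i[THEN conjunct2]
  show "homogeneous_poisson_process M X l" by (rule i[THEN conjunct1])
  note i = i[THEN conjunct2]
  show "prob_space.indep_vars M (\<lambda>_. borel) mark UNIV" by (rule i[THEN conjunct1])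
  note i = i[THEN conjunct2]
  show "distr M borel (mark i) = distr M borel (mark j)" by (rule i[THEN conjunct1, rule_format])
  show "prob_space.indep_set M
         (sets (vimage_algebra (space M) (\<lambda>\<omega> i. X i \<omega>) (Pi\<^sub>M UNIV (\<lambda>_. borel))))
         (sets (vimage_algebra (space M) (\<lambda>\<omega> i. mark i \<omega>) (Pi\<^sub>M UNIV (\<lambda>_. borel))))"
    by (rule i[THEN conjunct2])
qed

lemma prob_space_M: "prob_space M"
  using mp(1) unfolding marked_point_process_def by simp

lemma X_measurable: "X i \<in> borel_measurable M" and mark_measurable: "mark i \<in> borel_measurable M"
  using mp(1) unfolding marked_point_process_def by simp_all

lemma finite_points_in: "\<omega> \<in> space M \<Longrightarrow> bounded A \<Longrightarrow> finite {i. X i \<omega> \<in> A}"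
  using mp(1) unfolding marked_point_process_def by simp

lemma point_count_distr:
  assumes "A \<in> sets borel" "bounded A"
  shows "measure M {\<omega>\<in>space M. point_count X A \<omega> = k}
          = (l * measure lborel A) ^ k / fact k * exp (- (l * measure lborel A))"
  using mp(3) assms unfolding homogeneous_poisson_process_def by blast

lemma point_count_indep:
  fixes A :: "nat \<Rightarrow> (real ^ 'n) set"
  assumes "finite J" "disjoint_family_on A J" "\<And>j. j \<in> J \<Longrightarrow> A j \<in> sets borel \<and> bounded (A j)"
  shows "prob_space.indep_vars M (\<lambda>_. count_space UNIV) (\<lambda>j. point_count X (A j)) J"
  using mp(3) assms unfolding homogeneous_poisson_process_def by blast

lemma point_count_measurable:
  assumes "A \<in> sets borel" "bounded A"
  shows "point_count X A \<in> measurable M (count_space UNIV)"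
proof -
  have "prob_space.indep_vars M (\<lambda>_. count_space UNIV) (\<lambda>j. point_count X ((\<lambda>_. A) j)) {0 :: nat}"
    by (rule point_count_indep[of "{0}" "\<lambda>_. A"]) (use assms in \<open>auto simp: disjoint_family_on_def\<close>)
  then have "\<forall>i\<in>{0 :: nat}. point_count X A \<in> measurable M (count_space UNIV)"
    unfolding prob_space.indep_vars_def[OF prob_space_M] by (rule conjunct1)
  then show ?thesis by simp
qed

lemma poisson_generating_function:
  assumes A: "A \<in> sets borel" "bounded A" and c: "0 \<le> c"
  shows "(\<integral>\<^sup>+\<omega>. ennreal (c ^ point_count X A \<omega>) \<partial>M) = ennreal (exp (l * measure lborel A * (c - 1)))"
proof -
  interpret prob_space M by (rule prob_space_M)
  note [measurable] = point_count_measurable[OF A]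
  define \<mu> where "\<mu> = l * measure lborel A"
  have \<mu>: "0 \<le> \<mu>" unfolding \<mu>_def using mp(2) by simp
  define E where "E k = {\<omega>\<in>space M. point_count X A \<omega> = k}" for k
  have E: "E k \<in> sets M" for k unfolding E_def by measurable
  have "(\<integral>\<^sup>+\<omega>. ennreal (c ^ point_count X A \<omega>) \<partial>M) = (\<integral>\<^sup>+\<omega>. (\<integral>\<^sup>+k. ennreal (c ^ k) * indicator (E k) \<omega> \<partial>count_space UNIV) \<partial>M)"
  proof (rule nn_integral_cong)
    fix \<omega> assume "\<omega> \<in> space M"
    have "(\<integral>\<^sup>+k. ennreal (c ^ k) * indicator (E k) \<omega> \<partial>count_space UNIV)
        = (\<Sum>k\<in>{point_count X A \<omega>}. ennreal (c ^ k) * indicator (E k) \<omega>)"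
      by (rule nn_integral_count_space') (auto simp: E_def)
    then show "ennreal (c ^ point_count X A \<omega>) = (\<integral>\<^sup>+k. ennreal (c ^ k) * indicator (E k) \<omega> \<partial>count_space UNIV)"
      using \<open>\<omega> \<in> space M\<close> by (simp add: E_def)
  qed
  also have "\<dots> = (\<integral>\<^sup>+k. (\<integral>\<^sup>+\<omega>. ennreal (c ^ k) * indicator (E k) \<omega> \<partial>M) \<partial>count_space UNIV)"
    by (rule nn_integral_count_space_nn_integral) (use E in auto)
  also have "\<dots> = (\<integral>\<^sup>+k. ennreal ((\<mu> * c) ^ k / fact k * exp (- \<mu>)) \<partial>count_space UNIV)"
  proof (rule nn_integral_cong)
    fix k
    have "(\<integral>\<^sup>+\<omega>. ennreal (c ^ k) * indicator (E k) \<omega> \<partial>M) = ennreal (c ^ k) * emeasure M (E k)"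
      using E by (simp add: nn_integral_cmult_indicator)
    also have "emeasure M (E k) = ennreal (\<mu> ^ k / fact k * exp (- \<mu>))"
      unfolding emeasure_eq_measure E_def point_count_distr[OF A] \<mu>_def ..
    also have "ennreal (c ^ k) * \<dots> = ennreal ((\<mu> * c) ^ k / fact k * exp (- \<mu>))"
      using c \<mu> by (simp add: ennreal_mult' [symmetric] power_mult_distrib mult_ac)
    finally show "(\<integral>\<^sup>+\<omega>. ennreal (c ^ k) * indicator (E k) \<omega> \<partial>M) = ennreal ((\<mu> * c) ^ k / fact k * exp (- \<mu>))" .
  qed
  also have "\<dots> = suminf (\<lambda>k. ennreal ((\<mu> * c) ^ k / fact k * exp (- \<mu>)))"
    by (rule nn_integral_count_space_nat)
  also have "\<dots> = ennreal (exp (\<mu> * c) * exp (- \<mu>))"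
  proof (rule suminf_ennreal_eq)
    show "0 \<le> (\<mu> * c) ^ k / fact k * exp (- \<mu>)" for k using \<mu> c by simp
    have "(\<lambda>k. (\<mu> * c) ^ k /\<^sub>R fact k) sums exp (\<mu> * c)" by (rule exp_converges)
    then have "(\<lambda>k. (\<mu> * c) ^ k / fact k) sums exp (\<mu> * c)" by (simp add: scaleR_conv_of_real divide_inverse mult.commute)
    then show "(\<lambda>k. (\<mu> * c) ^ k / fact k * exp (- \<mu>)) sums (exp (\<mu> * c) * exp (- \<mu>))" by (rule sums_mult2)
  qed
  also have "exp (\<mu> * c) * exp (- \<mu>) = exp (l * measure lborel A * (c - 1))"
    unfolding \<mu>_def by (simp add: exp_add[symmetric] algebra_simps)
  finally show ?thesis .
qed

definition mark_prob :: "real set \<Rightarrow> real" where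
  "mark_prob B = measure M (mark 0 -` B \<inter> space M)"

lemma mark_prob_eq: "B \<in> sets borel \<Longrightarrow> measure M (mark i -` B \<inter> space M) = mark_prob B"
  unfolding mark_prob_def using mp(5)[of i 0]
  by (metis mark_measurable measure_distr)

lemma mark_avoid:
  assumes B: "\<And>i. i \<in> K \<Longrightarrow> B i \<in> sets borel" and K: "finite K"
  shows "measure M {\<omega>\<in>space M. \<forall>i\<in>K. mark i \<omega> \<notin> B i} = (\<Prod>i\<in>K. 1 - mark_prob (B i))"
proof (cases "K = {}")
  case True
  then show ?thesis using prob_space.prob_space[OF prob_space_M] by simp
next
  case False
  interpret prob_space M by (rule prob_space_M)
  have "{\<omega>\<in>space M. \<forall>i\<in>K. mark i \<omega> \<notin> B i} = (\<Inter>i\<in>K. mark i -` (- B i) \<inter> space M)"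
    using False by auto
  moreover have "prob (\<Inter>i\<in>K. mark i -` (- B i) \<inter> space M) = (\<Prod>i\<in>K. prob (mark i -` (- B i) \<inter> space M))"
    by (rule indep_varsD[OF mp(4) False K]) (use B in auto)
  moreover have "prob (mark i -` (- B i) \<inter> space M) = 1 - mark_prob (B i)" if "i \<in> K" for i
  proof -
    have s: "mark i -` B i \<inter> space M \<in> events" using measurable_sets[OF mark_measurable B[OF that]] .
    have "mark i -` (- B i) \<inter> space M = space M - (mark i -` B i \<inter> space M)" by blast
    then show ?thesis using prob_compl[OF s] mark_prob_eq[OF B[OF that]] by simp
  qed
  ultimately show ?thesis by (simp cong: prod.cong)
qed

lemma mark_prob_le_1: "mark_prob B \<le> 1"
  unfolding mark_prob_def by (rule prob_space.prob_le_1[OF prob_space_M])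

text \<open>Decompose the event according to the finite sets of indices of the points in the regions. Given these, the marks are independent of the locations, and
  each point in \<open>V j\<close> contributes a factor \<open>1 - mark_prob (B j)\<close>. The probability is therefore the mean of a product of powers with the numbers of points as
  exponents, and the Poisson generating function evaluates it. The regions are indexed by natural numbers to match the form in which the independence of the numbers of points is stated.\<close>
lemma avoid_nat:
  fixes J :: "nat set"
  assumes J: "finite J" and disj: "disjoint_family_on V J"
    and V: "\<And>j. j \<in> J \<Longrightarrow> V j \<in> sets borel \<and> bounded (V j)" and B: "\<And>j. j \<in> J \<Longrightarrow> B j \<in> sets borel"
  shows "measure M {\<omega>\<in>space M. \<forall>j\<in>J. \<forall>i. X i \<omega> \<in> V j \<longrightarrow> mark i \<omega> \<notin> B j}
    = (\<Prod>j\<in>J. exp (- (l * measure lborel (V j) * mark_prob (B j))))"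
proof -
  interpret prob_space M by (rule prob_space_M)
  define \<S> where "\<S> = (\<Pi>\<^sub>E j\<in>J. Collect (finite :: nat set \<Rightarrow> bool))"
  have c\<S>: "countable \<S>" unfolding \<S>_def by (rule countable_PiE[OF J]) (rule countable_Collect_finite)
  define I where "I \<omega> = (\<lambda>j\<in>J. {i. X i \<omega> \<in> V j})" for \<omega>
  \<comment> \<open>\<open>E S\<close> concerns the locations and \<open>F S\<close> the marks; \<open>S\<close> runs through a countable set of families of finite index sets\<close>
  define E where "E S = {\<omega>\<in>space M. \<forall>j\<in>J. \<forall>i. X i \<omega> \<in> V j \<longleftrightarrow> i \<in> S j}" for S :: "nat \<Rightarrow> nat set"
  define F where "F S = {\<omega>\<in>space M. \<forall>j\<in>J. \<forall>i\<in>S j. mark i \<omega> \<notin> B j}" for S :: "nat \<Rightarrow> nat set"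
  define h where "h S = (\<Prod>j\<in>J. (1 - mark_prob (B j)) ^ card (S j))" for S :: "nat \<Rightarrow> nat set"
  define ev where "ev = {\<omega>\<in>space M. \<forall>j\<in>J. \<forall>i. X i \<omega> \<in> V j \<longrightarrow> mark i \<omega> \<notin> B j}"
  have h0: "0 \<le> h S" for S unfolding h_def using mark_prob_le_1 by (intro prod_nonneg zero_le_power) simp
  have I\<S>: "I \<omega> \<in> \<S>" if "\<omega> \<in> space M" for \<omega>
    unfolding \<S>_def I_def using finite_points_in[OF that] V by auto
  have IE: "\<omega> \<in> E S \<longleftrightarrow> S = I \<omega>" if "\<omega> \<in> space M" "S \<in> \<S>" for \<omega> S
  proof
    assume "\<omega> \<in> E S"
    then show "S = I \<omega>" using that(2) unfolding \<S>_def
      by (intro PiE_ext[OF _ I\<S>[OF that(1), unfolded \<S>_def]]) (auto simp: E_def I_def)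
  qed (use that(1) in \<open>auto simp: E_def I_def\<close>)
  have E_X: "E S \<in> sets (vimage_algebra (space M) (\<lambda>\<omega> i. X i \<omega>) (Pi\<^sub>M UNIV (\<lambda>_. borel)))" for S
  proof -
    have "{x \<in> space (Pi\<^sub>M UNIV (\<lambda>_. borel)). \<forall>j\<in>J. \<forall>i. x i \<in> V j \<longleftrightarrow> i \<in> S j} \<in> sets (Pi\<^sub>M UNIV (\<lambda>_. borel :: (real ^ 'n) measure))"
    proof (intro sets.sets_Collect_finite_All[OF _ J] sets.sets_Collect_countable_All)
      fix j i :: nat assume "j \<in> J"
      have "{x \<in> space (Pi\<^sub>M UNIV (\<lambda>_. borel)). x i \<in> V j} \<in> sets (Pi\<^sub>M UNIV (\<lambda>_. borel :: (real ^ 'n) measure))"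
        by (rule measurable_sets_Collect[OF measurable_component_singleton]) (use V[OF \<open>j \<in> J\<close>] in auto)
      then show "{x \<in> space (Pi\<^sub>M UNIV (\<lambda>_. borel)). x i \<in> V j \<longleftrightarrow> i \<in> S j} \<in> sets (Pi\<^sub>M UNIV (\<lambda>_. borel :: (real ^ 'n) measure))"
        by (cases "i \<in> S j") (auto intro: sets.sets_Collect_neg)
    qed
    from in_vimage_algebra[OF this, of "\<lambda>\<omega> i. X i \<omega>" "space M"]
    show ?thesis by (rule back_subst[of "\<lambda>A. A \<in> _"]) (auto simp: E_def space_PiM)
  qed
  have F_m: "F S \<in> sets (vimage_algebra (space M) (\<lambda>\<omega> i. mark i \<omega>) (Pi\<^sub>M UNIV (\<lambda>_. borel)))" if "S \<in> \<S>" for S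
  proof -
    have "{x \<in> space (Pi\<^sub>M UNIV (\<lambda>_. borel)). \<forall>j\<in>J. \<forall>i\<in>S j. x i \<notin> B j} \<in> sets (Pi\<^sub>M UNIV (\<lambda>_. borel :: real measure))"
    proof (intro sets.sets_Collect_finite_All[OF _ J] sets.sets_Collect_finite_All)
      fix j assume j: "j \<in> J"
      show "finite (S j)" using that j unfolding \<S>_def by auto
      fix i :: nat
      have "{x \<in> space (Pi\<^sub>M UNIV (\<lambda>_. borel)). x i \<in> B j} \<in> sets (Pi\<^sub>M UNIV (\<lambda>_. borel :: real measure))"
        by (rule measurable_sets_Collect[OF measurable_component_singleton]) (use B[OF j] in auto)
      then show "{x \<in> space (Pi\<^sub>M UNIV (\<lambda>_. borel)). x i \<notin> B j} \<in> sets (Pi\<^sub>M UNIV (\<lambda>_. borel :: real measure))"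
        by (rule sets.sets_Collect_neg)
    qed
    from in_vimage_algebra[OF this, of "\<lambda>\<omega> i. mark i \<omega>" "space M"]
    show ?thesis by (rule back_subst[of "\<lambda>A. A \<in> _"]) (auto simp: F_def space_PiM)
  qed
  have Xm: "(\<lambda>\<omega> i. X i \<omega>) \<in> measurable M (Pi\<^sub>M UNIV (\<lambda>_. borel))"
    by (rule measurable_PiM_single') (auto intro: X_measurable)
  have mm: "(\<lambda>\<omega> i. mark i \<omega>) \<in> measurable M (Pi\<^sub>M UNIV (\<lambda>_. borel))"
    by (rule measurable_PiM_single') (auto intro: mark_measurable)
  have E_ev: "E S \<in> events" for S
    by (rule vimage_algebra_events[OF Xm E_X])
  have F_ev: "F S \<in> events" if "S \<in> \<S>" for S
    by (rule vimage_algebra_events[OF mm F_m[OF that]])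
  have PF: "emeasure M (E S \<inter> F S) = emeasure M (E S) * ennreal (h S)" if S: "S \<in> \<S>" for S
  proof (cases "E S = {}")
    case False
    then obtain \<omega>0 where w: "\<omega>0 \<in> space M" "\<And>j i. j \<in> J \<Longrightarrow> X i \<omega>0 \<in> V j \<longleftrightarrow> i \<in> S j" unfolding E_def by blast
    have Sd: "S j \<inter> S j' = {}" if "j \<in> J" "j' \<in> J" "j \<noteq> j'" for j j'
      using w(2)[OF that(1)] w(2)[OF that(2)] disj that unfolding disjoint_family_on_def by blast
    have fS: "finite (S j)" if "j \<in> J" for j using S that unfolding \<S>_def by auto
    \<comment> \<open>the sets \<open>S j\<close> are disjoint, so the union has a single member\<close>
    define B' where "B' i = (\<Union>j\<in>{j\<in>J. i \<in> S j}. B j)" for i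
    have B': "B' i = B j" if "j \<in> J" "i \<in> S j" for i j
    proof -
      have "{j\<in>J. i \<in> S j} = {j}" using that Sd by blast
      then show ?thesis by (simp add: B'_def)
    qed
    have "F S = {\<omega>\<in>space M. \<forall>i\<in>(\<Union>j\<in>J. S j). mark i \<omega> \<notin> B' i}"
      unfolding F_def using B' by auto
    moreover have "prob {\<omega>\<in>space M. \<forall>i\<in>(\<Union>j\<in>J. S j). mark i \<omega> \<notin> B' i} = (\<Prod>i\<in>(\<Union>j\<in>J. S j). 1 - mark_prob (B' i))"
    proof (rule mark_avoid)
      show "finite (\<Union>j\<in>J. S j)" using J fS by blast
      show "B' i \<in> sets borel" if "i \<in> (\<Union>j\<in>J. S j)" for i
        using that B B' by fastforce
    qed
    ultimately have "prob (F S) = (\<Prod>i\<in>(\<Union>j\<in>J. S j). 1 - mark_prob (B' i))" by simp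
    also have "\<dots> = (\<Prod>j\<in>J. \<Prod>i\<in>S j. 1 - mark_prob (B' i))"
      by (rule prod.UNION_disjoint) (use J fS Sd in auto)
    also have "\<dots> = h S"
      unfolding h_def by (intro prod.cong refl) (simp add: B')
    finally have "prob (F S) = h S" .
    moreover have "prob (E S \<inter> F S) = prob (E S) * prob (F S)"
      by (rule indep_setD[OF mp(6) E_X F_m[OF S]])
    ultimately show ?thesis by (simp add: emeasure_eq_measure ennreal_mult h0)
  qed simp
  have one: "(\<integral>\<^sup>+S. indicator (E S) \<omega> * g S \<partial>count_space \<S>) = g (I \<omega>)" if "\<omega> \<in> space M" for \<omega> and g :: "_ \<Rightarrow> ennreal"
  proof -
    have "(\<integral>\<^sup>+S. indicator (E S) \<omega> * g S \<partial>count_space \<S>) = (\<Sum>S\<in>{I \<omega>}. indicator (E S) \<omega> * g S)"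
      by (rule nn_integral_count_space') (use IE[OF that] I\<S>[OF that] in \<open>auto simp: indicator_def\<close>)
    then show ?thesis using IE[OF that I\<S>[OF that]] by simp
  qed
  have ev_I: "\<omega> \<in> ev \<longleftrightarrow> \<omega> \<in> F (I \<omega>)" if "\<omega> \<in> space M" for \<omega>
    using that unfolding ev_def F_def I_def by auto
  have ev_eq: "ev = (\<Union>S\<in>\<S>. E S \<inter> F S)"
  proof (intro equalityI subsetI)
    fix \<omega> assume a: "\<omega> \<in> ev"
    then have s: "\<omega> \<in> space M" by (simp add: ev_def)
    then show "\<omega> \<in> (\<Union>S\<in>\<S>. E S \<inter> F S)" using IE[OF s I\<S>[OF s]] ev_I[OF s] a I\<S>[OF s] by blast
  next
    fix \<omega> assume "\<omega> \<in> (\<Union>S\<in>\<S>. E S \<inter> F S)"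
    then obtain S where S: "S \<in> \<S>" "\<omega> \<in> E S" "\<omega> \<in> F S" by blast
    then have s: "\<omega> \<in> space M" by (simp add: E_def)
    then show "\<omega> \<in> ev" using IE[OF s S(1)] S ev_I[OF s] by simp
  qed
  have ev_m: "ev \<in> events"
    unfolding ev_eq by (rule sets.countable_UN'[OF c\<S>]) (use E_ev F_ev in auto)
  have "emeasure M ev = (\<integral>\<^sup>+\<omega>. indicator ev \<omega> \<partial>M)" using ev_m by simp
  also have "\<dots> = (\<integral>\<^sup>+\<omega>. (\<integral>\<^sup>+S. indicator (E S) \<omega> * indicator (F S) \<omega> \<partial>count_space \<S>) \<partial>M)"
  proof (rule nn_integral_cong)
    fix \<omega> assume s: "\<omega> \<in> space M"
    show "(indicator ev \<omega> :: ennreal) = (\<integral>\<^sup>+S. indicator (E S) \<omega> * indicator (F S) \<omega> \<partial>count_space \<S>)"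
      unfolding one[OF s, of "\<lambda>S. indicator (F S) \<omega>"] using ev_I[OF s] by (simp add: indicator_def)
  qed
  also have "\<dots> = (\<integral>\<^sup>+S. (\<integral>\<^sup>+\<omega>. indicator (E S) \<omega> * indicator (F S) \<omega> \<partial>M) \<partial>count_space \<S>)"
    by (rule nn_integral_count_space_nn_integral[OF c\<S>]) (use E_ev F_ev in auto)
  also have "\<dots> = (\<integral>\<^sup>+S. (\<integral>\<^sup>+\<omega>. indicator (E S) \<omega> * ennreal (h S) \<partial>M) \<partial>count_space \<S>)"
  proof (rule nn_integral_cong)
    fix S assume "S \<in> space (count_space \<S>)"
    then have S: "S \<in> \<S>" by simp
    have "(\<integral>\<^sup>+\<omega>. indicator (E S) \<omega> * indicator (F S) \<omega> \<partial>M) = emeasure M (E S \<inter> F S)"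
      unfolding indicator_inter_arith[symmetric] by (rule nn_integral_indicator) (use E_ev F_ev[OF S] in auto)
    also have "\<dots> = (\<integral>\<^sup>+\<omega>. indicator (E S) \<omega> * ennreal (h S) \<partial>M)"
      unfolding PF[OF S] using E_ev[of S] by (simp add: nn_integral_multc)
    finally show "(\<integral>\<^sup>+\<omega>. indicator (E S) \<omega> * indicator (F S) \<omega> \<partial>M) = (\<integral>\<^sup>+\<omega>. indicator (E S) \<omega> * ennreal (h S) \<partial>M)" .
  qed
  also have "\<dots> = (\<integral>\<^sup>+\<omega>. (\<integral>\<^sup>+S. indicator (E S) \<omega> * ennreal (h S) \<partial>count_space \<S>) \<partial>M)"
    by (rule nn_integral_count_space_nn_integral[OF c\<S>, symmetric]) (use E_ev in auto)
  also have "\<dots> = (\<integral>\<^sup>+\<omega>. (\<Prod>j\<in>J. ennreal ((1 - mark_prob (B j)) ^ point_count X (V j) \<omega>)) \<partial>M)"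
  proof (rule nn_integral_cong)
    fix \<omega> assume s: "\<omega> \<in> space M"
    have "h (I \<omega>) = (\<Prod>j\<in>J. (1 - mark_prob (B j)) ^ point_count X (V j) \<omega>)"
      unfolding h_def I_def point_count_def by (rule prod.cong) auto
    then show "(\<integral>\<^sup>+S. indicator (E S) \<omega> * ennreal (h S) \<partial>count_space \<S>) = (\<Prod>j\<in>J. ennreal ((1 - mark_prob (B j)) ^ point_count X (V j) \<omega>))"
      unfolding one[OF s] using mark_prob_le_1 by (simp add: prod_ennreal)
  qed
  also have "\<dots> = (\<Prod>j\<in>J. \<integral>\<^sup>+\<omega>. ennreal ((1 - mark_prob (B j)) ^ point_count X (V j) \<omega>) \<partial>M)"
  proof (rule indep_vars_nn_integral[OF J])
    have "indep_vars (\<lambda>_. borel) (\<lambda>j. (\<lambda>k. ennreal ((1 - mark_prob (B j)) ^ k)) \<circ> point_count X (V j)) J"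
      by (rule indep_vars_compose[OF point_count_indep[OF J disj V]]) auto
    then show "indep_vars (\<lambda>_. borel) (\<lambda>j \<omega>. ennreal ((1 - mark_prob (B j)) ^ point_count X (V j) \<omega>)) J"
      by (simp add: comp_def)
  qed auto
  also have "\<dots> = (\<Prod>j\<in>J. ennreal (exp (- (l * measure lborel (V j) * mark_prob (B j)))))"
  proof (rule prod.cong[OF refl])
    fix j assume "j \<in> J"
    then show "(\<integral>\<^sup>+\<omega>. ennreal ((1 - mark_prob (B j)) ^ point_count X (V j) \<omega>) \<partial>M) = ennreal (exp (- (l * measure lborel (V j) * mark_prob (B j))))"
      using poisson_generating_function[of "V j" "1 - mark_prob (B j)"] V mark_prob_le_1 by simp
  qed
  also have "\<dots> = ennreal (\<Prod>j\<in>J. exp (- (l * measure lborel (V j) * mark_prob (B j))))"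
    by (simp add: prod_ennreal)
  finally have "ennreal (prob ev) = ennreal (\<Prod>j\<in>J. exp (- (l * measure lborel (V j) * mark_prob (B j))))"
    by (simp add: emeasure_eq_measure)
  then show ?thesis unfolding ev_def by (simp add: prod_nonneg)
qed

text \<open>Transfer of \<open>avoid_nat\<close> along an enumeration of the index set.\<close>
lemma avoid:
  fixes J :: "'j set"
  assumes J: "finite J" and disj: "disjoint_family_on V J"
    and V: "\<And>j. j \<in> J \<Longrightarrow> V j \<in> sets borel \<and> bounded (V j)" and B: "\<And>j. j \<in> J \<Longrightarrow> B j \<in> sets borel"
  shows "measure M {\<omega>\<in>space M. \<forall>j\<in>J. \<forall>i. X i \<omega> \<in> V j \<longrightarrow> mark i \<omega> \<notin> B j}
    = (\<Prod>j\<in>J. exp (- (l * measure lborel (V j) * mark_prob (B j))))"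
proof -
  obtain e where e: "bij_betw e {0..<card J} J" using ex_bij_betw_nat_finite[OF J] by blast
  have eJ: "e ` {0..<card J} = J" "inj_on e {0..<card J}" using e unfolding bij_betw_def by auto
  have eJ': "e j \<in> J" if "j \<in> {0..<card J}" for j using eJ(1) that by blast
  have "measure M {\<omega>\<in>space M. \<forall>j\<in>{0..<card J}. \<forall>i. X i \<omega> \<in> V (e j) \<longrightarrow> mark i \<omega> \<notin> B (e j)}
    = (\<Prod>j\<in>{0..<card J}. exp (- (l * measure lborel (V (e j)) * mark_prob (B (e j)))))"
  proof (rule avoid_nat)
    show "disjoint_family_on (\<lambda>j. V (e j)) {0..<card J}"
      unfolding disjoint_family_on_def
    proof (intro ballI impI)
      fix i j assume ij: "i \<in> {0..<card J}" "j \<in> {0..<card J}" "i \<noteq> j"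
      then have "e i \<noteq> e j" using inj_onD[OF eJ(2)] by blast
      then show "V (e i) \<inter> V (e j) = {}" using disj eJ' ij(1,2) unfolding disjoint_family_on_def by blast
    qed
    show "V (e j) \<in> sets borel \<and> bounded (V (e j))" "B (e j) \<in> sets borel" if "j \<in> {0..<card J}" for j
      using V[OF eJ'[OF that]] B[OF eJ'[OF that]] by simp_all
  qed (rule finite_atLeastLessThan)
  also have "\<dots> = (\<Prod>j\<in>J. exp (- (l * measure lborel (V j) * mark_prob (B j))))"
    by (rule prod.reindex_bij_betw[OF e])
  finally have r: "measure M {\<omega>\<in>space M. \<forall>j\<in>{0..<card J}. \<forall>i. X i \<omega> \<in> V (e j) \<longrightarrow> mark i \<omega> \<notin> B (e j)}
    = (\<Prod>j\<in>J. exp (- (l * measure lborel (V j) * mark_prob (B j))))" .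
  have "(\<forall>j\<in>e ` {0..<card J}. R j) \<longleftrightarrow> (\<forall>j\<in>{0..<card J}. R (e j))" for R by simp
  note R = this[unfolded eJ(1)]
  show ?thesis unfolding R by (rule r)
qed

end

section \<open>Independence of the unit cells\<close>

lemma cell_eq: "cell z = (\<Inter>i\<in>UNIV. {x. real_of_int (z $ i) \<le> x $ i} \<inter> {x. x $ i < real_of_int (z $ i) + 1})"
  unfolding cell_def by auto

lemma cell_borel: "(cell z :: (real ^ 'n) set) \<in> sets borel"
proof -
  have "{x :: real ^ 'n. a \<le> x $ i} \<in> sets borel" for a i
    by (rule borel_closed) (use closed_halfspace_component_ge_cart[of a i] in simp)
  moreover have "{x :: real ^ 'n. x $ i < a} \<in> sets borel" for a i
    by (rule borel_open) (rule open_halfspace_component_lt_cart)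
  ultimately show ?thesis unfolding cell_eq by (intro sets.finite_INT finite sets.Int) auto
qed

lemma cell_shift: "x - embed z \<in> cell 0 \<longleftrightarrow> x \<in> cell z"
  unfolding cell_def embed_def by (simp add: le_diff_eq diff_less_eq add.commute)

lemma bounded_cell: "bounded (cell z :: (real ^ 'n) set)"
proof (rule bounded_subset[OF bounded_cbox])
  show "(cell z :: (real ^ 'n) set) \<subseteq> cbox (embed z) (embed z + 1)"
    unfolding cell_def embed_def by (auto simp: mem_box_cart less_imp_le)
qed

lemma measure_lborel_shift:
  fixes A :: "'a::euclidean_space set"
  assumes "A \<in> sets borel"
  shows "measure lborel ((\<lambda>x. x - v) -` A) = measure lborel A"
proof -
  have "measure lborel A = measure (distr lborel borel ((+) (- v))) A" by (simp add: lborel_distr_plus)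
  also have "\<dots> = measure lborel ((+) (- v) -` A \<inter> space lborel)" by (rule measure_distr) (use assms in auto)
  also have "(+) (- v) -` A \<inter> space lborel = (\<lambda>x. x - v) -` A" by auto
  finally show ?thesis by simp
qed

text \<open>The locations at which precisely the labels in \<open>a\<close> are forbidden by \<open>U\<close>. For fixed \<open>U\<close> the eight slices partition the cell.\<close>
definition slice :: "real set \<Rightarrow> 'n labelled set \<Rightarrow> (real ^ 'n) set" where
  "slice a U = {x \<in> cell 0. \<forall>t\<in>{0, 1, 2}. (x, t) \<in> U \<longleftrightarrow> t \<in> a}"

definition avoiding :: "'n::finite labelled set \<Rightarrow> 'n labelled set set" where
  "avoiding U = {Q \<in> cell_configurations. Q \<inter> U = {}}"

text \<open>The \<open>\<sigma>\<close>-algebra generated by void events. These are closed under intersection, so a law is determined by its void probabilities.\<close>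
definition configuration_space :: "'n::finite labelled set measure" where
  "configuration_space = sigma cell_configurations (avoiding ` sets borel)"

lemma avoiding_subset: "avoiding ` \<A> \<subseteq> Pow cell_configurations"
  by (auto simp: avoiding_def)

lemma space_configuration_space [simp]: "space configuration_space = cell_configurations"
  unfolding configuration_space_def by (rule space_measure_of[OF avoiding_subset])

lemma sets_configuration_space: "sets configuration_space = sigma_sets cell_configurations (avoiding ` sets borel)"
  unfolding configuration_space_def by (rule sets_measure_of[OF avoiding_subset])

lemma avoiding_in_sets: "U \<in> sets borel \<Longrightarrow> avoiding U \<in> sets configuration_space"
  unfolding sets_configuration_space by (rule sigma_sets.Basic) (rule imageI)

lemma Int_stable_avoiding: "Int_stable (avoiding ` sets (borel :: 'n::finite labelled measure))"
proof (rule Int_stableI)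
  fix a b assume "a \<in> avoiding ` sets (borel :: 'n labelled measure)" "b \<in> avoiding ` sets (borel :: 'n labelled measure)"
  then obtain U V where UV: "U \<in> sets borel" "V \<in> sets borel" "a = avoiding U" "b = avoiding V" by blast
  have "a \<inter> b = avoiding (U \<union> V)" unfolding UV avoiding_def by blast
  then show "a \<inter> b \<in> avoiding ` sets (borel :: 'n labelled measure)" using UV(1,2) by blast
qed

lemma slice_borel:
  fixes U :: "'n::finite labelled set"
  assumes U: "U \<in> sets borel"
  shows "slice a U \<in> sets borel"
proof -
  have m: "{x. (x, t) \<in> U} \<in> sets borel" for t
  proof -
    have "(\<lambda>x :: real ^ 'n. (x, t)) \<in> borel_measurable borel"
      by (rule borel_measurable_continuous_onI) (intro continuous_intros)
    from measurable_sets[OF this U] show ?thesis by (simp add: vimage_def)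
  qed
  have eq: "slice a U = cell 0 \<inter> (\<Inter>t\<in>{0, 1, 2}. {x. (x, t) \<in> U \<longleftrightarrow> t \<in> a})"
    unfolding slice_def by auto
  have m': "{x. (x, t) \<in> U \<longleftrightarrow> t \<in> a} \<in> sets borel" for t
  proof (cases "t \<in> a")
    case False
    have "- {x. (x, t) \<in> U} \<in> sets borel" using m[of t] by auto
    moreover have "- {x. (x, t) \<in> U} = {x. (x, t) \<in> U \<longleftrightarrow> t \<in> a}" using False by auto
    ultimately show ?thesis by simp
  qed (use m in simp)
  show ?thesis unfolding eq by (intro sets.Int cell_borel sets.finite_INT m') simp_all
qed

lemma slice_disjoint:
  assumes "a \<in> Pow {0, 1, 2}" "b \<in> Pow {0, 1, 2}" "x \<in> slice a U" "x \<in> slice b U"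
  shows "a = b"
  using assms unfolding slice_def by blast

locale labelled_poisson = marked_poisson M X mark T l
  for M :: "'w measure" and X :: "nat \<Rightarrow> 'w \<Rightarrow> real ^ 'n::finite" and mark T l +
  fixes s s' :: real
begin

definition label :: "real \<Rightarrow> real" where
  "label m = (if m \<le> s then 0 else if m \<le> s' then 1 else 2)"

lemma label_measurable: "label \<in> borel_measurable borel"
  unfolding label_def[abs_def] by measurable

definition cell_points :: "int ^ 'n \<Rightarrow> 'w \<Rightarrow> 'n labelled set" where
  "cell_points z \<omega> = {(X i \<omega> - embed z, label (mark i \<omega>)) | i. X i \<omega> \<in> cell z}"

lemma cell_points_image: "cell_points z \<omega> = (\<lambda>i. (X i \<omega> - embed z, label (mark i \<omega>))) ` {i. X i \<omega> \<in> cell z}"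
  unfolding cell_points_def by blast

lemma cell_points_configuration:
  assumes "\<omega> \<in> space M"
  shows "cell_points z \<omega> \<in> cell_configurations"
proof -
  have "finite (cell_points z \<omega>)"
    unfolding cell_points_image by (rule finite_imageI[OF finite_points_in[OF assms bounded_cell]])
  moreover have "cell_points z \<omega> \<subseteq> cell 0 \<times> {0, 1, 2}"
    unfolding cell_points_def by (auto simp: cell_shift label_def)
  ultimately show ?thesis unfolding cell_configurations_def by blast
qed

lemma avoid_event:
  assumes U: "U \<in> sets borel"
  shows "{\<omega>\<in>space M. cell_points z \<omega> \<inter> U = {}} \<in> sets M"
proof -
  have "{\<omega>\<in>space M. \<not> (X i \<omega> \<in> cell z \<and> (X i \<omega> - embed z, label (mark i \<omega>)) \<in> U)} \<in> sets M" for i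
  proof (intro sets.sets_Collect_neg sets.sets_Collect_conj)
    show "{\<omega>\<in>space M. X i \<omega> \<in> cell z} \<in> sets M"
      by (rule measurable_sets_Collect[OF X_measurable]) (use cell_borel in simp)
    have "(\<lambda>\<omega>. (X i \<omega> - embed z, label (mark i \<omega>))) \<in> borel_measurable M"
      by (intro borel_measurable_Pair borel_measurable_diff X_measurable borel_measurable_const
          measurable_compose[OF mark_measurable label_measurable])
    then show "{\<omega>\<in>space M. (X i \<omega> - embed z, label (mark i \<omega>)) \<in> U} \<in> sets M"
      by (rule measurable_sets_Collect) (use U in simp)
  qed
  then have "{\<omega>\<in>space M. \<forall>i. \<not> (X i \<omega> \<in> cell z \<and> (X i \<omega> - embed z, label (mark i \<omega>)) \<in> U)} \<in> sets M"
    by (rule sets.sets_Collect_countable_All)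
  also have "{\<omega>\<in>space M. \<forall>i. \<not> (X i \<omega> \<in> cell z \<and> (X i \<omega> - embed z, label (mark i \<omega>)) \<in> U)} = {\<omega>\<in>space M. cell_points z \<omega> \<inter> U = {}}"
    unfolding cell_points_def by (intro Collect_cong conj_cong refl) auto
  finally show ?thesis .
qed

lemma cell_points_measurable: "cell_points z \<in> measurable M configuration_space"
  unfolding configuration_space_def
proof (rule measurable_measure_of[OF avoiding_subset])
  show "cell_points z \<in> space M \<rightarrow> cell_configurations" using cell_points_configuration by blast
  fix A assume "A \<in> avoiding ` sets (borel :: 'n labelled measure)"
  then obtain U where U: "U \<in> sets borel" "A = avoiding U" by blast
  have "cell_points z -` A \<inter> space M = {\<omega>\<in>space M. cell_points z \<omega> \<inter> U = {}}"
    unfolding U(2) avoiding_def using cell_points_configuration by blast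
  then show "cell_points z -` A \<inter> space M \<in> sets M" using avoid_event[OF U(1)] by simp
qed

definition void_probability :: "'n labelled set \<Rightarrow> real" where
  "void_probability U = (\<Prod>a\<in>Pow {0, 1, 2}. exp (- (l * measure lborel (slice a U) * mark_prob (label -` a))))"

text \<open>A cell avoids \<open>U z\<close> if and only if for each slice no point in it has a label in the corresponding set. Slices of one cell and of distinct cells are disjoint, so \<open>avoid\<close> applies to all of them at once.\<close>
lemma joint_void_probability:
  assumes J: "finite J" and U: "\<And>z. z \<in> J \<Longrightarrow> U z \<in> sets borel"
  shows "measure M {\<omega>\<in>space M. \<forall>z\<in>J. cell_points z \<omega> \<inter> U z = {}} = (\<Prod>z\<in>J. void_probability (U z))"
proof -
  let ?P = "Pow {0, 1, 2 :: real}"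
  define V where "V = (\<lambda>(z, a). (\<lambda>x. x - embed z) -` slice a (U z))"
  define B where "B = (\<lambda>(z :: int ^ 'n, a). label -` a)"
  have fin: "finite (J \<times> ?P)" using J by simp
  have V_cell: "V (z, a) \<subseteq> cell z" for z a
    unfolding V_def slice_def by (auto simp: cell_shift)
  have shift: "(\<lambda>x :: real ^ 'n. x - embed z) \<in> borel_measurable borel" for z by measurable
  have V: "V j \<in> sets borel \<and> bounded (V j)" if jP: "j \<in> J \<times> ?P" for j
  proof -
    obtain z a where j: "j = (z, a)" "z \<in> J" using jP by blast
    have "V (z, a) \<in> sets borel"
      using measurable_sets[OF shift slice_borel[OF U[OF j(2)]]] unfolding V_def by simp
    then show ?thesis unfolding j(1) using bounded_subset[OF bounded_cell V_cell] by blast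
  qed
  have B: "B j \<in> sets borel" if jP: "j \<in> J \<times> ?P" for j
  proof -
    obtain z a where j: "j = (z, a)" "a \<in> ?P" using jP by blast
    have "finite a" using j(2) finite_subset[of a "{0, 1, 2}"] by simp
    then have "a \<in> sets borel" by (intro borel_closed finite_imp_closed)
    from measurable_sets[OF label_measurable this] show ?thesis unfolding B_def j(1) by simp
  qed
  have disj: "disjoint_family_on V (J \<times> ?P)"
    unfolding disjoint_family_on_def
  proof (intro ballI impI, rule ccontr)
    fix j j' assume jj: "j \<in> J \<times> ?P" "j' \<in> J \<times> ?P" "j \<noteq> j'" "V j \<inter> V j' \<noteq> {}"
    obtain z a where j: "j = (z, a)" "a \<in> ?P" using jj(1) by blast
    obtain z' a' where j': "j' = (z', a')" "a' \<in> ?P" using jj(2) by blast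
    obtain x where x: "x \<in> V (z, a)" "x \<in> V (z', a')" using jj(4) unfolding j(1) j'(1) by blast
    have "z = z'" by (rule cell_disjoint[OF subsetD[OF V_cell x(1)] subsetD[OF V_cell x(2)]])
    moreover have "a = a'"
      using slice_disjoint[OF j(2) j'(2)] x unfolding V_def \<open>z = z'\<close> by auto
    ultimately show False using jj(3) j(1) j'(1) by simp
  qed
  have ev: "cell_points z \<omega> \<inter> U z = {} \<longleftrightarrow> (\<forall>a\<in>?P. \<forall>i. X i \<omega> \<in> V (z, a) \<longrightarrow> mark i \<omega> \<notin> B (z, a))" for z \<omega>
  proof
    assume e: "cell_points z \<omega> \<inter> U z = {}"
    show "\<forall>a\<in>?P. \<forall>i. X i \<omega> \<in> V (z, a) \<longrightarrow> mark i \<omega> \<notin> B (z, a)"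
    proof (intro ballI allI impI notI)
      fix a i assume a: "a \<in> ?P" and x: "X i \<omega> \<in> V (z, a)" and m: "mark i \<omega> \<in> B (z, a)"
      have lab: "label (mark i \<omega>) \<in> a" using m by (simp add: B_def)
      then have "label (mark i \<omega>) \<in> {0, 1, 2}" using a by blast
      moreover have "X i \<omega> - embed z \<in> slice a (U z)" using x by (simp add: V_def)
      ultimately have "(X i \<omega> - embed z, label (mark i \<omega>)) \<in> U z" using lab unfolding slice_def by blast
      moreover have "X i \<omega> \<in> cell z" using x V_cell by blast
      ultimately show False using e unfolding cell_points_def by blast
    qed
  next
    assume a: "\<forall>a\<in>?P. \<forall>i. X i \<omega> \<in> V (z, a) \<longrightarrow> mark i \<omega> \<notin> B (z, a)"
    show "cell_points z \<omega> \<inter> U z = {}"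
    proof (rule ccontr)
      assume "cell_points z \<omega> \<inter> U z \<noteq> {}"
      then obtain i where i: "X i \<omega> \<in> cell z" "(X i \<omega> - embed z, label (mark i \<omega>)) \<in> U z" unfolding cell_points_def by blast
      \<comment> \<open>the slice that contains the offending point\<close>
      define b where "b = {t\<in>{0, 1, 2}. (X i \<omega> - embed z, t) \<in> U z}"
      have bP: "b \<in> ?P" unfolding b_def by blast
      have "X i \<omega> - embed z \<in> slice b (U z)" using i(1) unfolding slice_def b_def by (simp add: cell_shift)
      then have "X i \<omega> \<in> V (z, b)" by (simp add: V_def)
      then have "mark i \<omega> \<notin> B (z, b)" using a bP by blast
      moreover have "label (mark i \<omega>) \<in> b" using i(2) unfolding b_def by (simp add: label_def)
      ultimately show False by (simp add: B_def)
    qed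
  qed
  have "measure M {\<omega>\<in>space M. \<forall>z\<in>J. cell_points z \<omega> \<inter> U z = {}}
      = measure M {\<omega>\<in>space M. \<forall>j\<in>J \<times> ?P. \<forall>i. X i \<omega> \<in> V j \<longrightarrow> mark i \<omega> \<notin> B j}"
    unfolding ev by (intro arg_cong[where f = "measure M"] Collect_cong conj_cong refl) (simp add: Ball_def split_paired_all, blast)
  also have "\<dots> = (\<Prod>j\<in>J \<times> ?P. exp (- (l * measure lborel (V j) * mark_prob (B j))))"
    by (rule avoid[OF fin disj V B])
  also have "\<dots> = (\<Prod>z\<in>J. \<Prod>a\<in>?P. exp (- (l * measure lborel (V (z, a)) * mark_prob (B (z, a)))))"
    by (simp add: prod.cartesian_product case_prod_beta')
  also have "\<dots> = (\<Prod>z\<in>J. void_probability (U z))"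
    unfolding void_probability_def
  proof (intro prod.cong refl)
    fix z a assume "z \<in> J"
    then show "exp (- (l * measure lborel (V (z, a)) * mark_prob (B (z, a)))) = exp (- (l * measure lborel (slice a (U z)) * mark_prob (label -` a)))"
      using measure_lborel_shift[OF slice_borel[OF U]] by (simp add: V_def B_def)
  qed
  finally show ?thesis .
qed

definition cell_law :: "'n labelled set measure" where
  "cell_law = distr M configuration_space (cell_points 0)"

lemma cell_points_vimage:
  "cell_points z -` avoiding U \<inter> space M = {\<omega>\<in>space M. cell_points z \<omega> \<inter> U = {}}"
  unfolding avoiding_def using cell_points_configuration by blast

lemma cell_void_probability:
  assumes "U \<in> sets borel"
  shows "measure M {\<omega>\<in>space M. cell_points z \<omega> \<inter> U = {}} = void_probability U"
  using joint_void_probability[of "{z}" "\<lambda>_. U"] assms by simp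

lemma distr_cell_points: "distr M configuration_space (cell_points z) = cell_law"
  unfolding cell_law_def
proof (rule measure_eqI_generator_eq[OF Int_stable_avoiding avoiding_subset, where A = "\<lambda>_. cell_configurations"])
  interpret prob_space M by (rule prob_space_M)
  fix A assume "A \<in> avoiding ` sets (borel :: 'n labelled measure)"
  then obtain U where U: "U \<in> sets borel" "A = avoiding U" by blast
  show "emeasure (distr M configuration_space (cell_points z)) A = emeasure (distr M configuration_space (cell_points 0)) A"
    unfolding U(2) emeasure_distr[OF cell_points_measurable avoiding_in_sets[OF U(1)]] cell_points_vimage emeasure_eq_measure
      cell_void_probability[OF U(1)] ..
next
  have "cell_configurations = avoiding {}" by (simp add: avoiding_def)
  then show "range (\<lambda>_. cell_configurations) \<subseteq> avoiding ` sets (borel :: 'n labelled measure)" by auto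
  interpret prob_space "distr M configuration_space (cell_points z)"
    by (rule prob_space.prob_space_distr[OF prob_space_M cell_points_measurable])
  show "emeasure (distr M configuration_space (cell_points z)) cell_configurations \<noteq> \<infinity>" for i :: nat
    unfolding infinity_ennreal_def by (rule emeasure_finite)
qed (simp_all add: sets_configuration_space)

lemma prob_space_cell_law: "prob_space cell_law"
  unfolding cell_law_def by (rule prob_space.prob_space_distr[OF prob_space_M cell_points_measurable])

text \<open>Void events form a generator that is closed under intersection, and \<open>joint_void_probability\<close> is the product formula on it.\<close>
lemma indep_cell_points: "prob_space.indep_vars M (\<lambda>_. configuration_space) cell_points UNIV"
proof -
  interpret prob_space M by (rule prob_space_M)
  have fin: "indep_vars (\<lambda>_. configuration_space) cell_points J" if J: "J \<noteq> {}" "finite J" for J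
  proof (rule indep_vars_finite[OF J, where E = "\<lambda>_. avoiding ` sets (borel :: 'n labelled measure)", THEN iffD2])
    show "\<forall>A\<in>(\<Pi> i\<in>J. avoiding ` sets (borel :: 'n labelled measure)).
      prob (\<Inter>j\<in>J. cell_points j -` A j \<inter> space M) = (\<Prod>j\<in>J. prob (cell_points j -` A j \<inter> space M))"
    proof
      fix A assume "A \<in> (\<Pi> i\<in>J. avoiding ` sets (borel :: 'n labelled measure))"
      then have "\<forall>z\<in>J. \<exists>U. U \<in> sets borel \<and> A z = avoiding U" by blast
      then obtain U where U: "\<forall>z\<in>J. U z \<in> sets borel \<and> A z = avoiding (U z)" by (rule bchoice[THEN exE])
      have "(\<Inter>j\<in>J. cell_points j -` A j \<inter> space M) = {\<omega>\<in>space M. \<forall>z\<in>J. cell_points z \<omega> \<inter> U z = {}}"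
        using U J(1) cell_points_vimage by auto
      then have "prob (\<Inter>j\<in>J. cell_points j -` A j \<inter> space M) = (\<Prod>z\<in>J. void_probability (U z))"
        using joint_void_probability[OF J(2), of U] U by simp
      also have "\<dots> = (\<Prod>j\<in>J. prob (cell_points j -` A j \<inter> space M))"
        by (intro prod.cong refl) (use U in \<open>simp add: cell_points_vimage cell_void_probability\<close>)
      finally show "prob (\<Inter>j\<in>J. cell_points j -` A j \<inter> space M) = (\<Prod>j\<in>J. prob (cell_points j -` A j \<inter> space M))" .
    qed
    have "cell_configurations = avoiding {}" by (simp add: avoiding_def)
    then show "space configuration_space \<in> avoiding ` sets (borel :: 'n labelled measure)" by auto
  qed (simp_all add: sets_configuration_space cell_points_measurable Int_stable_avoiding avoiding_subset)
  show ?thesis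
    unfolding indep_vars_def2
  proof (intro conjI ballI cell_points_measurable)
    show "indep_sets (\<lambda>i. {cell_points i -` A \<inter> space M |A. A \<in> sets configuration_space}) UNIV"
    proof (subst indep_sets_finite_index_sets, intro allI impI)
      fix J :: "(int ^ 'n) set" assume "J \<noteq> {}" "finite J"
      from fin[OF this] show "indep_sets (\<lambda>i. {cell_points i -` A \<inter> space M |A. A \<in> sets configuration_space}) J"
        unfolding indep_vars_def2 by (rule conjunct2)
    qed
  qed
qed

theorem distr_cells: "distr M (Pi\<^sub>M UNIV (\<lambda>_. cell_law)) (\<lambda>\<omega> z. cell_points z \<omega>) = Pi\<^sub>M UNIV (\<lambda>_. cell_law)"
proof -
  interpret prob_space M by (rule prob_space_M)
  have "distr M (Pi\<^sub>M UNIV (\<lambda>_. configuration_space)) (\<lambda>\<omega>. \<lambda>z\<in>UNIV. cell_points z \<omega>) = Pi\<^sub>M UNIV (\<lambda>z. distr M configuration_space (cell_points z))"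
    using indep_cell_points by (subst (asm) indep_vars_iff_distr_eq_PiM') (auto intro: cell_points_measurable)
  moreover have "sets (Pi\<^sub>M UNIV (\<lambda>_. cell_law)) = sets (Pi\<^sub>M UNIV (\<lambda>_ :: int ^ 'n. configuration_space))"
    by (rule sets_PiM_cong) (simp_all add: cell_law_def)
  then have "distr M (Pi\<^sub>M UNIV (\<lambda>_. cell_law)) (\<lambda>\<omega> z. cell_points z \<omega>) = distr M (Pi\<^sub>M UNIV (\<lambda>_. configuration_space)) (\<lambda>\<omega> z. cell_points z \<omega>)"
    by (intro distr_cong refl)
  ultimately show ?thesis by (simp add: distr_cell_points restrict_UNIV)
qed

end

section \<open>The normal limit of persistent Betti numbers\<close>

lemma centered_normal_eq_distr:
  assumes "0 < s"
  shows "centered_normal s = distr std_normal_distribution borel (\<lambda>x. s * x)"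
proof -
  interpret N: real_distribution std_normal_distribution by (rule real_dist_normal_dist)
  have "distributed std_normal_distribution lborel (\<lambda>x. x) (normal_density 0 1)"
    by (simp add: distributed_def distr_id2)
  from N.normal_density_affine[OF this, of s 0] assms
  have "distributed std_normal_distribution lborel (\<lambda>x. s * x) (normal_density 0 s)" by simp
  then have "distr std_normal_distribution lborel (\<lambda>x. s * x) = density lborel (normal_density 0 s)"
    unfolding distributed_def by blast
  moreover have "distr std_normal_distribution lborel (\<lambda>x. s * x) = distr std_normal_distribution borel (\<lambda>x. s * x)"
    by (rule distr_cong) auto
  ultimately show ?thesis using assms by (simp add: centered_normal_def)
qed

text \<open>The degenerate case \<open>s = 0\<close> is the point mass at \<open>0\<close>.\<close>
lemma char_centered_normal:
  assumes "0 \<le> s"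
  shows "real_distribution (centered_normal s)" "char (centered_normal s) t = complex_of_real (exp (- (s * t)\<^sup>2 / 2))"
proof -
  interpret N: real_distribution std_normal_distribution by (rule real_dist_normal_dist)
  have "real_distribution (centered_normal s) \<and> char (centered_normal s) t = complex_of_real (exp (- (s * t)\<^sup>2 / 2))"
  proof (cases "s = 0")
    case True
    have "prob_space (return borel (0 :: real))" by (rule prob_space_return) simp
    then have "real_distribution (return borel (0 :: real))"
      by (intro real_distribution.intro real_distribution_axioms.intro) auto
    moreover have "char (return borel 0) t = 1"
      unfolding char_def by (subst integral_return) auto
    ultimately show ?thesis using True by (simp add: centered_normal_def)
  next
    case False
    then have s: "0 < s" using assms by simp
    have "char (centered_normal s) t = (CLINT x|std_normal_distribution. iexp (t * (s * x)))"
      unfolding centered_normal_eq_distr[OF s] char_def by (rule integral_distr) auto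
    also have "\<dots> = char std_normal_distribution (s * t)"
      unfolding char_def by (rule Bochner_Integration.integral_cong) (simp_all add: mult_ac)
    finally show ?thesis
      unfolding char_std_normal_distribution centered_normal_eq_distr[OF s] by (simp add: N.real_distribution_distr)
  qed
  then show "real_distribution (centered_normal s)" "char (centered_normal s) t = complex_of_real (exp (- (s * t)\<^sup>2 / 2))" by simp_all
qed

locale betti_field = labelled_poisson M X mark T l s s' + multicover_parameters r r' k k' q T
  for M :: "'w measure" and X :: "nat \<Rightarrow> 'w \<Rightarrow> real ^ 'n::{finite,linorder}" and mark T l s s' r r' k k' q +
  assumes thresholds: "s \<le> s'"
begin

definition window_betti :: "(int ^ 'n::{finite,linorder}) set \<Rightarrow> (int ^ 'n::{finite,linorder} \<Rightarrow> 'n::{finite,linorder} labelled set) \<Rightarrow> real" where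
  "window_betti W \<omega> = real (labelled_betti (assemble W \<omega>))"

abbreviation "\<Omega> \<equiv> (iid_field cell_law :: (int ^ 'n::{finite,linorder} \<Rightarrow> 'n::{finite,linorder} labelled set) measure)"

lemma space_cell_law: "space cell_law = cell_configurations"
  and sets_cell_law: "sets cell_law = sets configuration_space"
  by (simp_all add: cell_law_def)

lemma in_space: "\<omega> \<in> space \<Omega> \<Longrightarrow> \<omega> z \<in> cell_configurations"
  by (auto simp: space_PiM space_cell_law PiE_iff)

lemma coordinate_avoids:
  assumes "U \<in> sets borel"
  shows "{\<omega>\<in>space \<Omega>. \<omega> z \<inter> U = {}} \<in> sets \<Omega>"
proof -
  have "{Q\<in>space cell_law. Q \<in> avoiding U} = avoiding U" unfolding space_cell_law avoiding_def by blast
  then have "{Q\<in>space cell_law. Q \<in> avoiding U} \<in> sets cell_law" using avoiding_in_sets[OF assms] by (simp add: sets_cell_law)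
  then have "{\<omega>\<in>space \<Omega>. \<omega> z \<in> avoiding U} \<in> sets \<Omega>"
    by (rule measurable_sets_Collect[OF measurable_component_singleton[OF UNIV_I]])
  moreover have "{\<omega>\<in>space \<Omega>. \<omega> z \<in> avoiding U} = {\<omega>\<in>space \<Omega>. \<omega> z \<inter> U = {}}"
    using in_space unfolding avoiding_def by blast
  ultimately show ?thesis by simp
qed

lemma random_assemble:
  assumes W: "finite W"
  shows "random_finite_set \<Omega> (assemble W)"
  unfolding random_finite_set_def
proof (intro conjI ballI)
  show "finite (assemble W \<omega>)" if "\<omega> \<in> space \<Omega>" for \<omega> by (rule finite_assemble[OF W in_space[OF that]])
  fix U :: "'n labelled set" assume U: "U \<in> sets borel"
  define V where "V z = (\<lambda>p. (fst p + embed z, snd p)) -` U" for z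
  have V: "V z \<in> sets borel" for z
  proof -
    have "(\<lambda>p :: 'n labelled. (fst p + embed z, snd p)) \<in> borel_measurable borel"
      by (rule borel_measurable_continuous_onI) (intro continuous_intros)
    from measurable_sets[OF this U] show ?thesis by (simp add: V_def)
  qed
  have "{\<omega>\<in>space \<Omega>. \<forall>z\<in>W. \<omega> z \<inter> V z = {}} \<in> sets \<Omega>"
    by (intro sets.sets_Collect_finite_All W coordinate_avoids V)
  moreover have "(\<forall>z\<in>W. \<omega> z \<inter> V z = {}) \<longleftrightarrow> assemble W \<omega> \<inter> U = {}" for \<omega>
  proof -
    have "\<omega> z \<inter> V z = {} \<longleftrightarrow> move (embed z) (\<omega> z) \<inter> U = {}" for z
      unfolding move_def V_def by (force simp: split_beta disjoint_iff)
    then show ?thesis unfolding assemble_def by blast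
  qed
  ultimately show "{\<omega>\<in>space \<Omega>. assemble W \<omega> \<inter> U = {}} \<in> sets \<Omega>" by simp
qed

lemma betti_measurable:
  assumes "random_finite_set N Q"
  shows "(\<lambda>\<omega>. real (labelled_betti (Q \<omega> :: 'n labelled set))) \<in> borel_measurable N"
proof -
  have "(\<lambda>\<omega>. labelled_betti (Q \<omega>)) \<in> measurable N (count_space UNIV)"
  proof (rule measurable_count_space_eq2_countable[THEN iffD2], intro conjI ballI)
    fix v
    have "{\<omega>\<in>space N. labelled_betti (Q \<omega>) = v} \<in> sets N"
      by (rule random_set_functional_measurable[OF assms betti_tuple_measurable])
    moreover have "(\<lambda>\<omega>. labelled_betti (Q \<omega>)) -` {v} \<inter> space N = {\<omega>\<in>space N. labelled_betti (Q \<omega>) = v}" by auto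
    ultimately show "(\<lambda>\<omega>. labelled_betti (Q \<omega>)) -` {v} \<inter> space N \<in> sets N" by simp
  qed auto
  then show ?thesis by (rule measurable_compose) simp
qed

lemma bound_measurable: "increment_bound \<in> borel_measurable \<Omega>"
proof -
  have "random_finite_set \<Omega> (\<lambda>\<omega>. \<omega> z)" for z
    unfolding random_finite_set_def using in_space coordinate_avoids by (auto simp: cell_configurations_def)
  then have c: "(\<lambda>\<omega>. real (card (\<omega> z \<inter> UNIV))) \<in> borel_measurable \<Omega>" for z
    by (rule card_Int_measurable) simp
  have "(\<lambda>\<omega>. (\<Sum>z\<in>lattice_ball reach. real (card (\<omega> z \<inter> UNIV))) * real (q + 2)) \<in> borel_measurable \<Omega>"
    by (intro borel_measurable_times borel_measurable_sum c borel_measurable_const)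
  then have "(\<lambda>\<omega>. 2 * 2 powr ((\<Sum>z\<in>lattice_ball reach. real (card (\<omega> z \<inter> UNIV))) * real (q + 2))) \<in> borel_measurable \<Omega>"
    by (rule measurable_compose[where g = "\<lambda>x. 2 * 2 powr x"]) (intro borel_measurable_continuous_onI continuous_intros, simp)
  moreover have "increment_bound \<omega> = 2 * 2 powr ((\<Sum>z\<in>lattice_ball reach. real (card (\<omega> z \<inter> UNIV))) * real (q + 2))" for \<omega> :: "int ^ 'n::{finite,linorder} \<Rightarrow> 'n::{finite,linorder} labelled set"
  proof -
    have "(\<Sum>z\<in>lattice_ball reach. real (card (\<omega> z \<inter> UNIV))) * real (q + 2) = real ((\<Sum>z\<in>lattice_ball reach. card (\<omega> z)) * (q + 2))"
      by (simp only: Int_UNIV_right of_nat_mult of_nat_sum)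
    then show ?thesis unfolding increment_bound_def by (simp only: powr_realpow zero_less_numeral)
  qed
  ultimately show ?thesis by (simp add: fun_eq_iff cong: measurable_cong)
qed

lemma cells_measurable: "(\<lambda>\<omega> z. cell_points z \<omega>) \<in> measurable M \<Omega>"
proof (rule measurable_PiM_single')
  show "cell_points z \<in> measurable M cell_law" for z
    using cell_points_measurable[of z] measurable_cong_sets[OF refl sets_cell_law] by blast
  show "(\<lambda>\<omega> z. cell_points z \<omega>) \<in> space M \<rightarrow> UNIV \<rightarrow>\<^sub>E space cell_law"
    using cell_points_configuration by (auto simp: space_cell_law)
qed

text \<open>The bound is exponential in the number of points in a bounded region, which is Poisson distributed and has all exponential moments.\<close>
lemma bound_square_integrable: "integrable \<Omega> (\<lambda>\<omega>. (increment_bound \<omega>)\<^sup>2)"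
proof -
  define A where "A = (\<Union>z\<in>lattice_ball reach. cell z :: (real ^ 'n::{finite,linorder}) set)"
  have A: "A \<in> sets borel" "bounded A"
    unfolding A_def by (auto intro!: sets.finite_UN cell_borel bounded_UN bounded_cell finite_lattice_ball)
  define c where "c = (4 :: real) ^ (q + 2)"
  have le: "(increment_bound (\<lambda>z. cell_points z \<omega>))\<^sup>2 \<le> 4 * c ^ point_count X A \<omega>" if \<omega>: "\<omega> \<in> space M" for \<omega>
  proof -
    let ?I = "\<lambda>z. {i. X i \<omega> \<in> cell z}"
    have fin: "finite (?I z)" for z by (rule finite_points_in[OF \<omega> bounded_cell])
    have "(\<Sum>z\<in>lattice_ball reach. card (cell_points z \<omega>)) \<le> (\<Sum>z\<in>lattice_ball reach. card (?I z))"
      unfolding cell_points_image by (intro sum_mono card_image_le fin)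
    also have "\<dots> = card (\<Union>z\<in>lattice_ball reach. ?I z)"
    proof (rule card_UN_disjoint[symmetric, OF finite_lattice_ball])
      show "\<forall>z\<in>lattice_ball reach. \<forall>w\<in>lattice_ball reach. z \<noteq> w \<longrightarrow> ?I z \<inter> ?I w = {}" using cell_disjoint by blast
    qed (use fin in blast)
    also have "(\<Union>z\<in>lattice_ball reach. ?I z) = {i. X i \<omega> \<in> A}" unfolding A_def by blast
    finally have "(\<Sum>z\<in>lattice_ball reach. card (cell_points z \<omega>)) \<le> point_count X A \<omega>" unfolding point_count_def .
    then have "(2 :: real) ^ ((\<Sum>z\<in>lattice_ball reach. card (cell_points z \<omega>)) * (q + 2)) \<le> 2 ^ (point_count X A \<omega> * (q + 2))"
      by (intro power_increasing mult_le_mono1) auto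
    then have "(increment_bound (\<lambda>z. cell_points z \<omega>))\<^sup>2 \<le> (2 * 2 ^ (point_count X A \<omega> * (q + 2)))\<^sup>2"
      unfolding increment_bound_def by (intro power_mono mult_left_mono) auto
    also have "\<dots> = 4 * ((2 ^ (q + 2))\<^sup>2) ^ point_count X A \<omega>"
      by (simp only: power_mult_distrib power_mult[symmetric] mult_ac) simp
    also have "((2 :: real) ^ (q + 2))\<^sup>2 = c" unfolding c_def by (simp add: power2_eq_square power_mult_distrib[symmetric])
    finally show ?thesis .
  qed
  have meas: "(\<lambda>\<omega>. (increment_bound (\<lambda>z. cell_points z \<omega>))\<^sup>2) \<in> borel_measurable M"
    by (intro borel_measurable_power measurable_compose[OF cells_measurable bound_measurable])
  have "integrable M (\<lambda>\<omega>. (increment_bound (\<lambda>z. cell_points z \<omega>))\<^sup>2)"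
  proof (rule integrableI_bounded[OF meas])
    have "(\<integral>\<^sup>+\<omega>. ennreal (norm ((increment_bound (\<lambda>z. cell_points z \<omega>))\<^sup>2)) \<partial>M) \<le> (\<integral>\<^sup>+\<omega>. 4 * ennreal (c ^ point_count X A \<omega>) \<partial>M)"
    proof (rule nn_integral_mono)
      fix \<omega> assume "\<omega> \<in> space M"
      from le[OF this] show "ennreal (norm ((increment_bound (\<lambda>z. cell_points z \<omega>))\<^sup>2)) \<le> 4 * ennreal (c ^ point_count X A \<omega>)"
        by (simp add: ennreal_mult'[symmetric] flip: ennreal_numeral) (rule ennreal_leI, simp add: c_def)
    qed
    also have "\<dots> = 4 * (\<integral>\<^sup>+\<omega>. ennreal (c ^ point_count X A \<omega>) \<partial>M)"
      by (rule nn_integral_cmult) (use measurable_compose[OF point_count_measurable[OF A], of "\<lambda>m. ennreal (c ^ m)" borel] in simp)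
    also have "\<dots> < \<infinity>"
      by (subst poisson_generating_function[OF A]) (simp_all add: c_def ennreal_mult_less_top)
    finally show "(\<integral>\<^sup>+\<omega>. ennreal (norm ((increment_bound (\<lambda>z. cell_points z \<omega>))\<^sup>2)) \<partial>M) < \<infinity>" .
  qed
  then have "integrable (distr M \<Omega> (\<lambda>\<omega> z. cell_points z \<omega>)) (\<lambda>\<omega>. (increment_bound \<omega>)\<^sup>2)"
    by (subst integrable_distr_eq[OF cells_measurable]) (auto intro: borel_measurable_power bound_measurable)
  then show ?thesis unfolding distr_cells .
qed

lemma stabilizing: "stabilizing_field cell_law window_betti increment_bound"
proof (rule stabilizing_field.intro)
  show "prob_space cell_law" by (rule prob_space_cell_law)
  show "window_betti W \<in> borel_measurable \<Omega>" if "finite W" for W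
    unfolding window_betti_def[abs_def] by (rule betti_measurable[OF random_assemble[OF that]])
  show "depends_on cell_law W (window_betti W)" for W
    unfolding depends_on_def window_betti_def assemble_def by (auto intro!: arg_cong[where f = labelled_betti])
  show "window_betti ((\<lambda>z. z + v) ` W) \<omega> = window_betti W (\<lambda>z. \<omega> (z + v))" if "finite W" "\<omega> \<in> space \<Omega>" for W v \<omega>
    unfolding window_betti_def assemble_translate
    by (subst betti_move[OF finite_assemble[OF that(1) in_space[OF that(2)]]]) (rule refl)
  show "increment_bound \<in> borel_measurable \<Omega>" by (rule bound_measurable)
  show "integrable \<Omega> (\<lambda>\<omega>. (increment_bound \<omega>)\<^sup>2)" by (rule bound_square_integrable)
  show "\<bar>window_betti W \<omega> - window_betti (W - {c}) \<omega>\<bar> \<le> increment_bound (\<lambda>z. \<omega> (z + c))"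
    if "finite W" "c \<in> W" "\<omega> \<in> space \<Omega>" for W c \<omega>
    unfolding window_betti_def by (rule betti_increment_bound[OF in_space[OF that(3)] that(1)])
  show "\<exists>R. \<forall>W W'. finite W \<longrightarrow> finite W' \<longrightarrow> lattice_ball R \<subseteq> W \<longrightarrow> lattice_ball R \<subseteq> W' \<longrightarrow>
        window_betti W \<omega> - window_betti (W - {0}) \<omega> = window_betti W' \<omega> - window_betti (W' - {0}) \<omega>" if "\<omega> \<in> space \<Omega>" for \<omega>
    unfolding window_betti_def by (rule betti_stabilizes[OF in_space[OF that]])
qed

definition box :: "nat \<Rightarrow> (real ^ 'n::{finite,linorder}) set" where
  "box n = {x. \<forall>j. 0 \<le> x $ j \<and> x $ j \<le> real n}"

definition box_points :: "nat \<Rightarrow> 'w \<Rightarrow> 'n::{finite,linorder} labelled set" where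
  "box_points n \<omega> = (\<lambda>i. (X i \<omega>, label (mark i \<omega>))) ` {i. X i \<omega> \<in> box n}"

lemma box_eq_cbox: "box n = cbox 0 (\<chi> i. real n)"
  unfolding box_def by (auto simp: mem_box_cart)

text \<open>The two point sets in the definition consist of the marks at most \<open>s\<close> and at most \<open>s'\<close>, which the labels tell apart.\<close>
lemma persistent_betti_eq:
  "persistent_betti (\<lambda>i. X i \<omega>) (\<lambda>i. mark i \<omega>) n q (r, s, k) (r', s', k') = labelled_betti (box_points n \<omega>)"
proof -
  have zero: "label v = 0 \<longleftrightarrow> v \<le> s" and zero_one: "label v = 0 \<or> label v = 1 \<longleftrightarrow> v \<le> s'" for v
    using thresholds by (auto simp: label_def)
  have mem: "(p, t) \<in> box_points n \<omega> \<longleftrightarrow> (\<exists>i. X i \<omega> \<in> box n \<and> p = X i \<omega> \<and> label (mark i \<omega>) = t)" for p t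
    unfolding box_points_def by (auto simp: image_iff)
  have in_box: "(\<forall>j. 0 \<le> x $ j \<and> x $ j \<le> real n) \<longleftrightarrow> x \<in> box n" for x by (simp add: box_def)
  have "low_points (box_points n \<omega>) = {X i \<omega> | i. (\<forall>j. 0 \<le> X i \<omega> $ j \<and> X i \<omega> $ j \<le> real n) \<and> mark i \<omega> \<le> s}"
    unfolding low_points_def mem in_box zero by blast
  moreover have "high_points (box_points n \<omega>) = {X i \<omega> | i. (\<forall>j. 0 \<le> X i \<omega> $ j \<and> X i \<omega> $ j \<le> real n) \<and> mark i \<omega> \<le> s'}"
    unfolding high_points_def mem in_box zero_one[symmetric] by blast
  ultimately show ?thesis
    unfolding persistent_betti_def multicover_complex_def labelled_betti_def by simp
qed

lemma random_box_points: "random_finite_set M (box_points n)"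
  unfolding random_finite_set_def
proof (intro conjI ballI)
  show "finite (box_points n \<omega>)" if "\<omega> \<in> space M" for \<omega>
    unfolding box_points_def box_eq_cbox by (rule finite_imageI[OF finite_points_in[OF that bounded_cbox]])
  fix U :: "'n labelled set" assume U: "U \<in> sets borel"
  have "{\<omega>\<in>space M. \<not> (X i \<omega> \<in> box n \<and> (X i \<omega>, label (mark i \<omega>)) \<in> U)} \<in> sets M" for i
  proof (intro sets.sets_Collect_neg sets.sets_Collect_conj)
    show "{\<omega>\<in>space M. X i \<omega> \<in> box n} \<in> sets M"
      by (rule measurable_sets_Collect[OF X_measurable]) (simp add: box_eq_cbox)
    have "(\<lambda>\<omega>. (X i \<omega>, label (mark i \<omega>))) \<in> borel_measurable M"
      by (intro borel_measurable_Pair X_measurable measurable_compose[OF mark_measurable label_measurable])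
    then show "{\<omega>\<in>space M. (X i \<omega>, label (mark i \<omega>)) \<in> U} \<in> sets M"
      by (rule measurable_sets_Collect) (use U in simp)
  qed
  then have "{\<omega>\<in>space M. \<forall>i. \<not> (X i \<omega> \<in> box n \<and> (X i \<omega>, label (mark i \<omega>)) \<in> U)} \<in> sets M"
    by (rule sets.sets_Collect_countable_All)
  also have "{\<omega>\<in>space M. \<forall>i. \<not> (X i \<omega> \<in> box n \<and> (X i \<omega>, label (mark i \<omega>)) \<in> U)} = {\<omega>\<in>space M. box_points n \<omega> \<inter> U = {}}"
    unfolding box_points_def by (intro Collect_cong conj_cong refl) auto
  finally show "{\<omega>\<in>space M. box_points n \<omega> \<inter> U = {}} \<in> sets M" .
qed

text \<open>The box is closed while the cells are half open; the upper faces of the box have volume \<open>0\<close> and almost surely contain no points.\<close>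
lemma AE_no_boundary_points: "AE \<omega> in M. \<forall>i. \<not> (X i \<omega> \<in> box n \<and> (\<exists>j. X i \<omega> $ j = real n))"
proof -
  interpret prob_space M by (rule prob_space_M)
  define Z where "Z = box n \<inter> (\<Union>j\<in>UNIV. {x. axis j 1 \<bullet> x = real n})"
  have Z_iff: "x \<in> Z \<longleftrightarrow> x \<in> box n \<and> (\<exists>j. x $ j = real n)" for x
    unfolding Z_def by (simp add: inner_axis' )
  have "closed Z"
    unfolding Z_def box_eq_cbox by (intro closed_Int closed_cbox closed_UN finite ballI closed_hyperplane)
  then have Zb: "Z \<in> sets borel" by (rule borel_closed)
  have Zd: "bounded Z" unfolding Z_def box_eq_cbox by (rule bounded_Int) (simp add: bounded_cbox)
  have "negligible (\<Union>j\<in>UNIV. {x :: real ^ 'n::{finite,linorder}. axis j 1 \<bullet> x = real n})"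
    by (intro negligible_Union) (auto intro!: negligible_hyperplane)
  then have "negligible Z" by (rule negligible_subset) (simp add: Z_def)
  then have "measure lebesgue Z = 0" by (rule negligible_imp_measure0)
  then have Z0: "measure lborel Z = 0" using Zb by (simp add: measure_completion)
  have "prob {\<omega>\<in>space M. point_count X Z \<omega> = 0} = 1"
    unfolding point_count_distr[OF Zb Zd] Z0 by simp
  then have "AE \<omega> in M. \<omega> \<in> {\<omega>\<in>space M. point_count X Z \<omega> = 0}" by (rule AE_prob_1)
  then show ?thesis
  proof (rule AE_mp, intro AE_I2 impI allI)
    fix \<omega> i assume "\<omega> \<in> space M" "\<omega> \<in> {\<omega>\<in>space M. point_count X Z \<omega> = 0}"
    then have "{i. X i \<omega> \<in> Z} = {}"
      using finite_points_in[OF _ Zd] unfolding point_count_def by simp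
    then show "\<not> (X i \<omega> \<in> box n \<and> (\<exists>j. X i \<omega> $ j = real n))" using Z_iff by blast
  qed
qed

lemma box_points_assemble:
  assumes "\<forall>i. \<not> (X i \<omega> \<in> box n \<and> (\<exists>j. X i \<omega> $ j = real n))"
  shows "box_points n \<omega> = assemble (lattice_cube n) (\<lambda>z. cell_points z \<omega>)"
proof -
  have inside: "X i \<omega> \<in> box n \<longleftrightarrow> (\<exists>z\<in>lattice_cube n. X i \<omega> \<in> cell z)" for i
  proof
    assume b: "X i \<omega> \<in> box n"
    define z :: "int ^ 'n::{finite,linorder}" where "z = (\<chi> j. \<lfloor>X i \<omega> $ j\<rfloor>)"
    have "0 \<le> z $ j \<and> z $ j < int n" for j
    proof -
      have "0 \<le> X i \<omega> $ j" "X i \<omega> $ j \<le> real n" "X i \<omega> $ j \<noteq> real n" using b assms unfolding box_def by blast+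
      then show ?thesis unfolding z_def by (simp add: floor_less_iff)
    qed
    then have "z \<in> lattice_cube n" by (simp add: lattice_cube_def)
    moreover have "X i \<omega> \<in> cell z" unfolding cell_def z_def by simp
    ultimately show "\<exists>z\<in>lattice_cube n. X i \<omega> \<in> cell z" by blast
  next
    assume "\<exists>z\<in>lattice_cube n. X i \<omega> \<in> cell z"
    then obtain z where z: "z \<in> lattice_cube n" "X i \<omega> \<in> cell z" by blast
    have "0 \<le> X i \<omega> $ j \<and> X i \<omega> $ j \<le> real n" for j
    proof -
      have "0 \<le> z $ j" "z $ j + 1 \<le> int n" using z(1) by (auto simp: lattice_cube_def dest: spec[of _ j])
      then have "0 \<le> real_of_int (z $ j)" "real_of_int (z $ j) + 1 \<le> real n" by linarith+
      moreover have "real_of_int (z $ j) \<le> X i \<omega> $ j" "X i \<omega> $ j < real_of_int (z $ j) + 1" using z(2) unfolding cell_def by blast+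
      ultimately show ?thesis by linarith
    qed
    then show "X i \<omega> \<in> box n" by (simp add: box_def)
  qed
  have mv: "move (embed z) (cell_points z \<omega>) = (\<lambda>i. (X i \<omega>, label (mark i \<omega>))) ` {i. X i \<omega> \<in> cell z}" for z
    unfolding move_def cell_points_image image_image by simp
  show ?thesis
    unfolding box_points_def assemble_def mv image_UN[symmetric]
    by (rule arg_cong[where f = "image _"]) (use inside in blast)
qed

theorem central_limit_theorem_betti:
  "\<exists>\<sigma>\<ge>0. weak_conv_m
    (\<lambda>n. distr M borel (\<lambda>\<omega>. (real (labelled_betti (box_points n \<omega>)) - prob_space.expectation M (\<lambda>\<omega>. real (labelled_betti (box_points n \<omega>))))
        / real n powr (real CARD('n) / 2)))
    (centered_normal \<sigma>)"
proof -
  interpret prob_space M by (rule prob_space_M)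
  interpret F: stabilizing_field cell_law window_betti increment_bound by (rule stabilizing)
  let ?c = "\<lambda>\<omega> z. cell_points z \<omega>"
  let ?\<beta> = "\<lambda>n \<omega>. real (labelled_betti (box_points n \<omega>))"
  have ae: "AE \<omega> in M. ?\<beta> n \<omega> = window_betti (lattice_cube n) (?c \<omega>)" for n
    using AE_no_boundary_points[of n] by eventually_elim (simp add: box_points_assemble window_betti_def)
  have bm: "?\<beta> n \<in> borel_measurable M" for n by (rule betti_measurable[OF random_box_points])
  have wm: "window_betti (lattice_cube n) \<in> borel_measurable \<Omega>" for n by (rule F.F_measurable[OF card_lattice_cube(1)])
  have wc: "(\<lambda>\<omega>. window_betti (lattice_cube n) (?c \<omega>)) \<in> borel_measurable M" for n
    by (rule measurable_compose[OF cells_measurable wm])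
  have mean: "expectation (?\<beta> n) = F.mean n" for n
  proof -
    have "expectation (?\<beta> n) = expectation (\<lambda>\<omega>. window_betti (lattice_cube n) (?c \<omega>))"
      by (rule integral_cong_AE[OF bm wc ae])
    also have "\<dots> = (LINT \<omega>|distr M \<Omega> ?c. window_betti (lattice_cube n) \<omega>)"
      by (rule integral_distr[symmetric, OF cells_measurable wm])
    finally show ?thesis unfolding distr_cells F.mean_def .
  qed
  have nm: "F.normalized n \<in> borel_measurable \<Omega>" for n
    unfolding F.normalized_def[abs_def] by (intro borel_measurable_divide borel_measurable_diff wm) auto
  have law: "distr M borel (\<lambda>\<omega>. (?\<beta> n \<omega> - expectation (?\<beta> n)) / real n powr (real CARD('n) / 2)) = distr \<Omega> borel (F.normalized n)" for n
  proof -
    have "distr M borel (\<lambda>\<omega>. (?\<beta> n \<omega> - expectation (?\<beta> n)) / real n powr (real CARD('n) / 2)) = distr M borel (F.normalized n \<circ> ?c)"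
    proof (rule distr_cong_AE[OF refl refl])
      show "AE \<omega> in M. (?\<beta> n \<omega> - expectation (?\<beta> n)) / real n powr (real CARD('n) / 2) = (F.normalized n \<circ> ?c) \<omega>"
        using ae[of n] by eventually_elim (simp add: mean F.normalized_def F.scale_def)
      show "(\<lambda>\<omega>. (?\<beta> n \<omega> - expectation (?\<beta> n)) / real n powr (real CARD('n) / 2)) \<in> borel_measurable M"
        by (intro borel_measurable_divide borel_measurable_diff bm) auto
      show "F.normalized n \<circ> ?c \<in> borel_measurable M" by (rule measurable_comp[OF cells_measurable nm])
    qed
    also have "\<dots> = distr (distr M \<Omega> ?c) borel (F.normalized n)" by (rule distr_distr[symmetric, OF nm cells_measurable])
    finally show ?thesis unfolding distr_cells .
  qed
  obtain \<sigma> where \<sigma>: "0 \<le> \<sigma>" "\<forall>t. (\<lambda>n. char (distr \<Omega> borel (F.normalized n)) t) \<longlonglongrightarrow> complex_of_real (exp (- (\<sigma> * t)\<^sup>2 / 2))"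
    using F.central_limit_char by blast
  have "weak_conv_m (\<lambda>n. distr \<Omega> borel (F.normalized n)) (centered_normal \<sigma>)"
  proof (rule levy_continuity)
    show "real_distribution (distr \<Omega> borel (F.normalized n))" for n
      by (rule prob_space.real_distribution_distr[OF F.prob_space_P nm])
    show "(\<lambda>n. char (distr \<Omega> borel (F.normalized n)) t) \<longlonglongrightarrow> char (centered_normal \<sigma>) t" for t
      unfolding char_centered_normal(2)[OF \<sigma>(1)] using \<sigma>(2) by blast
  qed (rule char_centered_normal(1)[OF \<sigma>(1)])
  then show ?thesis unfolding law using \<sigma>(1) by blast
qed

end

theorem theorem3p2:
  fixes M :: "'w measure"
    and X :: "nat \<Rightarrow> 'w \<Rightarrow> real ^ 'n::{finite,linorder}"
    and mark :: "nat \<Rightarrow> 'w \<Rightarrow> real"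
    and T q :: nat
    and l :: real
    and b d :: "real \<times> real \<times> nat"
  defines "\<beta> \<equiv> (\<lambda>n \<omega>. real (persistent_betti (\<lambda>i. X i \<omega>) (\<lambda>i. mark i \<omega>) n q b d))"
  assumes "T \<ge> 1"
    and "independently_marked_poisson M X mark T l"
    and "q \<le> CARD('n)"
    and "b \<in> filtration_index T" and "d \<in> filtration_index T" and "filtration_le b d"
  shows "\<exists>s\<ge>0. weak_conv_m
    (\<lambda>n. distr M borel
       (\<lambda>\<omega>. (\<beta> n \<omega> - prob_space.expectation M (\<beta> n)) / real n powr (real CARD('n) / 2)))
    (centered_normal s)"
proof -
  obtain r s k where b: "b = (r, s, k)" by (cases b)
  obtain r' s' k' where d: "d = (r', s', k')" by (cases d)
  have par: "0 \<le> r" "r \<le> r'" "r' \<le> real T" "k' \<le> k" "1 \<le> k'" "s \<le> s'"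
    using assms(5-7) unfolding b d filtration_index_def filtration_le_def by auto
  interpret betti_field M X mark T l s s' r r' k k' q
    by unfold_locales (use assms(3) par in auto)
  show ?thesis
    using central_limit_theorem_betti unfolding \<beta>_def b d persistent_betti_eq .
qed

end
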